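(* For real $x>1/2$ let $$f_4(x)=\frac{e^{\pi ix}(7x-2)\,\Gamma(x+1)^3}{(2x-1)\,x^2\,\Gamma(3x+1)}.$$ Then the following series converge and $$\sum_{k=1}^\infty f_4'(k)=\frac 72\zeta(3)-\frac{\pi^3}{12}i,\qquad \sum_{k=1}^\infty f_4''(k)=7\pi\zeta(3)i-15\zeta(4),$$ $$\sum_{k=1}^\infty f_4'''(k)=279\zeta(5)-21\pi^2\zeta(3)-\frac23\pi^5i,$$ $$\sum_{k=1}^\infty f_4^{(4)}(k)=6\big(56\zeta(3)^2-75\zeta(6)\big)+4\pi i\big(279\zeta(5)-14\pi^2\zeta(3)\big),$$ $$\sum_{k=1}^\infty f_4^{(5)}(k)=360\big(127\zeta(7)+21\zeta(3)\zeta(4)-93\zeta(2)\zeta(5)\big)+60\pi i\big(28\zeta(3)^2-111\zeta(6)\big),$$ $$\frac1{72}\sum_{k=1}^\infty f_4^{(6)}(k)=61\zeta(8)-84\zeta(2)\zeta(3)^2+1680\zeta(3)\zeta(5)-408\zeta(5,3)+30\pi i\big(127\zeta(7)-62\zeta(2)\zeta(5)\big),$$ $$\frac1{168}\sum_{k=1}^\infty f_4^{(7)}(k)=5\big(17009\zeta(9)+224\zeta(3)^3-13716\zeta(2)\zeta(7)-336\zeta(3)\zeta(6)+5022\zeta(4)\zeta(5)\big)+3\pi i\big(1680\zeta(3)\zeta(5)-408\zeta(5,3)-560\zeta(2)\zeta(3)^2-2039\zeta(8)\big).$$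
   Context: $i=\sqrt{-1}$, $e^{\pi i x}=\cos(\pi x)+i\sin(\pi x)$, $\Gamma$ is Euler's gamma function, and $f^{(m)}$ (also $f',f'',f'''$) is the $m$-th derivative of the complex-valued function $f$ of the real variable $x$. $\zeta(s)=\sum_{n\ge1}n^{-s}$ is the Riemann zeta function and $\zeta(5,3)=\sum_{k_1>k_2>0}\frac{1}{k_1^5k_2^3}$.
   Formalization: In the identity for the sum of f_4^(6)(k), the printed coefficient 84 of ζ(2)ζ(3)^2 is a misprint that makes the identity false; the formal statement has the correct coefficient 840. *)

theory Defs
  imports "HOL-Analysis.Analysis"
begin

text \<open>Used only for \<^prop>\<open>Re s > 1\<close>, where the series converges absolutely.\<close>

definition zeta :: "complex \<Rightarrow> complex" where
  "zeta s = (\<Sum>n. of_nat (Suc n) powr (- s))"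

text \<open>The convention is that the larger summation index carries the first exponent.\<close>

definition double_zeta :: "nat \<Rightarrow> nat \<Rightarrow> complex" where
  "double_zeta a b =
     (\<Sum>\<^sub>\<infinity>(k, l)\<in>{(k, l). k > l \<and> l > 0}. 1 / (of_nat k ^ a * of_nat l ^ b))"

text \<open>
  The \<open>m\<close>-th derivative of a complex-valued function of a real variable. (The library's
  \<^const>\<open>deriv\<close> is limited to functions from a field to itself.)
\<close>

definition nth_deriv :: "nat \<Rightarrow> (real \<Rightarrow> complex) \<Rightarrow> real \<Rightarrow> complex" where
  "nth_deriv m f = ((\<lambda>g x. vector_derivative g (at x)) ^^ m) f"

text \<open>
  Only the values for \<open>x > 1/2\<close> matter: the derivatives are taken at the integers \<open>k \<ge> 1\<close>,
  which are interior points of that half-line.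
\<close>

definition f4 :: "real \<Rightarrow> complex" where
  "f4 x = exp (of_real pi * \<i> * of_real x) * of_real (7 * x - 2) * of_real (Gamma (x + 1)) ^ 3 /
          (of_real (2 * x - 1) * of_real x ^ 2 * of_real (Gamma (3 * x + 1)))"

end

theory Submission
  imports Defs "HOL-Complex_Analysis.Complex_Analysis" "HOL-Real_Asymp.Real_Asymp"
begin

text \<open>
  For small real t > 0 the series with terms f4 (k + t), k = 1, 2, ..., telescopes by contiguous relations of a
  hypergeometric series L(u, w) at u = 2t, w = t. The combination of L with a second solution R
  of the same first-order recurrence in w, weighted by reciprocal Gamma factors, is 1-periodic in w, and by
  Liouville's theorem it vanishes identically. Hence the shifted sum is an explicit expression in Gamma
  functions and one power series in t whose coefficients are the multiple zeta values
  zeta(n, 2, ..., 2), and the higher derivatives of f4 are read off from Taylor coefficients at t = 0.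
  The multiple zeta values of depth at most three that occur are reduced to zeta values and
  zeta(5,3) by double shuffle relations; zeta(3,2,2) and zeta(3,2,2,2) come from the limiting case w = 0
  of the same periodicity argument.
\<close>

text \<open>R has poles at the non-negative integers, so the weighted combination of L and R has one
  at w = 1. The added term pi/sin(pi u) times sin(pi (w - u))/sin(pi w) is itself 1-periodic and has
  the opposite residue there. The sum extends to an entire function of at most linear growth, hence
  affine, hence constant by periodicity; the constant is found at w = u, where rGamma(w - u) and
  sin(pi (w - u)) both vanish. On the diagonal u = 2t, w = t the trigonometric quotient is -1 and
  the relation can be solved for L. All this concerns real t > 0, so the closed form is proved on a
  real interval ending at 0 and carried over to formal power series by the identity theorem, after
  multiplication by 4 t^2 to clear denominators. The m-th derivative sum then sits at order m + 2,
  so weights up to 9 occur. Order 9 contains zeta(3,2,2,2), of depth four; the limit w -> 0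
  evaluates it through zeta values, alternating zeta values and Digamma, without depth-four
  shuffles.\<close>

section \<open>Power series of infinite sums of holomorphic functions\<close>

lemma sums_power_series_sum:
  fixes c :: "nat \<Rightarrow> nat \<Rightarrow> complex"
  assumes bound: "\<And>k n. norm (c k n) * r ^ n \<le> M k * q ^ n" and "0 \<le> q" "q < 1" "summable M" "0 \<le> r"
    and z: "norm z \<le> r"
  shows "(\<lambda>n. (\<Sum>k. c k n) * z ^ n) sums (\<Sum>k. \<Sum>n. c k n * z ^ n)"
    and "summable (\<lambda>k. \<Sum>n. c k n * z ^ n)"
proof -
  have nb: "norm (c k n * z ^ n) \<le> M k * q ^ n" for k n
  proof -
    have "norm (c k n * z ^ n) \<le> norm (c k n) * r ^ n"
      unfolding norm_mult norm_power using z by (intro mult_left_mono power_mono) auto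
    also note bound
    finally show ?thesis .
  qed
  have M0: "0 \<le> M k" for k using order_trans [OF norm_ge_zero nb [of k 0]] by simp
  have q: "summable (\<lambda>n. q ^ n)" using assms by (intro summable_geometric) auto
  have Mq: "summable (\<lambda>n. M k * q ^ n)" for k
    using q by (rule summable_mult)
  have summ_n: "summable (\<lambda>n. norm (c k n * z ^ n))" for k
    by (rule summable_comparison_test' [OF Mq [of k], of 0]) (simp only: real_norm_def abs_norm_cancel nb)
  have on_n: "(\<lambda>n. norm (c k n * z ^ n)) summable_on UNIV" for k
    by (rule norm_summable_imp_summable_on) (simp only: real_norm_def abs_norm_cancel summ_n)
  have inf_le: "(\<Sum>\<^sub>\<infinity>n. norm (c k n * z ^ n)) \<le> M k * (1 / (1 - q))" for k
  proof -
    have "(\<Sum>\<^sub>\<infinity>n. norm (c k n * z ^ n)) = (\<Sum>n. norm (c k n * z ^ n))"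
      by (rule sums_unique [OF has_sum_imp_sums [OF has_sum_infsum [OF on_n]]])
    also have "\<dots> \<le> (\<Sum>n. M k * q ^ n)"
      by (rule suminf_le [OF nb summ_n Mq])
    also have "\<dots> = M k * (\<Sum>n. q ^ n)"
      by (rule suminf_mult [OF q])
    also have "(\<Sum>n. q ^ n) = 1 / (1 - q)"
      using assms(2,3) by (intro suminf_geometric) simp
    finally show ?thesis .
  qed
  have "summable (\<lambda>k. M k * (1 / (1 - q)))" using assms(4) by (rule summable_mult2)
  hence summ_k: "summable (\<lambda>k. norm (\<Sum>\<^sub>\<infinity>n. norm (c k n * z ^ n)))"
    by (rule summable_comparison_test' [of _ 0]) (use inf_le in \<open>simp add: infsum_nonneg\<close>)
  have on_k: "(\<lambda>k. norm (\<Sum>\<^sub>\<infinity>n. norm (c k n * z ^ n))) summable_on UNIV"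
    by (rule norm_summable_imp_summable_on) (simp only: real_norm_def abs_abs abs_norm_cancel, rule summ_k [unfolded real_norm_def])
  have "(\<lambda>x. norm (case x of (k, n) \<Rightarrow> c k n * z ^ n)) summable_on UNIV \<times> UNIV"
    unfolding Infinite_Sum.abs_summable_on_Sigma_iff prod.case using on_n on_k by blast
  hence S: "(\<lambda>(k, n). c k n * z ^ n) summable_on UNIV \<times> UNIV" by (rule abs_summable_summable)
  have in_n: "(\<lambda>n. c k n * z ^ n) summable_on UNIV" for k
    using summable_on_SigmaD1 [OF S, of k] by simp
  have in_k: "(\<lambda>k. c k n * z ^ n) summable_on UNIV" for n
    using summable_on_SigmaD1 [OF summable_on_swap [THEN iffD1, OF S], of n] by (simp add: case_prod_unfold)
  have out_k: "(\<lambda>k. \<Sum>\<^sub>\<infinity>n. c k n * z ^ n) summable_on UNIV"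
    using summable_on_Sigma_banach [OF S] by simp
  have out_n: "(\<lambda>n. \<Sum>\<^sub>\<infinity>k. c k n * z ^ n) summable_on UNIV"
    using summable_on_Sigma_banach [OF summable_on_swap [THEN iffD1, OF S]] by (simp add: case_prod_unfold)
  have inf_n: "(\<Sum>\<^sub>\<infinity>n. c k n * z ^ n) = (\<Sum>n. c k n * z ^ n)" for k
    using has_sum_imp_sums [OF has_sum_infsum [OF in_n]] by (rule sums_unique)
  have inf_k: "(\<lambda>k. c k n * z ^ n) sums (\<Sum>\<^sub>\<infinity>k. c k n * z ^ n)" for n
    using in_k by (intro has_sum_imp_sums has_sum_infsum)
  \<comment> \<open>Only \<open>r = 0\<close> with \<open>n > 0\<close> can leave a column
    non-summable; then \<open>z ^ n = 0\<close>, and the default value of the divergent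
    \<open>suminf\<close> is multiplied by zero.\<close>
  have inf_k': "(\<Sum>\<^sub>\<infinity>k. c k n * z ^ n) = (\<Sum>k. c k n) * z ^ n" for n
  proof (cases "summable (\<lambda>k. c k n)")
    case True
    show ?thesis by (rule sums_unique2 [OF inf_k sums_mult2 [OF summable_sums [OF True]]])
  next
    case False
    have "r ^ n = 0"
    proof (rule ccontr)
      assume "r ^ n \<noteq> 0"
      moreover have "0 \<le> r ^ n" using \<open>0 \<le> r\<close> by (rule zero_le_power)
      ultimately have "r ^ n > 0" by linarith
      have le: "norm (c k n) \<le> M k * (q ^ n / r ^ n)" for k
        using bound [of k n] \<open>r ^ n > 0\<close> by (simp add: pos_le_divide_eq)
      have "summable (\<lambda>k. M k * (q ^ n / r ^ n))" using assms(4) by (rule summable_mult2)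
      hence "summable (\<lambda>k. c k n)"
        by (rule summable_comparison_test' [of _ 0]) (rule le)
      with False show False by blast
    qed
    moreover have "norm (z ^ n) \<le> r ^ n" unfolding norm_power using z by (rule power_mono) simp
    ultimately have "z ^ n = 0" by (simp only: norm_le_zero_iff)
    thus ?thesis by (simp only: mult_zero_right infsum_0_simp)
  qed
  have "(\<lambda>n. \<Sum>\<^sub>\<infinity>k. c k n * z ^ n) sums (\<Sum>\<^sub>\<infinity>n. \<Sum>\<^sub>\<infinity>k. c k n * z ^ n)"
    using out_n by (intro has_sum_imp_sums has_sum_infsum)
  also have "(\<Sum>\<^sub>\<infinity>n. \<Sum>\<^sub>\<infinity>k. c k n * z ^ n) = (\<Sum>\<^sub>\<infinity>k. \<Sum>\<^sub>\<infinity>n. c k n * z ^ n)"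
    by (rule infsum_swap_banach [OF S, symmetric])
  also have "\<dots> = (\<Sum>k. \<Sum>n. c k n * z ^ n)"
    using has_sum_imp_sums [OF has_sum_infsum [OF out_k]] unfolding inf_n by (rule sums_unique)
  finally show "(\<lambda>n. (\<Sum>k. c k n) * z ^ n) sums (\<Sum>k. \<Sum>n. c k n * z ^ n)"
    by (simp only: inf_k')
  show "summable (\<lambda>k. \<Sum>n. c k n * z ^ n)"
    using summable_on_imp_summable [OF out_k] by (simp only: inf_n)
qed

lemma has_fps_expansion_suminf:
  fixes c :: "nat \<Rightarrow> nat \<Rightarrow> complex"
  assumes bound: "\<And>k n. norm (c k n) * r ^ n \<le> M k * q ^ n" and "0 \<le> q" "q < 1" "summable M" "0 < r"
    and f: "\<And>z. norm z < r \<Longrightarrow> f z = (\<Sum>k. \<Sum>n. c k n * z ^ n)"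
  shows "f has_fps_expansion Abs_fps (\<lambda>n. \<Sum>k. c k n)"
proof -
  note ps = sums_power_series_sum [OF bound assms(2-4) less_imp_le [OF assms(5)]]
  have "summable (\<lambda>n. fps_nth (Abs_fps (\<lambda>n. \<Sum>k. c k n)) n * of_real r ^ n)"
    using sums_summable [OF ps(1) [of "of_real r"]] assms(5) by simp
  hence "fps_conv_radius (Abs_fps (\<lambda>n. \<Sum>k. c k n)) \<ge> norm (of_real r :: complex)"
    unfolding fps_conv_radius_def by (rule conv_radius_geI)
  moreover have "norm (of_real r :: complex) = r" using assms(5) by simp
  ultimately have "ereal r \<le> fps_conv_radius (Abs_fps (\<lambda>n. \<Sum>k. c k n))" by (simp only:)
  moreover have "0 < ereal r" using assms(5) by simp
  ultimately have "0 < fps_conv_radius (Abs_fps (\<lambda>n. \<Sum>k. c k n))" by (rule less_le_trans [rotated])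
  moreover have "eventually (\<lambda>z. z \<in> ball 0 r) (nhds (0 :: complex))"
    using assms(5) by (intro eventually_nhds_in_open) auto
  hence "eventually (\<lambda>z. eval_fps (Abs_fps (\<lambda>n. \<Sum>k. c k n)) z = f z) (nhds 0)"
  proof eventually_elim
    case (elim z)
    hence z: "norm z < r" by simp
    have "eval_fps (Abs_fps (\<lambda>n. \<Sum>k. c k n)) z = (\<Sum>n. (\<Sum>k. c k n) * z ^ n)"
      by (simp add: eval_fps_def)
    also have "\<dots> = (\<Sum>k. \<Sum>n. c k n * z ^ n)"
      using ps(1) [of z] z by (intro sums_unique [symmetric]) simp
    finally show ?case using f [OF z] by simp
  qed
  ultimately show ?thesis unfolding has_fps_expansion_def by blast
qed

text \<open>Cauchy's inequality on the disc of radius \<open>R / 2\<close> turns the uniform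
  majorant \<open>M k\<close> into a bound for every coefficient; shrinking further to
  \<open>R / 4\<close> supplies the geometric factor \<open>(1 / 2) ^ n\<close> that makes the
  double series absolutely convergent.\<close>

lemma has_fps_expansion_suminf_holomorphic:
  fixes f :: "nat \<Rightarrow> complex \<Rightarrow> complex"
  assumes holo: "\<And>k. f k holomorphic_on ball 0 R" and "0 < R"
    and bound: "\<And>k z. norm z < R \<Longrightarrow> norm (f k z) \<le> M k" and "summable M"
    and F: "\<And>k. f k has_fps_expansion F k"
  shows "(\<lambda>z. \<Sum>k. f k z) has_fps_expansion Abs_fps (\<lambda>n. \<Sum>k. fps_nth (F k) n)"
    and "summable (\<lambda>k. norm (fps_nth (F k) n))"
proof -
  have nth: "norm (fps_nth (F k) n) * (R / 2) ^ n \<le> M k" for k n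
  proof -
    have "norm ((deriv ^^ n) (f k) 0) \<le> fact n * M k / (R / 2) ^ n"
    proof (rule Cauchy_inequality)
      show "f k holomorphic_on ball 0 (R / 2)"
        by (rule holomorphic_on_subset [OF holo]) (use assms(2) in auto)
      show "continuous_on (cball 0 (R / 2)) (f k)"
        by (rule holomorphic_on_imp_continuous_on [OF holomorphic_on_subset [OF holo]]) (use assms(2) in auto)
    qed (use assms(2) bound in auto)
    moreover have "(deriv ^^ n) (f k) 0 = fact n * fps_nth (F k) n"
      using fps_nth_fps_expansion [OF F [of k], of n] by simp
    ultimately have "fact n * norm (fps_nth (F k) n) \<le> fact n * (M k / (R / 2) ^ n)"
      by (simp add: norm_mult)
    hence "norm (fps_nth (F k) n) \<le> M k / (R / 2) ^ n"
      by (subst (asm) mult_le_cancel_left_pos) auto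
    moreover have "(R / 2) ^ n > 0" using assms(2) by simp
    ultimately show ?thesis by (simp only: pos_le_divide_eq)
  qed
  show "(\<lambda>z. \<Sum>k. f k z) has_fps_expansion Abs_fps (\<lambda>n. \<Sum>k. fps_nth (F k) n)"
  proof (rule has_fps_expansion_suminf [where r = "R / 4" and q = "1 / 2" and M = M])
    fix k n
    have "norm (fps_nth (F k) n) * (R / 4) ^ n = norm (fps_nth (F k) n) * (R / 2) ^ n * (1 / 2) ^ n"
      using power_mult_distrib [of "R / 2" "1 / 2" n] by simp
    also have "\<dots> \<le> M k * (1 / 2) ^ n" by (rule mult_right_mono [OF nth]) simp
    finally show "norm (fps_nth (F k) n) * (R / 4) ^ n \<le> M k * (1 / 2) ^ n" .
  next
    fix z :: complex assume z: "norm z < R / 4"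
    have "(\<lambda>n. fps_nth (F k) n * z ^ n) sums f k z" for k
    proof (rule has_fps_expansion_imp_sums_complex [OF F])
      show "f k holomorphic_on eball 0 (ereal R)" using holo [of k] by simp
    qed (use z assms(2) in simp)
    thus "(\<Sum>k. f k z) = (\<Sum>k. \<Sum>n. fps_nth (F k) n * z ^ n)"
      by (simp add: sums_iff)
  qed (use assms in auto)
  have "norm (fps_nth (F k) n) \<le> M k / (R / 2) ^ n" for k
    using nth [of k n] assms(2) by (simp add: pos_le_divide_eq)
  thus "summable (\<lambda>k. norm (fps_nth (F k) n))"
    by (intro summable_comparison_test' [OF summable_divide [OF assms(4)], of 0]) (simp only: real_norm_def abs_norm_cancel)
qed

lemma has_fps_expansion_unique:
  fixes f :: "complex \<Rightarrow> complex"
  assumes "f has_fps_expansion F" "f has_fps_expansion G"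
  shows "F = G"
  using fps_nth_fps_expansion [OF assms(1)] fps_nth_fps_expansion [OF assms(2)] by (simp add: fps_eq_iff)

text \<open>The analytic identities below are available for small positive real arguments only. A
  real segment ending at 0 accumulates there, so the identity theorem makes the two expansions
  equal.\<close>

lemma has_fps_expansion_eq_real:
  fixes f g :: "complex \<Rightarrow> complex"
  assumes f: "f has_fps_expansion F" and g: "g has_fps_expansion G"
    and eq: "\<And>t. 0 < t \<Longrightarrow> t < \<epsilon> \<Longrightarrow> f (of_real t) = g (of_real t)" and "0 < \<epsilon>"
  shows "F = G"
proof -
  have d: "(\<lambda>z. f z - g z) has_fps_expansion F - G" using f g by (rule has_fps_expansion_diff)
  then obtain r where r: "0 < r" "(\<lambda>z. f z - g z) holomorphic_on ball 0 r"
    using has_fps_expansion_imp_analytic_0 analytic_at_ball by blast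
  have lim: "0 islimpt (of_real ` {0<..<min \<epsilon> r} :: complex set)"
    unfolding islimpt_approachable
  proof safe
    fix e :: real assume e: "0 < e"
    define t where "t = min e (min \<epsilon> r) / 2"
    have t: "t > 0" "t < min \<epsilon> r" "t < e" using e r assms(4) by (auto simp: min_def t_def)
    have "of_real t \<in> (of_real ` {0<..<min \<epsilon> r} :: complex set)" using t by (intro imageI) simp
    moreover have "of_real t \<noteq> (0 :: complex)" "dist (of_real t) (0 :: complex) < e" using t by simp_all
    ultimately show "\<exists>x'\<in>of_real ` {0<..<min \<epsilon> r}. x' \<noteq> (0 :: complex) \<and> dist x' 0 < e" by blast
  qed
  have "f z - g z = 0" if "z \<in> ball 0 r" for z
  proof (rule analytic_continuation [OF r(2) _ _ _ _ lim])
    show "of_real ` {0<..<min \<epsilon> r} \<subseteq> (ball 0 r :: complex set)" by auto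
  qed (use that r(1) eq in auto)
  hence "eventually (\<lambda>z. f z - g z = 0) (nhds 0)"
    using r(1) by (intro eventually_mono [OF eventually_nhds_in_open [of "ball 0 r"]]) auto
  hence "(\<lambda>z. f z - g z) has_fps_expansion 0 \<longleftrightarrow> (\<lambda>_. 0 :: complex) has_fps_expansion 0"
    by (rule has_fps_expansion_cong) (rule refl)
  hence "(\<lambda>z. f z - g z) has_fps_expansion 0" by simp
  from has_fps_expansion_unique [OF d this] show ?thesis by simp
qed

text \<open>Stands in for a formal logarithm: together with the constant term, the logarithmic
  derivative \<open>v\<close> determines all coefficients of a Gamma product through a linear
  recursion.\<close>

lemma fps_deriv_eq_log_deriv:
  fixes W V :: "complex \<Rightarrow> complex"
  assumes W: "W has_fps_expansion w" and V: "V has_fps_expansion v"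
    and d: "eventually (\<lambda>z. (W has_field_derivative W z * V z) (at z)) (nhds 0)"
  shows "fps_deriv w = w * v"
proof -
  have "deriv W has_fps_expansion fps_deriv w" using W by (rule has_fps_expansion_deriv)
  moreover have "eventually (\<lambda>z. deriv W z = W z * V z) (nhds 0)"
    using d by eventually_elim (rule DERIV_imp_deriv)
  hence "deriv W has_fps_expansion fps_deriv w \<longleftrightarrow> (\<lambda>z. W z * V z) has_fps_expansion fps_deriv w"
    by (rule has_fps_expansion_cong) (rule refl)
  ultimately have "(\<lambda>z. W z * V z) has_fps_expansion fps_deriv w" by (rule iffD1 [rotated])
  moreover have "(\<lambda>z. W z * V z) has_fps_expansion w * v" using W V by (rule has_fps_expansion_mult)
  ultimately show ?thesis by (rule has_fps_expansion_unique)
qed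

lemma has_fps_expansion_cmult_arg:
  fixes f :: "complex \<Rightarrow> complex"
  assumes "f has_fps_expansion F"
  shows "(\<lambda>z. f (c * z)) has_fps_expansion Abs_fps (\<lambda>n. c ^ n * fps_nth F n)"
proof -
  have "(f \<circ> (\<lambda>z. c * z)) has_fps_expansion (F oo (fps_const c * fps_X))"
    by (intro has_fps_expansion_compose assms has_fps_expansion_cmult_left has_fps_expansion_fps_X) simp
  thus ?thesis by (simp add: o_def fps_compose_linear)
qed

section \<open>Expansions of Digamma and of Gamma quotients at 0\<close>

definition zeta_n :: "nat \<Rightarrow> complex" where
  "zeta_n s = (\<Sum>k. inverse (of_nat (Suc k) ^ s))"

text \<open>The Taylor coefficients are Polygamma values at 1. Euler's constant in order 0 is the
  only entry that is not a zeta value, and it cancels in both Gamma products treated next.\<close>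

lemma has_fps_expansion_Digamma_1:
  "(\<lambda>z. Digamma (1 + z)) has_fps_expansion
     Abs_fps (\<lambda>n. if n = 0 then - euler_mascheroni else (-1) ^ (n + 1) * zeta_n (n + 1))"
proof -
  have "(\<lambda>z :: complex. Digamma (1 + z)) analytic_on {0}"
    by (auto intro!: analytic_intros)
  then obtain F where F: "(\<lambda>z :: complex. Digamma (1 + z)) has_fps_expansion F"
    using analytic_at_imp_has_fps_expansion_0 by blast
  have "fps_nth F n = (if n = 0 then - euler_mascheroni else (-1) ^ (n + 1) * zeta_n (n + 1))" for n
  proof -
    have "fps_nth F n = (deriv ^^ n) (\<lambda>z. Digamma (1 + z)) 0 / fact n"
      by (rule fps_nth_fps_expansion [OF F])
    also have "(deriv ^^ n) (\<lambda>z. Digamma (1 + z)) 0 = (deriv ^^ n) Digamma (1 :: complex)"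
      by (simp add: higher_deriv_shift_0 [of n Digamma] o_def)
    also have "\<dots> = Polygamma n 1" by (subst higher_deriv_Polygamma) auto
    also have "Polygamma n 1 / fact n = (if n = 0 then - euler_mascheroni else (-1) ^ (n + 1) * (zeta_n (n + 1) :: complex))"
      by (auto simp: Polygamma_def zeta_n_def add_ac Digamma_1)
    finally show ?thesis .
  qed
  hence "F = Abs_fps (\<lambda>n. if n = 0 then - euler_mascheroni else (-1) ^ (n + 1) * zeta_n (n + 1))"
    by (simp add: fps_eq_iff)
  thus ?thesis using F by simp
qed


lemma not_nonpos_Ints_1_plus: "norm z < 1 \<Longrightarrow> 1 + z \<notin> \<int>\<^sub>\<le>\<^sub>0" for z :: complex
proof
  assume z: "norm z < 1" "1 + z \<in> \<int>\<^sub>\<le>\<^sub>0"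
  then obtain n where n: "1 + z = of_int n" "n \<le> 0" by (elim nonpos_Ints_cases)
  have "z = (1 + z) - 1" by simp
  also have "\<dots> = of_int n - 1" by (simp only: n)
  finally have "Re z = of_int n - 1" by simp
  moreover have "\<bar>Re z\<bar> < 1" using abs_Re_le_cmod [of z] z(1) by linarith
  ultimately show False using n(2) by linarith
qed

lemma eventually_norm_less: "0 < r \<Longrightarrow> eventually (\<lambda>z :: complex. norm z < r) (nhds 0)"
  using eventually_nhds_in_open [of "ball 0 r" "0 :: complex"] by simp

text \<open>The function is pi z / sin(pi z). Its logarithmic derivative is kept in terms of zeta
  values, so that a later comparison with the sine series yields Euler's formulas for zeta(2), ...,
  zeta(8).\<close>

lemma Gamma_reflected_expansion:
  obtains s where "(\<lambda>z. Gamma (1 + z) * Gamma (1 - z)) has_fps_expansion s" "fps_nth s 0 = 1"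
    "fps_deriv s = s * Abs_fps (\<lambda>n. if odd n then 2 * zeta_n (n + 1) else 0)"
proof -
  define P where "P = (\<lambda>n. if n = 0 then - euler_mascheroni else (-1) ^ (n + 1) * zeta_n (n + 1))"
  have D: "(\<lambda>z. Digamma (1 + z)) has_fps_expansion Abs_fps P"
    using has_fps_expansion_Digamma_1 by (simp add: P_def)
  have "(\<lambda>z :: complex. Gamma (1 + z) * Gamma (1 - z)) analytic_on {0}"
    by (auto intro!: analytic_intros)
  then obtain s where s: "(\<lambda>z :: complex. Gamma (1 + z) * Gamma (1 - z)) has_fps_expansion s"
    using analytic_at_imp_has_fps_expansion_0 by blast
  have "fps_nth s 0 = 1" using has_fps_expansion_imp_0_eq_fps_nth_0 [OF s] by simp
  moreover have V: "(\<lambda>z. Digamma (1 + z) - Digamma (1 + (-1) * z)) has_fps_expansion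
      Abs_fps P - Abs_fps (\<lambda>n. (-1) ^ n * P n)"
    using has_fps_expansion_cmult_arg [OF D, of "-1"] by (intro has_fps_expansion_diff D) simp
  have "fps_deriv s = s * (Abs_fps P - Abs_fps (\<lambda>n. (-1) ^ n * P n))"
  proof (rule fps_deriv_eq_log_deriv [OF s V])
    show "eventually (\<lambda>z. ((\<lambda>z. Gamma (1 + z) * Gamma (1 - z)) has_field_derivative
        Gamma (1 + z) * Gamma (1 - z) * (Digamma (1 + z) - Digamma (1 + (-1) * z))) (at z)) (nhds (0 :: complex))"
      using eventually_norm_less [OF zero_less_one]
    proof eventually_elim
      case (elim z)
      thus ?case
        using not_nonpos_Ints_1_plus [of z] not_nonpos_Ints_1_plus [of "-z"]
        by (auto intro!: derivative_eq_intros simp: algebra_simps)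
    qed
  qed
  moreover have "Abs_fps P - Abs_fps (\<lambda>n. (-1) ^ n * P n) = Abs_fps (\<lambda>n. if odd n then 2 * zeta_n (n + 1) else 0)"
    by (auto simp: fps_eq_iff P_def)
  ultimately show ?thesis using that s by simp
qed

text \<open>The logarithmic derivative is 3 psi(1 + z) - 3 psi(1 + 3z), whose constants cancel.
  Rescaling the argument by 3 multiplies order n by \<open>3 ^ n\<close>, which together with the
  outer factor gives \<open>3 - 3 ^ (n + 1)\<close>.\<close>

lemma Gamma_cube_quotient_expansion:
  obtains g where "(\<lambda>z. Gamma (1 + z) ^ 3 / Gamma (1 + 3 * z)) has_fps_expansion g" "fps_nth g 0 = 1"
    "fps_deriv g = g * Abs_fps (\<lambda>n. if n = 0 then 0 else (-1) ^ (n + 1) * (3 - 3 ^ (n + 1)) * zeta_n (n + 1))"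
proof -
  define P where "P = (\<lambda>n. if n = 0 then - euler_mascheroni else (-1) ^ (n + 1) * zeta_n (n + 1))"
  have D: "(\<lambda>z. Digamma (1 + z)) has_fps_expansion Abs_fps P"
    using has_fps_expansion_Digamma_1 by (simp add: P_def)
  have "(\<lambda>z :: complex. Gamma (1 + z) ^ 3 / Gamma (1 + 3 * z)) analytic_on {0}"
    by (auto intro!: analytic_intros simp: Gamma_eq_zero_iff)
  then obtain s where s: "(\<lambda>z :: complex. Gamma (1 + z) ^ 3 / Gamma (1 + 3 * z)) has_fps_expansion s"
    using analytic_at_imp_has_fps_expansion_0 by blast
  have "fps_nth s 0 = 1" using has_fps_expansion_imp_0_eq_fps_nth_0 [OF s] by simp
  moreover have V: "(\<lambda>z. 3 * Digamma (1 + z) - 3 * Digamma (1 + 3 * z)) has_fps_expansion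
      fps_const 3 * Abs_fps P - fps_const 3 * Abs_fps (\<lambda>n. 3 ^ n * P n)"
    using has_fps_expansion_cmult_arg [OF D, of 3]
    by (intro has_fps_expansion_diff has_fps_expansion_cmult_left D) simp
  have "fps_deriv s = s * (fps_const 3 * Abs_fps P - fps_const 3 * Abs_fps (\<lambda>n. 3 ^ n * P n))"
  proof (rule fps_deriv_eq_log_deriv [OF s V])
    show "eventually (\<lambda>z. ((\<lambda>z. Gamma (1 + z) ^ 3 / Gamma (1 + 3 * z)) has_field_derivative
        Gamma (1 + z) ^ 3 / Gamma (1 + 3 * z) * (3 * Digamma (1 + z) - 3 * Digamma (1 + 3 * z))) (at z)) (nhds (0 :: complex))"
      using eventually_norm_less [of "1 / 3", OF divide_pos_pos [OF zero_less_one zero_less_numeral]]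
    proof eventually_elim
      case (elim z)
      have 1: "1 + z \<notin> \<int>\<^sub>\<le>\<^sub>0" using elim by (intro not_nonpos_Ints_1_plus) simp
      have 3: "1 + 3 * z \<notin> \<int>\<^sub>\<le>\<^sub>0" using elim by (intro not_nonpos_Ints_1_plus) (simp add: norm_mult)
      have nz: "Gamma (1 + 3 * z) \<noteq> 0" using 3 by (simp add: Gamma_eq_zero_iff)
      have "((\<lambda>z. Gamma (1 + z)) has_field_derivative Gamma (1 + z) * Digamma (1 + z)) (at z)"
        using 1 by (auto intro!: derivative_eq_intros)
      moreover have "((\<lambda>z. Gamma (1 + 3 * z)) has_field_derivative Gamma (1 + 3 * z) * Digamma (1 + 3 * z) * 3) (at z)"
        using 3 by (auto intro!: derivative_eq_intros)
      ultimately show ?case using nz 1 3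
        by (auto intro!: derivative_eq_intros simp: field_simps power2_eq_square power3_eq_cube)
    qed
  qed
  moreover have "fps_const 3 * Abs_fps P - fps_const 3 * Abs_fps (\<lambda>n. 3 ^ n * P n) =
      Abs_fps (\<lambda>n. if n = 0 then 0 else (-1) ^ (n + 1) * (3 - 3 ^ (n + 1)) * zeta_n (n + 1))"
    by (auto simp: fps_eq_iff P_def algebra_simps)
  ultimately show ?thesis using that s by simp
qed

section \<open>Generating series of the values zeta(n, 2, ..., 2)\<close>

primrec nested_sum :: "nat \<Rightarrow> nat \<Rightarrow> real" where
  "nested_sum 0 k = 1"
| "nested_sum (Suc i) k = (\<Sum>j<k. nested_sum i j / real (Suc j) ^ 2)"

lemma nested_sum_nonneg: "0 \<le> nested_sum i k"
  by (induction i arbitrary: k) (auto intro!: sum_nonneg)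

lemma nested_sum_le: "\<exists>C. \<forall>k. nested_sum i k \<le> C"
proof (induction i)
  case (Suc i)
  then obtain C where C: "\<And>k. nested_sum i k \<le> C" by blast
  have summ: "summable (\<lambda>j. inverse (real (Suc j) ^ 2))"
    using inverse_power_summable [of 2, where ?'a = real] by (subst summable_Suc_iff) simp
  have "nested_sum (Suc i) k \<le> C * (\<Sum>j. inverse (real (Suc j) ^ 2))" for k
  proof -
    have "nested_sum (Suc i) k \<le> (\<Sum>j<k. C * inverse (real (Suc j) ^ 2))"
      unfolding nested_sum.simps divide_inverse by (intro sum_mono mult_right_mono C) simp
    also have "\<dots> = C * (\<Sum>j<k. inverse (real (Suc j) ^ 2))" by (simp only: sum_distrib_left)
    also have "\<dots> \<le> C * (\<Sum>j. inverse (real (Suc j) ^ 2))"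
      using nested_sum_nonneg [of i 0] C [of 0] by (intro mult_left_mono sum_le_suminf summ) auto
    finally show ?thesis .
  qed
  thus ?case by blast
qed auto

text \<open>\<open>nested_sum i k\<close> is the elementary symmetric polynomial of degree
  \<open>i\<close> in the numbers 1/j^2 with 1 \<le> j \<le> k, so this is zeta(s, 2, ..., 2) with
  \<open>i\<close> twos; the largest summation index is \<open>Suc k\<close>.\<close>

definition zeta_twos :: "nat \<Rightarrow> nat \<Rightarrow> real" where
  "zeta_twos i s = (\<Sum>k. nested_sum i k / real (Suc k) ^ s)"

lemma summable_zeta_twos:
  assumes "2 \<le> s"
  shows "summable (\<lambda>k. nested_sum i k / real (Suc k) ^ s)"
proof -
  obtain C where C: "\<And>k. nested_sum i k \<le> C" using nested_sum_le by blast
  have "summable (\<lambda>k. inverse (real (Suc k) ^ s))"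
    using inverse_power_summable [OF assms, where ?'a = real] by (subst summable_Suc_iff) simp
  hence "summable (\<lambda>k. C * inverse (real (Suc k) ^ s))" by (rule summable_mult)
  thus ?thesis
  proof (rule summable_comparison_test' [of _ 0])
    fix k
    show "norm (nested_sum i k / real (Suc k) ^ s) \<le> C * inverse (real (Suc k) ^ s)"
      using C [of k] nested_sum_nonneg [of i k] by (simp add: divide_inverse mult_right_mono)
  qed
qed

text \<open>Expanding the product produces the elementary symmetric polynomials of the 1/j^2. The
  factor for j = k + 1 either contributes 1 or raises \<open>i\<close> by one, which is the
  recursion of \<open>nested_sum\<close> in \<open>k\<close>.\<close>

lemma prod_expansion:
  fixes \<alpha> :: complex
  shows "(\<lambda>z. \<Prod>j<k. 1 - \<alpha> * z ^ 2 / of_nat (Suc j) ^ 2) has_fps_expansion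
     Abs_fps (\<lambda>n. if even n then (- \<alpha>) ^ (n div 2) * of_real (nested_sum (n div 2) k) else 0)" (is "_ has_fps_expansion ?E k")
proof (induction k)
  case 0
  have "?E 0 = 1"
  proof (rule fps_ext)
    fix n show "fps_nth (?E 0) n = fps_nth 1 n"
      by (cases "n div 2") (auto elim: evenE)
  qed
  thus ?case by simp
next
  case (Suc k)
  have "(\<lambda>z. (\<Prod>j<k. 1 - \<alpha> * z ^ 2 / of_nat (Suc j) ^ 2) - \<alpha> / of_nat (Suc k) ^ 2 * (z ^ 2 * (\<Prod>j<k. 1 - \<alpha> * z ^ 2 / of_nat (Suc j) ^ 2)))
     has_fps_expansion (?E k - fps_const (\<alpha> / of_nat (Suc k) ^ 2) * (fps_X ^ 2 * ?E k))"
    by (intro has_fps_expansion_diff has_fps_expansion_cmult_left has_fps_expansion_mult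
          has_fps_expansion_fps_X_power Suc)
  also have "?E k - fps_const (\<alpha> / of_nat (Suc k) ^ 2) * (fps_X ^ 2 * ?E k) = ?E (Suc k)"
  proof (rule fps_ext)
    fix n :: nat
    have "\<exists>i. n = 2 * i \<or> n = 2 * i + 1" by presburger
    then obtain i where "n = 2 * i \<or> n = 2 * i + 1" ..
    thus "fps_nth (?E k - fps_const (\<alpha> / of_nat (Suc k) ^ 2) * (fps_X ^ 2 * ?E k)) n = fps_nth (?E (Suc k)) n"
      by (cases i) (auto simp: fps_X_power_mult_nth algebra_simps)
  qed
  finally show ?case
    by (simp add: algebra_simps)
qed

lemma geometric_expansion:
  fixes a \<beta> :: complex
  assumes "a \<noteq> 0"
  shows "(\<lambda>z. 1 / (a - \<beta> * z)) has_fps_expansion Abs_fps (\<lambda>m. \<beta> ^ m / a ^ (m + 1))"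
proof -
  let ?A = "fps_const a - fps_const \<beta> * fps_X" and ?B = "Abs_fps (\<lambda>m. \<beta> ^ m / a ^ (m + 1))"
  have "?A * ?B = 1"
  proof (rule fps_ext)
    fix n show "fps_nth (?A * ?B) n = fps_nth 1 n"
      using assms by (cases n) (simp_all add: left_diff_distrib mult.assoc)
  qed
  hence "inverse ?A = ?B" by (rule fps_inverse_unique)
  moreover have "(\<lambda>z. inverse (a - \<beta> * z)) has_fps_expansion inverse ?A"
    by (intro has_fps_expansion_inverse has_fps_expansion_diff has_fps_expansion_const
          has_fps_expansion_cmult_left has_fps_expansion_fps_X) (use assms in simp)
  ultimately show ?thesis by (simp add: inverse_eq_divide)
qed

lemma summable_inverse_Suc_square: "summable (\<lambda>k. inverse (real (Suc k) ^ 2))"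
  using inverse_power_summable [of 2, where ?'a = real] by (subst summable_Suc_iff) simp

lemma norm_prod_le_exp:
  fixes \<alpha> z :: complex
  assumes "norm (\<alpha> * z ^ 2) \<le> 1"
  shows "norm (\<Prod>j<k. 1 - \<alpha> * z ^ 2 / of_nat (Suc j) ^ 2) \<le> exp (\<Sum>j. inverse (real (Suc j) ^ 2))"
proof -
  have "norm (1 - \<alpha> * z ^ 2 / of_nat (Suc j) ^ 2) \<le> exp (inverse (real (Suc j) ^ 2))" for j
  proof -
    have "norm (\<alpha> * z ^ 2 / of_nat (Suc j) ^ 2) = norm (\<alpha> * z ^ 2) / real (Suc j) ^ 2"
      by (simp only: norm_divide norm_power norm_of_nat)
    also have "\<dots> \<le> 1 / real (Suc j) ^ 2" by (rule divide_right_mono [OF assms]) simp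
    finally have "norm (\<alpha> * z ^ 2 / of_nat (Suc j) ^ 2) \<le> inverse (real (Suc j) ^ 2)"
      by (simp only: inverse_eq_divide)
    moreover have "norm (1 - \<alpha> * z ^ 2 / of_nat (Suc j) ^ 2) \<le> 1 + norm (\<alpha> * z ^ 2 / of_nat (Suc j) ^ 2)"
      using norm_triangle_ineq4 [of 1 "\<alpha> * z ^ 2 / of_nat (Suc j) ^ 2"] by (simp only: norm_one)
    moreover have "1 + inverse (real (Suc j) ^ 2) \<le> exp (inverse (real (Suc j) ^ 2))"
      by (rule exp_ge_add_one_self)
    ultimately show ?thesis by linarith
  qed
  hence "norm (\<Prod>j<k. 1 - \<alpha> * z ^ 2 / of_nat (Suc j) ^ 2) \<le> (\<Prod>j<k. exp (inverse (real (Suc j) ^ 2)))"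
    by (subst prod_norm [symmetric]) (intro prod_mono conjI norm_ge_zero)
  also have "\<dots> = exp (\<Sum>j<k. inverse (real (Suc j) ^ 2))" by (rule exp_sum [symmetric]) simp
  also have "\<dots> \<le> exp (\<Sum>j. inverse (real (Suc j) ^ 2))"
    unfolding exp_le_cancel_iff by (intro sum_le_suminf summable_inverse_Suc_square) auto
  finally show ?thesis .
qed

lemma norm_Suc_minus_ge:
  fixes w :: complex
  assumes "norm w \<le> 1 / 2"
  shows "real (Suc k) / 2 \<le> norm (of_nat (Suc k) - w)"
proof -
  have "norm (of_nat (Suc k) :: complex) - norm w \<le> norm (of_nat (Suc k) - w)" by (rule norm_triangle_ineq2)
  thus ?thesis using assms unfolding norm_of_nat by simp
qed

text \<open>This is R with its pole at 0 split off: if \<alpha> z^2 = u^2 and w = \<beta> z, it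
  equals -(R(u,w) + 1/w)/u^2. The pair (4, 1) belongs to the diagonal u = 2z, w = z, and the pair
  (1, 0) to u = z, w = 0.\<close>

definition product_series :: "complex \<Rightarrow> complex \<Rightarrow> complex \<Rightarrow> complex" where
  "product_series \<alpha> \<beta> z = (\<Sum>k. (\<Prod>j<k. 1 - \<alpha> * z ^ 2 / of_nat (Suc j) ^ 2) *
       (1 / of_nat (Suc k) ^ 2 * (1 / (of_nat (Suc k) - \<beta> * z))))"

text \<open>The leading entry \<open>n - i + 3\<close> combines 1/k^2 with the order
  \<open>n - i\<close> term of the geometric series for 1/(k - \<beta> z). The values occurring in
  order \<open>n\<close> therefore all have weight \<open>n + 3\<close>.\<close>

definition product_coeff :: "complex \<Rightarrow> complex \<Rightarrow> nat \<Rightarrow> complex" where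
  "product_coeff \<alpha> \<beta> n = (\<Sum>i=0..n. if even i then (- \<alpha>) ^ (i div 2) * \<beta> ^ (n - i) * of_real (zeta_twos (i div 2) (n - i + 3)) else 0)"

text \<open>The bounds on \<alpha> and \<beta> cover both specialisations. For |z| < 1/2 they give
  |\<alpha> z^2| \<le> 1 and |\<beta> z| \<le> 1/2, which bound the partial products uniformly in
  \<open>k\<close> and keep the denominators away from zero.\<close>

lemma product_series_expansion:
  assumes \<alpha>: "norm \<alpha> \<le> 4" and \<beta>: "norm \<beta> \<le> 1"
  shows "product_series \<alpha> \<beta> has_fps_expansion Abs_fps (product_coeff \<alpha> \<beta>)"
proof -
  let ?S = "exp (\<Sum>j. inverse (real (Suc j) ^ 2))"
  let ?f = "\<lambda>k z. (\<Prod>j<k. 1 - \<alpha> * z ^ 2 / of_nat (Suc j) ^ 2) *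
       (1 / of_nat (Suc k) ^ 2 * (1 / (of_nat (Suc k) - \<beta> * z))) :: complex"
  let ?E = "\<lambda>k. Abs_fps (\<lambda>n. if even n then (- \<alpha>) ^ (n div 2) * of_real (nested_sum (n div 2) k) else 0)"
  let ?F = "\<lambda>k. ?E k * (fps_const (1 / of_nat (Suc k) ^ 2) * Abs_fps (\<lambda>m. \<beta> ^ m / of_nat (Suc k) ^ (m + 1)))"
  have \<beta>z: "norm (\<beta> * z) \<le> 1 / 2" if "norm z < 1 / 2" for z
    using mult_mono [OF \<beta> less_imp_le [OF that]] by (simp add: norm_mult)
  have nz: "of_nat (Suc k) - \<beta> * z \<noteq> 0" if "norm z < 1 / 2" for k z
    using norm_Suc_minus_ge [OF \<beta>z [OF that], of k] by auto
  have "(\<lambda>z. \<Sum>k. ?f k z) has_fps_expansion Abs_fps (\<lambda>n. \<Sum>k. fps_nth (?F k) n)"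
  proof (rule has_fps_expansion_suminf_holomorphic(1) [where R = "1 / 2" and M = "\<lambda>k. ?S * 2 * inverse (real (Suc k) ^ 2)"])
    fix k
    show "?f k holomorphic_on ball 0 (1 / 2)"
      using nz [of _ k] by (intro holomorphic_intros) auto
    show "?f k has_fps_expansion ?F k"
      by (intro has_fps_expansion_mult prod_expansion has_fps_expansion_cmult_left geometric_expansion)
         (simp del: of_nat_Suc)
  next
    fix k and z :: complex assume z: "norm z < 1 / 2"
    have "norm (\<alpha> * z ^ 2) \<le> 4 * (1 / 2) ^ 2"
      unfolding norm_mult norm_power using z \<alpha> by (intro mult_mono power_mono) auto
    hence 1: "norm (\<Prod>j<k. 1 - \<alpha> * z ^ 2 / of_nat (Suc j) ^ 2) \<le> ?S"
      by (intro norm_prod_le_exp) (simp add: power2_eq_square)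
    have "norm (1 / (of_nat (Suc k) - \<beta> * z)) \<le> 1 / (real (Suc k) / 2)"
      unfolding norm_divide norm_one
      using norm_Suc_minus_ge [OF \<beta>z [OF z], of k] by (intro frac_le) (auto simp del: of_nat_Suc)
    also have "\<dots> \<le> 2" by (simp add: divide_simps)
    finally have 2: "norm (1 / (of_nat (Suc k) - \<beta> * z)) \<le> 2" .
    have 3: "norm (1 / of_nat (Suc k) ^ 2 :: complex) = inverse (real (Suc k) ^ 2)"
      by (simp only: norm_divide norm_power norm_of_nat norm_one inverse_eq_divide)
    have "norm (?f k z) \<le> ?S * (inverse (real (Suc k) ^ 2) * 2)"
      unfolding norm_mult [of "\<Prod>j<k. _ j"] norm_mult [of "1 / of_nat (Suc k) ^ 2"] 3
      by (intro mult_mono mult_left_mono 1 2) auto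
    thus "norm (?f k z) \<le> ?S * 2 * inverse (real (Suc k) ^ 2)" by (simp only: mult_ac)
  qed (simp, intro summable_mult summable_inverse_Suc_square)
  moreover have "(\<Sum>k. fps_nth (?F k) n) = product_coeff \<alpha> \<beta> n" for n
  proof -
    let ?g = "\<lambda>i k. (if even i then (- \<alpha>) ^ (i div 2) * \<beta> ^ (n - i) else 0) * of_real (nested_sum (i div 2) k / real (Suc k) ^ (n - i + 3)) :: complex"
    have "fps_nth (?F k) n = (\<Sum>i=0..n. ?g i k)" for k
    proof -
      have "1 / of_nat (Suc k) ^ 2 * (\<beta> ^ m / of_nat (Suc k) ^ (m + 1)) = (\<beta> ^ m / of_nat (Suc k) ^ (m + 3) :: complex)" for m
        by (simp add: power_add power2_eq_square power3_eq_cube del: of_nat_Suc)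
      thus ?thesis
        unfolding fps_mult_nth [of "?E k"] fps_mult_left_const_nth fps_nth_Abs_fps
          of_real_divide of_real_power of_real_of_nat_eq
        by (intro sum.cong refl) (auto simp only: if_True if_False mult_zero_left times_divide_eq_right times_divide_eq_left mult_ac simp_thms split: if_split)
    qed
    hence "(\<Sum>k. fps_nth (?F k) n) = (\<Sum>k. \<Sum>i=0..n. ?g i k)" by (simp only:)
    also have "\<dots> = (\<Sum>i=0..n. \<Sum>k. ?g i k)"
      by (intro suminf_sum summable_mult summable_of_real summable_zeta_twos) simp
    also have "\<dots> = product_coeff \<alpha> \<beta> n"
      unfolding product_coeff_def
    proof (intro sum.cong refl)
      fix i
      have "(\<Sum>k. ?g i k) = (if even i then (- \<alpha>) ^ (i div 2) * \<beta> ^ (n - i) else 0) * of_real (zeta_twos (i div 2) (n - i + 3))"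
        unfolding zeta_twos_def by (subst suminf_mult, intro summable_of_real summable_zeta_twos, simp,
          subst suminf_of_real, rule summable_zeta_twos) simp_all
      thus "(\<Sum>k. ?g i k) = (if even i then (- \<alpha>) ^ (i div 2) * \<beta> ^ (n - i) * of_real (zeta_twos (i div 2) (n - i + 3)) else 0)"
        by simp
    qed
    finally show ?thesis .
  qed
  ultimately show ?thesis by (simp only: product_series_def [abs_def])
qed

section \<open>Alternating sums of squares and alternating zeta values\<close>

definition alternating_squares :: "complex \<Rightarrow> complex" where
  "alternating_squares z = (\<Sum>n. (-1) ^ n * (1 / (of_nat (Suc n) + z)) ^ 2)"

definition eta_value :: "nat \<Rightarrow> complex" where
  "eta_value s = (\<Sum>n. (-1) ^ n * (1 / of_nat (Suc n) ^ s))"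

lemma alternating_squares_expansion:
  "alternating_squares has_fps_expansion Abs_fps (\<lambda>j. (-1) ^ j * of_nat (j + 1) * eta_value (j + 2))"
proof -
  let ?f = "\<lambda>k z. (-1) ^ k * (1 / (of_nat (Suc k) - (-1) * z)) ^ 2 :: complex"
  let ?G = "\<lambda>k. Abs_fps (\<lambda>m. (-1) ^ m / of_nat (Suc k) ^ (m + 1)) :: complex fps"
  have F: "?f k has_fps_expansion fps_const ((-1) ^ k) * ?G k ^ 2" for k
    by (intro has_fps_expansion_cmult_left has_fps_expansion_power geometric_expansion) (simp del: of_nat_Suc)
  have bd: "norm (1 / (of_nat (Suc k) - (-1) * z)) \<le> 2 / real (Suc k)" and nz: "of_nat (Suc k) - (-1) * z \<noteq> 0"
    if z: "norm z < 1 / 2" for k and z :: complex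
  proof -
    have *: "real (Suc k) / 2 \<le> norm (of_nat (Suc k) - (-1) * z)"
      using z by (intro norm_Suc_minus_ge) simp
    hence "norm (1 / (of_nat (Suc k) - (-1) * z)) \<le> 1 / (real (Suc k) / 2)"
      unfolding norm_divide norm_one by (intro frac_le) (auto simp del: of_nat_Suc)
    thus "norm (1 / (of_nat (Suc k) - (-1) * z)) \<le> 2 / real (Suc k)" by (simp del: of_nat_Suc)
    show "of_nat (Suc k) - (-1) * z \<noteq> 0"
    proof
      assume "of_nat (Suc k) - (-1) * z = 0"
      thus False using * by (simp only: norm_zero) simp
    qed
  qed
  have "(\<lambda>z. \<Sum>k. ?f k z) has_fps_expansion Abs_fps (\<lambda>n. \<Sum>k. fps_nth (fps_const ((-1) ^ k) * ?G k ^ 2) n)"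
  proof (rule has_fps_expansion_suminf_holomorphic(1) [OF _ _ _ _ F, where R = "1 / 2" and M = "\<lambda>k. 4 * inverse (real (Suc k) ^ 2)"])
    fix k
    show "?f k holomorphic_on ball 0 (1 / 2)"
      using nz [of _ k] by (intro holomorphic_intros) auto
  next
    fix k and z :: complex assume z: "norm z < 1 / 2"
    have "norm (?f k z) = norm (1 / (of_nat (Suc k) - (-1) * z)) ^ 2"
      by (simp only: norm_mult norm_power norm_minus_cancel norm_one power_one mult_1)
    also have "\<dots> \<le> (2 / real (Suc k)) ^ 2" by (intro power_mono bd z) simp
    also have "\<dots> = 4 * inverse (real (Suc k) ^ 2)" by (simp add: power_divide inverse_eq_divide del: of_nat_Suc)
    finally show "norm (?f k z) \<le> 4 * inverse (real (Suc k) ^ 2)" .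
  qed (simp, intro summable_mult summable_inverse_Suc_square)
  moreover have "(\<Sum>k. fps_nth (fps_const ((-1) ^ k) * ?G k ^ 2) n) = (-1) ^ n * of_nat (n + 1) * eta_value (n + 2)" for n
  proof -
    have "fps_nth (fps_const ((-1) ^ k) * ?G k ^ 2) n = (-1) ^ n * of_nat (n + 1) * ((-1) ^ k * (1 / of_nat (Suc k) ^ (n + 2)))" for k
    proof -
      have "fps_nth (?G k ^ 2) n = (\<Sum>i=0..n. (-1) ^ i / of_nat (Suc k) ^ (i + 1) * ((-1) ^ (n - i) / of_nat (Suc k) ^ (n - i + 1)))"
        by (simp add: power2_eq_square fps_mult_nth del: of_nat_Suc)
      also have "\<dots> = (\<Sum>i=0..n. (-1) ^ n / of_nat (Suc k) ^ (n + 2))"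
      proof (intro sum.cong refl)
        fix i assume "i \<in> {0..n}"
        hence "(-1) ^ n = ((-1) ^ i * (-1) ^ (n - i) :: complex)"
          "of_nat (Suc k) ^ (n + 2) = (of_nat (Suc k) ^ (i + 1) * of_nat (Suc k) ^ (n - i + 1) :: complex)"
          by (simp_all add: power_add [symmetric] del: of_nat_Suc)
        thus "(-1) ^ i / of_nat (Suc k) ^ (i + 1) * ((-1) ^ (n - i) / of_nat (Suc k) ^ (n - i + 1)) =
           ((-1) ^ n / of_nat (Suc k) ^ (n + 2) :: complex)" by (simp only: times_divide_times_eq)
      qed
      finally show ?thesis by simp
    qed
    moreover have "summable (\<lambda>k. (-1) ^ k * (1 / of_nat (Suc k) ^ (n + 2)) :: complex)"
    proof (rule summable_comparison_test' [of "\<lambda>k. inverse (real (Suc k) ^ (n + 2))" 0])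
      show "summable (\<lambda>k. inverse (real (Suc k) ^ (n + 2)))"
        using inverse_power_summable [of "n + 2", where ?'a = real] by (subst summable_Suc_iff) simp
    qed (simp only: norm_mult norm_power norm_minus_cancel norm_one power_one mult_1 norm_divide norm_of_nat inverse_eq_divide order.refl)
    ultimately show ?thesis unfolding eta_value_def by (simp only: suminf_mult)
  qed
  ultimately show ?thesis by (simp add: alternating_squares_def [abs_def])
qed

lemma eta_value_eq:
  assumes "2 \<le> s"
  shows "eta_value s = (1 - 2 / 2 ^ s) * zeta_n s"
proof -
  let ?h = "\<lambda>n. 1 / of_nat (Suc n) ^ s :: complex"
  have summ: "summable (\<lambda>n. inverse (real (Suc n) ^ s))"
    using inverse_power_summable [OF assms, where ?'a = real] by (subst summable_Suc_iff) simp
  have z: "?h sums zeta_n s"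
  proof -
    have "summable ?h"
      by (rule summable_comparison_test' [OF summ, of 0])
         (simp only: norm_power norm_one norm_divide norm_of_nat inverse_eq_divide order.refl)
    thus ?thesis unfolding zeta_n_def inverse_eq_divide by (rule summable_sums)
  qed
  \<comment> \<open>Odd zero-based indices belong to the even denominators
    \<open>2 * m + 2 = 2 * (m + 1)\<close>, which explains the scaling by
    \<open>2 / 2 ^ s\<close>.\<close>
  have odd: "(\<lambda>n. if odd n then 2 * ?h n else 0) sums (2 / 2 ^ s * zeta_n s)"
  proof (subst sums_mono_reindex [of "\<lambda>m. 2 * m + 1", symmetric])
    have "(if odd (2 * m + 1) then 2 * ?h (2 * m + 1) else 0) = 2 / 2 ^ s * ?h m" for m
    proof -
      have "of_nat (Suc (2 * m + 1)) = (2 * of_nat (Suc m) :: complex)" by simp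
      thus ?thesis by (simp add: power_mult_distrib del: of_nat_Suc)
    qed
    thus "(\<lambda>m. if odd (2 * m + 1) then 2 * ?h (2 * m + 1) else 0) sums (2 / 2 ^ s * zeta_n s)"
      using sums_mult [OF z, of "2 / 2 ^ s"] by simp
  qed (auto simp: strict_mono_def elim: oddE)
  have "(\<lambda>n. ?h n - (if odd n then 2 * ?h n else 0)) sums (zeta_n s - 2 / 2 ^ s * zeta_n s)"
    by (rule sums_diff [OF z odd])
  moreover have "?h n - (if odd n then 2 * ?h n else 0) = (-1) ^ n * ?h n" for n
    by simp
  ultimately show ?thesis
    unfolding eta_value_def by (simp add: sums_iff left_diff_distrib)
qed

section \<open>The series L(u, w) and its contiguous relations\<close>

definition gamma_coeff :: "real \<Rightarrow> nat \<Rightarrow> real" where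
  "gamma_coeff u k = Gamma (real k + u) ^ 2 / (fact k * Gamma (real k + 1 + 2 * u))"

lemma gamma_coeff_pos: "0 < u \<Longrightarrow> 0 < gamma_coeff u k"
  unfolding gamma_coeff_def by (intro divide_pos_pos mult_pos_pos zero_less_power Gamma_real_pos) auto

lemma gamma_coeff_nonneg: "0 < u \<Longrightarrow> 0 \<le> gamma_coeff u k"
  using gamma_coeff_pos [of u k] by simp

lemma gamma_coeff_Suc:
  assumes "0 < u"
  shows "(real k + 1) * (real k + 1 + 2 * u) * gamma_coeff u (Suc k) = (real k + u) ^ 2 * gamma_coeff u k"
proof -
  have 1: "Gamma (real (Suc k) + u) = (real k + u) * Gamma (real k + u)"
    using Gamma_plus1 [of "real k + u"] assms nonpos_Ints_nonpos [of "real k + u"] by (force simp: add_ac)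
  have 2: "Gamma (real (Suc k) + 1 + 2 * u) = (real k + 1 + 2 * u) * Gamma (real k + 1 + 2 * u)"
    using Gamma_plus1 [of "real k + 1 + 2 * u"] assms nonpos_Ints_nonpos [of "real k + 1 + 2 * u"]
    by (force simp: add_ac)
  have 3: "Gamma (real k + 1 + 2 * u) > 0" "real k + 1 + 2 * u > 0"
    using assms by (auto intro!: Gamma_real_pos)
  show ?thesis
    unfolding gamma_coeff_def 1 2 using 3 by (simp add: divide_simps)
qed

lemma gamma_coeff_shift:
  assumes "0 < u"
  shows "(real k + 2 + 2 * u) * gamma_coeff (u + 1) k = (real k + 1) * gamma_coeff u (Suc k)"
proof -
  have 2: "Gamma (real k + 1 + 2 * (u + 1)) = (real k + 2 + 2 * u) * Gamma (real (Suc k) + 1 + 2 * u)"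
    using Gamma_plus1 [of "real k + 2 + 2 * u"] assms nonpos_Ints_nonpos [of "real k + 2 + 2 * u"]
    by (force simp: add_ac algebra_simps)
  have 1: "real k + (u + 1) = real (Suc k) + u" by simp
  have 3: "Gamma (real (Suc k) + 1 + 2 * u) > 0" "real k + 2 + 2 * u > 0"
    using assms by (auto intro!: Gamma_real_pos)
  show ?thesis
    unfolding gamma_coeff_def 1 2 using 3 by (simp add: divide_simps)
qed

text \<open>A telescoping form of Gauss's evaluation of 2F1(u, u; 1 + 2u; 1): the partial sums have
  a closed form, so the total needs only the asymptotics of a single term.\<close>

lemma sum_gamma_coeff:
  assumes "0 < u"
  shows "u ^ 2 * (\<Sum>k<n. gamma_coeff u k) = real n * (real n + 2 * u) * gamma_coeff u n"
proof (induction n)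
  case (Suc n)
  have "u ^ 2 * (\<Sum>k<Suc n. gamma_coeff u k) = (real n * (real n + 2 * u) + u ^ 2) * gamma_coeff u n"
    using Suc by (simp add: algebra_simps)
  also have "real n * (real n + 2 * u) + u ^ 2 = (real n + u) ^ 2"
    by (simp add: power2_eq_square algebra_simps)
  also have "(real n + u) ^ 2 * gamma_coeff u n = real (Suc n) * (real (Suc n) + 2 * u) * gamma_coeff u (Suc n)"
    using gamma_coeff_Suc [OF assms, of n] by (simp add: add_ac)
  finally show ?case .
qed auto

text \<open>This is Euler's limit formula for Gamma, read as Gamma(x) divided by its n-th
  approximant tending to 1; no Stirling estimate enters.\<close>

lemma Gamma_shift_ratio:
  assumes "0 < (x :: real)"
  shows "(\<lambda>n. Gamma (x + real n + 1) / (fact n * real n powr x)) \<longlonglongrightarrow> 1"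
proof -
  have x: "x \<notin> \<int>\<^sub>\<le>\<^sub>0" using assms nonpos_Ints_nonpos [of x] by force
  have "(\<lambda>n. Gamma x / Gamma_series x n) \<longlonglongrightarrow> Gamma x / Gamma x"
    using x by (intro tendsto_intros Gamma_series_LIMSEQ) (auto simp: Gamma_eq_zero_iff)
  moreover have "Gamma x / Gamma_series x n = Gamma (x + real n + 1) / (fact n * real n powr x)"
    if "n > 0" for n
  proof -
    have "pochhammer x (Suc n) = Gamma (x + real (Suc n)) / Gamma x"
      using x by (intro pochhammer_Gamma) auto
    thus ?thesis using that x
      by (simp add: Gamma_series_def powr_def Gamma_eq_zero_iff add_ac mult.commute)
  qed
  hence "eventually (\<lambda>n. Gamma x / Gamma_series x n = Gamma (x + real n + 1) / (fact n * real n powr x)) sequentially"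
    using eventually_gt_at_top [of 0] by (rule eventually_mono [rotated]) auto
  ultimately show ?thesis
    using x by (simp add: Gamma_eq_zero_iff tendsto_cong)
qed

text \<open>The square of the ratio for \<open>u\<close> is divided by the ratio for
  \<open>2 * u\<close>, and the powers of n cancel because (n^u)^2 = n^(2u). What remains is the
  claim at index \<open>Suc n\<close>.\<close>

lemma gamma_coeff_asymp:
  assumes "0 < u"
  shows "(\<lambda>n. real n * (real n + 2 * u) * gamma_coeff u n) \<longlonglongrightarrow> 1"
proof -
  have "(\<lambda>n. (Gamma (u + real n + 1) / (fact n * real n powr u)) ^ 2 /
             (Gamma (2 * u + real n + 1) / (fact n * real n powr (2 * u)))) \<longlonglongrightarrow> 1 ^ 2 / 1"
    using assms by (intro tendsto_intros Gamma_shift_ratio) auto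
  moreover have "(Gamma (u + real n + 1) / (fact n * real n powr u)) ^ 2 /
             (Gamma (2 * u + real n + 1) / (fact n * real n powr (2 * u))) =
             real (Suc n) * (real (Suc n) + 2 * u) * gamma_coeff u (Suc n)" if "n > 0" for n
  proof -
    have nonpos: "2 * u + real n + 1 \<notin> \<int>\<^sub>\<le>\<^sub>0"
      using assms nonpos_Ints_nonpos [of "2 * u + real n + 1"] by force
    have 1: "Gamma (real (Suc n) + u) = Gamma (u + real n + 1)" by (simp add: add_ac)
    have "real (Suc n) + 1 + 2 * u = (2 * u + real n + 1) + 1" by simp
    hence 2: "Gamma (real (Suc n) + 1 + 2 * u) = (real (Suc n) + 2 * u) * Gamma (2 * u + real n + 1)"
      using Gamma_plus1 [OF nonpos] by (simp add: add_ac)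
    have 3: "Gamma (2 * u + real n + 1) \<noteq> 0"
      using nonpos by (simp add: Gamma_eq_zero_iff)
    have 4: "real n powr (2 * u) = (real n powr u) ^ 2"
      unfolding mult_2 powr_add power2_eq_square ..
    have 5: "real n powr u \<noteq> 0" "real (Suc n) + 2 * u \<noteq> 0"
      using that assms by simp_all
    have *: "(A / (F * p)) ^ 2 / (B / (F * p ^ 2)) = m * c * (A ^ 2 / (m * F * (c * B)))"
      if "F \<noteq> 0" "B \<noteq> 0" "p \<noteq> 0" "m \<noteq> 0" "c \<noteq> 0" for A B F p m c :: real
      using that by (simp add: divide_simps power2_eq_square)
    show ?thesis unfolding gamma_coeff_def 1 2 4 fact_Suc
      by (rule *) (use 3 5 in simp_all)
  qed
  hence "eventually (\<lambda>n. (Gamma (u + real n + 1) / (fact n * real n powr u)) ^ 2 /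
             (Gamma (2 * u + real n + 1) / (fact n * real n powr (2 * u))) =
             real (Suc n) * (real (Suc n) + 2 * u) * gamma_coeff u (Suc n)) sequentially"
    using eventually_gt_at_top [of 0] by (rule eventually_mono [rotated]) auto
  ultimately have "(\<lambda>n. real (Suc n) * (real (Suc n) + 2 * u) * gamma_coeff u (Suc n)) \<longlonglongrightarrow> 1 ^ 2 / 1"
    by (rule Lim_transform_eventually)
  hence "(\<lambda>n. real (Suc n) * (real (Suc n) + 2 * u) * gamma_coeff u (Suc n)) \<longlonglongrightarrow> 1"
    by (simp del: of_nat_Suc)
  thus ?thesis by (rule filterlim_sequentially_Suc [THEN iffD1])
qed

lemma gamma_coeff_sums:
  assumes "0 < u"
  shows "gamma_coeff u sums (1 / u ^ 2)"
proof -
  have "(\<lambda>n. real n * (real n + 2 * u) * gamma_coeff u n / u ^ 2) \<longlonglongrightarrow> 1 / u ^ 2"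
    using assms by (intro tendsto_intros gamma_coeff_asymp) auto
  moreover have "real n * (real n + 2 * u) * gamma_coeff u n / u ^ 2 = (\<Sum>k<n. gamma_coeff u k)" for n
    using sum_gamma_coeff [OF assms, of n] assms by (simp add: field_simps)
  ultimately show ?thesis by (simp add: sums_def)
qed

text \<open>Up to a factor independent of k this is 3F2(u, u, u + w; 1 + 2u, u + w + 1; 1). It is
  polymorphic in \<open>w\<close> because the telescoping of the f4 series takes place over the
  reals and the periodicity argument over the complex numbers.\<close>

definition gamma_series :: "real \<Rightarrow> 'a \<Rightarrow> 'a :: {real_normed_field, banach}" where
  "gamma_series u w = (\<Sum>k. of_real (gamma_coeff u k) / (of_nat k + of_real u + w))"

lemma summable_divide_shift:
  fixes w :: "'a :: {real_normed_field, banach}"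
  assumes "summable (\<lambda>k. norm (f k))"
  shows "summable (\<lambda>k. f k / (of_nat k + w))"
proof (rule summable_comparison_test_ev [OF _ assms])
  obtain N :: nat where N: "real N \<ge> norm w + 1" using real_arch_simple by blast
  have "norm (f k / (of_nat k + w)) \<le> norm (f k)" if "k \<ge> N" for k
  proof -
    have "norm (of_nat k :: 'a) - norm w \<le> norm (of_nat k + w)" by (rule norm_diff_ineq)
    moreover have "real k \<ge> real N" using that by simp
    ultimately have "norm (of_nat k + w) \<ge> 1" using N by (simp only: norm_of_nat)
    thus ?thesis
      using divide_left_mono [of 1 "norm (of_nat k + w)" "norm (f k)"]
      by (cases "of_nat k + w = 0") (auto simp: norm_divide)
  qed
  thus "eventually (\<lambda>k. norm (f k / (of_nat k + w)) \<le> norm (f k)) sequentially"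
    by (rule eventually_sequentiallyI)
qed

lemma summable_gamma_series:
  fixes w :: "'a :: {real_normed_field, banach}"
  assumes "0 < u"
  shows "summable (\<lambda>k. of_real (gamma_coeff u k) / (of_nat k + of_real u + w))"
proof -
  have "summable (\<lambda>k. norm (of_real (gamma_coeff u k) :: 'a))"
    using sums_summable [OF gamma_coeff_sums [OF assms]] gamma_coeff_nonneg [OF assms] by simp
  from summable_divide_shift [OF this, of "of_real u + w"] show ?thesis by (simp add: add_ac)
qed

lemma of_real_add_nonzero:
  fixes w :: "'a :: real_normed_field"
  shows "w \<notin> of_real ` {..-u} \<Longrightarrow> of_nat k + of_real u + w \<noteq> 0"
proof
  assume w: "w \<notin> of_real ` {..-u}" and "of_nat k + of_real u + w = 0"
  hence "w = - (of_nat k + of_real u)" by (metis add.inverse_inverse add_eq_0_iff)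
  hence "w = of_real (- u - real k)" by simp
  moreover have "- u - real k \<in> {..-u}" by simp
  ultimately show False using w by blast
qed

text \<open>Creative telescoping with certificate \<open>H\<close>. Dividing (k+u)^2 - u^2 by k + u
  + w leaves the remainder w^2 - u^2, and dividing (k+u)^2 by k + u + w + 1 leaves (w+1)^2. The two
  quotients differ by 1, so the inhomogeneity is the total of the coefficients, 1/u^2.\<close>

lemma gamma_series_shift_w:
  fixes w :: "'a :: {real_normed_field, banach}"
  assumes "0 < u" "w \<notin> of_real ` {..-u}"
  shows "(w ^ 2 - of_real (u ^ 2)) * gamma_series u w - (w + 1) ^ 2 * gamma_series u (w + 1) = - of_real (1 / u ^ 2)"
proof -
  let ?s = "\<lambda>k. of_nat k + of_real u :: 'a"
  let ?F = "\<lambda>k. of_real (gamma_coeff u k) + (w ^ 2 - of_real (u ^ 2)) * (of_real (gamma_coeff u k) / (?s k + w))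
       - (w + 1) ^ 2 * (of_real (gamma_coeff u k) / (?s k + (w + 1)))"
  define H where "H k = of_real (real k * (real k + 2 * u) * gamma_coeff u k) / (?s k + w)" for k
  have nz: "?s k + w \<noteq> 0" for k using of_real_add_nonzero [OF assms(2)] by blast
  have nz': "?s k + (w + 1) \<noteq> 0" for k using nz [of "Suc k"] by (simp add: add_ac)
  have H_Suc: "H (Suc k) = ?s k ^ 2 * of_real (gamma_coeff u k) / (?s k + (w + 1))" for k
  proof -
    have "real (Suc k) * (real (Suc k) + 2 * u) * gamma_coeff u (Suc k) = (real k + u) ^ 2 * gamma_coeff u k"
      using gamma_coeff_Suc [OF assms(1), of k] by (simp add: add_ac)
    thus ?thesis by (simp add: H_def add_ac)
  qed
  have H0: "H k = (?s k ^ 2 - of_real u ^ 2) * of_real (gamma_coeff u k) / (?s k + w)" for k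
    by (simp add: H_def power2_eq_square algebra_simps)
  have "H \<longlonglongrightarrow> 0"
  proof -
    have "(\<lambda>k. of_real (real k * (real k + 2 * u) * gamma_coeff u k) :: 'a) \<longlonglongrightarrow> of_real 1"
      by (intro tendsto_of_real gamma_coeff_asymp assms)
    moreover have "(\<lambda>k. inverse (of_nat k + (of_real u + w))) \<longlonglongrightarrow> 0"
      by (rule filterlim_compose [OF tendsto_inverse_0
            tendsto_add_filterlim_at_infinity' [OF tendsto_of_nat tendsto_const]])
    ultimately have "(\<lambda>k. of_real (real k * (real k + 2 * u) * gamma_coeff u k) * inverse (of_nat k + (of_real u + w))) \<longlonglongrightarrow> of_real 1 * 0"
      by (rule tendsto_mult)
    thus ?thesis by (simp add: H_def [abs_def] divide_inverse add_ac)
  qed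
  hence "(\<lambda>k. H k - H (Suc k)) sums (H 0 - 0)" by (rule telescope_sums')
  also have "(\<lambda>k. H k - H (Suc k)) = ?F"
  proof
    fix k
    let ?X = "(w ^ 2 - of_real u ^ 2) / (?s k + w)" and ?Y = "(w + 1) ^ 2 / (?s k + (w + 1))"
    have X: "(?s k ^ 2 - of_real u ^ 2) / (?s k + w) = ?s k - w + ?X"
    proof -
      have "?s k ^ 2 - of_real u ^ 2 = (?s k - w) * (?s k + w) + (w ^ 2 - of_real u ^ 2)"
        by (simp add: power2_eq_square algebra_simps)
      thus ?thesis using nz [of k] by (metis add_divide_distrib nonzero_mult_div_cancel_right)
    qed
    have Y: "?s k ^ 2 / (?s k + (w + 1)) = ?s k - w - 1 + ?Y"
    proof -
      have "?s k ^ 2 = (?s k - w - 1) * (?s k + (w + 1)) + (w + 1) ^ 2"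
        by (simp add: power2_eq_square algebra_simps)
      thus ?thesis using nz' [of k] by (metis add_divide_distrib nonzero_mult_div_cancel_right)
    qed
    have "H k - H (Suc k) = of_real (gamma_coeff u k) *
        ((?s k ^ 2 - of_real u ^ 2) / (?s k + w) - ?s k ^ 2 / (?s k + (w + 1)))"
      unfolding H_Suc unfolding H0 by (simp add: algebra_simps)
    also have "\<dots> = of_real (gamma_coeff u k) * (1 + ?X - ?Y)"
      unfolding X Y by simp
    also have "\<dots> = of_real (gamma_coeff u k) + (w ^ 2 - of_real (u ^ 2)) * (of_real (gamma_coeff u k) / (?s k + w))
       - (w + 1) ^ 2 * (of_real (gamma_coeff u k) / (?s k + (w + 1)))"
      by (simp add: ring_distribs mult.commute)
    finally show "H k - H (Suc k) = \<dots>" .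
  qed
  finally have 1: "?F sums 0" by (simp add: H_def)
  have 2: "?F sums (of_real (1 / u ^ 2) + (w ^ 2 - of_real (u ^ 2)) * gamma_series u w - (w + 1) ^ 2 * gamma_series u (w + 1))"
    unfolding gamma_series_def
    by (intro sums_add sums_diff sums_mult sums_of_real gamma_coeff_sums summable_sums summable_gamma_series assms)
  from sums_unique2 [OF 1 2] show ?thesis by (simp add: algebra_simps)
qed

lemma gamma_series_shift_u:
  fixes w :: "'a :: {real_normed_field, banach}"
  assumes "0 < u" "w \<notin> of_real ` {..-u}"
  shows "(1 + of_real u - w) * gamma_series (u + 1) w + (of_real u + w) * gamma_series u w =
     of_real (1 / u ^ 2 - 1 / (u + 1) ^ 2)"
proof -
  \<comment> \<open>\<open>c\<close> is \<open>gamma_coeff (u + 1)\<close> moved up by one index, so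
    that both series acquire the denominators k + u + w. Since \<open>c 0 = 0\<close>, the shift
    does not change the sum.\<close>
  define c where "c k = real k / (real k + 1 + 2 * u) * gamma_coeff u k" for k
  have nz: "of_nat k + of_real u + w \<noteq> 0" for k using of_real_add_nonzero [OF assms(2)] by blast
  have c_Suc: "c (Suc k) = gamma_coeff (u + 1) k" for k
  proof -
    have nz: "real k + 2 + 2 * u \<noteq> 0" using assms(1) by simp
    have eq: "real (Suc k) + 1 + 2 * u = real k + 2 + 2 * u" "real (Suc k) = real k + 1" by simp_all
    have "(real k + 2 + 2 * u) * c (Suc k) = (real k + 1) * gamma_coeff u (Suc k)"
      unfolding c_def eq using nz by (simp add: add_ac)
    also have "\<dots> = (real k + 2 + 2 * u) * gamma_coeff (u + 1) k"
      by (rule gamma_coeff_shift [OF assms(1), symmetric])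
    finally show ?thesis using nz by (rule mult_left_cancel [THEN iffD1, rotated])
  qed
  have c0: "c 0 = 0" by (simp add: c_def)
  have "(\<lambda>k. c (Suc k)) sums (1 / (u + 1) ^ 2)"
    unfolding c_Suc using assms(1) by (intro gamma_coeff_sums) simp
  hence c: "c sums (1 / (u + 1) ^ 2)"
    unfolding sums_Suc_iff c0 by simp
  have Lc: "(\<lambda>k. of_real (c k) / (of_nat k + of_real u + w)) sums gamma_series (u + 1) w"
  proof -
    have "(\<lambda>k. of_real (gamma_coeff (u + 1) k) / (of_nat k + of_real (u + 1) + w)) sums gamma_series (u + 1) w"
      unfolding gamma_series_def using assms by (intro summable_sums summable_gamma_series) auto
    also have "(\<lambda>k. of_real (gamma_coeff (u + 1) k) / (of_nat k + of_real (u + 1) + w)) =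
       (\<lambda>k. of_real (c (Suc k)) / (of_nat (Suc k) + of_real u + w))"
      by (simp add: c_Suc add_ac)
    finally show ?thesis
      by (subst (asm) sums_Suc_iff) (simp add: c0)
  qed
  have L: "(\<lambda>k. of_real (gamma_coeff u k) / (of_nat k + of_real u + w)) sums gamma_series u w"
    unfolding gamma_series_def using assms by (intro summable_sums summable_gamma_series) auto
  have "(\<lambda>k. (1 + of_real u - w) * (of_real (c k) / (of_nat k + of_real u + w)) +
       (of_real u + w) * (of_real (gamma_coeff u k) / (of_nat k + of_real u + w))) sums
       ((1 + of_real u - w) * gamma_series (u + 1) w + (of_real u + w) * gamma_series u w)"
    by (intro sums_add sums_mult Lc L)
  also have "(\<lambda>k. (1 + of_real u - w) * (of_real (c k) / (of_nat k + of_real u + w)) +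
       (of_real u + w) * (of_real (gamma_coeff u k) / (of_nat k + of_real u + w))) =
       (\<lambda>k. of_real (gamma_coeff u k - c k))"
  proof
    fix k
    have "real k + 1 + 2 * u \<noteq> 0" using assms(1) by simp
    hence "(real k + 1 + 2 * u) * c k = real k * gamma_coeff u k"
      unfolding c_def by simp
    hence "of_real ((real k + 1 + 2 * u) * c k) = (of_real (real k * gamma_coeff u k) :: 'a)"
      by (rule arg_cong)
    hence *: "(of_nat k + 1 + 2 * of_real u) * of_real (c k) = (of_nat k * of_real (gamma_coeff u k) :: 'a)"
      by (simp only: of_real_mult of_real_add of_real_of_nat_eq of_real_1 of_real_numeral)
    have "(1 + of_real u - w) * of_real (c k) + (of_real u + w) * of_real (gamma_coeff u k) =
          of_real (gamma_coeff u k - c k) * (of_nat k + of_real u + w)"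
      using * by (simp add: algebra_simps)
    thus "(1 + of_real u - w) * (of_real (c k) / (of_nat k + of_real u + w)) +
       (of_real u + w) * (of_real (gamma_coeff u k) / (of_nat k + of_real u + w)) = of_real (gamma_coeff u k - c k)"
      using nz [of k] by (simp add: divide_simps)
  qed
  finally have 1: "(\<lambda>k. of_real (gamma_coeff u k - c k) :: 'a) sums
       ((1 + of_real u - w) * gamma_series (u + 1) w + (of_real u + w) * gamma_series u w)" .
  have 2: "(\<lambda>k. of_real (gamma_coeff u k - c k) :: 'a) sums of_real (1 / u ^ 2 - 1 / (u + 1) ^ 2)"
    by (intro sums_of_real sums_diff gamma_coeff_sums c assms)
  from sums_unique2 [OF 1 2] show ?thesis .
qed

section \<open>The second solution R(u, w)\<close>

definition sine_product :: "real \<Rightarrow> nat \<Rightarrow> real" where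
  "sine_product u n = (\<Prod>j<n. 1 - u ^ 2 / (real j + 1) ^ 2)"

text \<open>These are (u)_k (-u)_k / (k!)^2, the terms of 2F1(u, -u; 1; 1). They are written through
  \<open>sine_product\<close> because their partial sums are exactly the partial products of Euler's
  sine formula.\<close>

definition sine_coeff :: "real \<Rightarrow> nat \<Rightarrow> real" where
  "sine_coeff u k = (case k of 0 \<Rightarrow> 1 | Suc n \<Rightarrow> - (u ^ 2 / (real n + 1) ^ 2) * sine_product u n)"

lemma sine_coeff_simps: "sine_coeff u 0 = 1" "sine_coeff u (Suc n) = - (u ^ 2 / (real n + 1) ^ 2) * sine_product u n"
  by (simp_all add: sine_coeff_def)

lemma sine_product_Suc: "sine_product u (Suc n) = sine_product u n * (1 - u ^ 2 / (real n + 1) ^ 2)"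
  by (simp add: sine_product_def)

lemma sine_coeff_Suc: "(real k + 1) ^ 2 * sine_coeff u (Suc k) = (real k ^ 2 - u ^ 2) * sine_coeff u k"
proof (cases k)
  case (Suc n)
  show ?thesis using Suc by (simp add: sine_coeff_simps sine_product_Suc field_simps)
qed (simp add: sine_coeff_simps sine_product_def)

lemma sum_sine_coeff: "(\<Sum>k\<le>n. sine_coeff u k) = sine_product u n"
  by (induction n) (simp_all add: sine_coeff_simps sine_product_Suc sine_product_def algebra_simps)

lemma sine_product_bounds:
  assumes "0 \<le> u" "u < 1"
  shows "0 \<le> sine_product u n" "sine_product u n \<le> 1"
proof -
  have "u ^ 2 / (real j + 1) ^ 2 \<le> 1" for j
  proof -
    have "u ^ 2 \<le> 1 ^ 2" "(1 :: real) ^ 2 \<le> (real j + 1) ^ 2"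
      by (rule power_mono; use assms in simp)+
    hence "u ^ 2 \<le> (real j + 1) ^ 2" by linarith
    thus ?thesis by (simp add: divide_le_eq)
  qed
  thus "0 \<le> sine_product u n" "sine_product u n \<le> 1"
    unfolding sine_product_def by (auto intro!: prod_nonneg prod_le_1)
qed

lemma sine_product_limit:
  assumes "0 < u"
  shows "sine_product u \<longlonglongrightarrow> sin (pi * u) / (pi * u)"
proof -
  have "(\<lambda>n. pi * u * (\<Prod>k=1..n. 1 - u ^ 2 / real k ^ 2) / (pi * u)) \<longlonglongrightarrow> sin (pi * u) / (pi * u)"
    by (intro tendsto_divide sin_product_formula_real tendsto_const) (use assms in auto)
  also have "(\<lambda>n. pi * u * (\<Prod>k=1..n. 1 - u ^ 2 / real k ^ 2) / (pi * u)) = sine_product u"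
    using assms by (simp add: fun_eq_iff sine_product_def prod.atLeast1_atMost_eq add_ac)
  finally show ?thesis .
qed

lemma sine_coeff_sums:
  assumes "0 < u"
  shows "sine_coeff u sums (sin (pi * u) / (pi * u))"
  using sine_product_limit [OF assms] by (simp add: sums_def_le sum_sine_coeff)

lemma norm_sine_coeff_le:
  assumes "0 < u" "u < 1"
  shows "\<bar>sine_coeff u (Suc k)\<bar> \<le> inverse ((real k + 1) ^ 2)"
proof -
  have "u ^ 2 \<le> 1 ^ 2" using assms by (intro power_mono) auto
  hence "u ^ 2 * sine_product u k \<le> 1 * 1"
    using sine_product_bounds [of u k] assms by (intro mult_mono) auto
  thus ?thesis
    using sine_product_bounds [of u k] assms
    by (simp add: sine_coeff_simps abs_mult divide_inverse mult_left_le_one_le mult.commute mult.left_commute)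
qed

lemma summable_inverse_square: "summable (\<lambda>k. inverse ((real k + 1) ^ 2))"
  using summable_iff_shift [of "\<lambda>k. inverse (real k ^ 2)" 1] inverse_power_summable [of 2, where ?'a = real]
  by (simp add: add_ac)

lemma summable_abs_sine_coeff:
  assumes "0 < u" "u < 1"
  shows "summable (\<lambda>k. \<bar>sine_coeff u k\<bar>)"
proof -
  have "summable (\<lambda>k. \<bar>sine_coeff u (Suc k)\<bar>)"
    by (rule summable_comparison_test' [OF summable_inverse_square, of 0]) (use norm_sine_coeff_le assms in auto)
  thus ?thesis by (rule summable_Suc_iff [THEN iffD1])
qed

definition sine_series :: "real \<Rightarrow> 'a \<Rightarrow> 'a :: {real_normed_field, banach}" where
  "sine_series u w = (\<Sum>k. of_real (sine_coeff u k) / (of_nat k - w))"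

lemma summable_sine_series:
  fixes w :: "'a :: {real_normed_field, banach}"
  assumes "0 < u" "u < 1"
  shows "summable (\<lambda>k. of_real (sine_coeff u k) / (of_nat k - w))"
  using summable_divide_shift [of "\<lambda>k. of_real (sine_coeff u k)" "- w"] summable_abs_sine_coeff [OF assms] by simp

text \<open>Same certificate method and the same homogeneous part as for L. The inhomogeneities,
  -1/u^2 there and sin(pi u)/(pi u) here, do not depend on w, so adding pi/(u sin(pi u)) times R to
  L makes the recurrence homogeneous.\<close>

lemma sine_series_shift_w:
  fixes w :: "'a :: {real_normed_field, banach}"
  assumes "0 < u" "u < 1" "w \<notin> range of_nat" "w + 1 \<notin> range of_nat"
  shows "(w ^ 2 - of_real (u ^ 2)) * sine_series u w - (w + 1) ^ 2 * sine_series u (w + 1) =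
     of_real (sin (pi * u) / (pi * u))"
proof -
  let ?n = "\<lambda>k. of_nat k :: 'a"
  let ?F = "\<lambda>k. of_real (sine_coeff u k) + (w + 1) ^ 2 * (of_real (sine_coeff u k) / (?n k - (w + 1)))
       - (w ^ 2 - of_real (u ^ 2)) * (of_real (sine_coeff u k) / (?n k - w))"
  define H where "H k = of_real (real k ^ 2 * sine_coeff u k) / (?n k - (w + 1))" for k
  have nz: "?n k - w \<noteq> 0" "?n k - (w + 1) \<noteq> 0" for k
    using assms(3,4) by (metis range_eqI right_minus_eq)+
  have H_Suc: "H (Suc k) = (?n k ^ 2 - of_real u ^ 2) * of_real (sine_coeff u k) / (?n k - w)" for k
  proof -
    have "real (Suc k) ^ 2 * sine_coeff u (Suc k) = (real k ^ 2 - u ^ 2) * sine_coeff u k"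
      using sine_coeff_Suc [of k u] by (simp add: add_ac)
    thus ?thesis by (simp add: H_def)
  qed
  have H0: "H k = ?n k ^ 2 * of_real (sine_coeff u k) / (?n k - (w + 1))" for k
    by (simp add: H_def)
  have "H \<longlonglongrightarrow> 0"
  proof (rule Lim_null_comparison)
    show "(\<lambda>k. norm (inverse (?n k + (- (w + 1))))) \<longlonglongrightarrow> 0"
      by (intro tendsto_norm_zero filterlim_compose [OF tendsto_inverse_0
            tendsto_add_filterlim_at_infinity' [OF tendsto_of_nat tendsto_const]])
    have "norm (H k) \<le> norm (inverse (?n k + (- (w + 1))))" for k
    proof -
      have "real k ^ 2 * \<bar>sine_coeff u k\<bar> \<le> 1"
      proof (cases k)
        case (Suc n)
        have "real k ^ 2 * \<bar>sine_coeff u k\<bar> \<le> real k ^ 2 * inverse ((real n + 1) ^ 2)"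
          using norm_sine_coeff_le [OF assms(1,2), of n] Suc by (intro mult_left_mono) auto
        also have "\<dots> = 1" using Suc by (simp add: field_simps)
        finally show ?thesis .
      qed auto
      hence "norm (of_real (real k ^ 2 * sine_coeff u k) :: 'a) \<le> 1"
        by (simp only: norm_of_real abs_mult abs_power2 power_abs)
      hence "norm (of_real (real k ^ 2 * sine_coeff u k) :: 'a) * norm (inverse (?n k + (- (w + 1)))) \<le>
             1 * norm (inverse (?n k + (- (w + 1))))"
        by (rule mult_right_mono) simp
      thus ?thesis by (simp only: H_def divide_inverse norm_mult diff_conv_add_uminus mult_1)
    qed
    thus "eventually (\<lambda>k. norm (H k) \<le> norm (inverse (?n k + (- (w + 1))))) sequentially"
      by simp
  qed
  hence "(\<lambda>k. H k - H (Suc k)) sums (H 0 - 0)" by (rule telescope_sums')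
  also have "(\<lambda>k. H k - H (Suc k)) = ?F"
  proof
    fix k
    let ?X = "(w ^ 2 - of_real u ^ 2) / (?n k - w)" and ?Y = "(w + 1) ^ 2 / (?n k - (w + 1))"
    have X: "(?n k ^ 2 - of_real u ^ 2) / (?n k - w) = ?n k + w + ?X"
    proof -
      have "?n k ^ 2 - of_real u ^ 2 = (?n k + w) * (?n k - w) + (w ^ 2 - of_real u ^ 2)"
        by (simp add: power2_eq_square algebra_simps)
      thus ?thesis using nz(1) [of k] by (metis add_divide_distrib nonzero_mult_div_cancel_right)
    qed
    have Y: "?n k ^ 2 / (?n k - (w + 1)) = ?n k + w + 1 + ?Y"
    proof -
      have "?n k ^ 2 = (?n k + w + 1) * (?n k - (w + 1)) + (w + 1) ^ 2"
        by (simp add: power2_eq_square algebra_simps)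
      thus ?thesis using nz(2) [of k] by (metis add_divide_distrib nonzero_mult_div_cancel_right)
    qed
    have "H k - H (Suc k) = of_real (sine_coeff u k) *
        (?n k ^ 2 / (?n k - (w + 1)) - (?n k ^ 2 - of_real u ^ 2) / (?n k - w))"
      unfolding H_Suc unfolding H0 by (simp add: algebra_simps)
    also have "\<dots> = of_real (sine_coeff u k) * (1 + ?Y - ?X)"
      unfolding X Y by simp
    also have "\<dots> = ?F k"
      by (simp add: ring_distribs mult.commute diff_divide_distrib)
    finally show "H k - H (Suc k) = ?F k" .
  qed
  finally have 1: "?F sums 0" by (simp add: H_def)
  have 2: "?F sums (of_real (sin (pi * u) / (pi * u)) + (w + 1) ^ 2 * sine_series u (w + 1) -
             (w ^ 2 - of_real (u ^ 2)) * sine_series u w)"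
    unfolding sine_series_def
    by (intro sums_add sums_diff sums_mult sums_of_real sine_coeff_sums summable_sums summable_sine_series assms)
  from sums_unique2 [OF 1 2] show ?thesis by (simp add: algebra_simps)
qed

section \<open>The reciprocal Gamma weight, and holomorphy of L and R\<close>

definition rGamma_quot :: "real \<Rightarrow> complex \<Rightarrow> complex" where
  "rGamma_quot u w = rGamma (w - of_real u) * rGamma (w + of_real u) / rGamma w ^ 2"

text \<open>Chosen to match the homogeneous recurrence (w^2 - u^2) D(w) = (w+1)^2 D(w+1):
  multiplying it by \<open>rGamma_quot u (w + 1)\<close> shows that w^2
  \<open>rGamma_quot u w\<close> D(w) has period 1.\<close>

lemma rGamma_quot_shift:
  assumes "w \<noteq> 0" "w + 1 \<notin> \<int>\<^sub>\<le>\<^sub>0"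
  shows "w ^ 2 * rGamma_quot u w = (w ^ 2 - of_real (u ^ 2)) * rGamma_quot u (w + 1)"
proof -
  have "rGamma (w - of_real u) = (w - of_real u) * rGamma (w + 1 - of_real u)"
       "rGamma (w + of_real u) = (w + of_real u) * rGamma (w + 1 + of_real u)"
       "rGamma w = w * rGamma (w + 1)"
    using rGamma_plus1 [of "w - of_real u"] rGamma_plus1 [of "w + of_real u"] rGamma_plus1 [of w]
    by (simp_all add: algebra_simps)
  moreover have "rGamma (w + 1) \<noteq> 0" using assms by (simp add: rGamma_eq_zero_iff)
  ultimately show ?thesis using assms
    by (simp add: rGamma_quot_def divide_simps) (simp add: power2_eq_square algebra_simps)
qed

text \<open>In Euler's limit the powers of n cancel because (w - u) + (w + u) = 2w, and the quotient
  becomes an infinite product. That form gives a bound independent of the imaginary part of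
  w.\<close>

lemma rGamma_quot_LIMSEQ:
  assumes "w \<notin> \<int>\<^sub>\<le>\<^sub>0"
  shows "(\<lambda>n. \<Prod>j\<le>n. 1 - of_real (u ^ 2) / (w + of_nat j) ^ 2) \<longlonglongrightarrow> rGamma_quot u w"
proof -
  have "(\<lambda>n. rGamma_series (w - of_real u) n * rGamma_series (w + of_real u) n / rGamma_series w n ^ 2)
          \<longlonglongrightarrow> rGamma_quot u w"
    unfolding rGamma_quot_def using assms
    by (intro tendsto_intros) (auto simp: rGamma_eq_zero_iff)
  moreover have "rGamma_series (w - of_real u) n * rGamma_series (w + of_real u) n / rGamma_series w n ^ 2 =
     (\<Prod>j\<le>n. 1 - of_real (u ^ 2) / (w + of_nat j) ^ 2)" if "n > 0" for n
  proof -
    have nz: "w + of_nat j \<noteq> 0" for j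
      using assms plus_of_nat_eq_0_imp by blast
    define Q where "Q = (\<Prod>j\<le>n. 1 - of_real (u ^ 2) / (w + of_nat j) ^ 2)"
    let ?e = "\<lambda>z. exp (z * of_real (ln (real n)))"
    have e: "?e (w - of_real u) * ?e (w + of_real u) = ?e w ^ 2"
      by (simp add: power2_eq_square algebra_simps flip: exp_add)
    have "pochhammer (w - of_real u) (Suc n) * pochhammer (w + of_real u) (Suc n) =
          pochhammer w (Suc n) ^ 2 * Q"
    proof -
      have "(w - of_real u + of_nat j) * (w + of_real u + of_nat j) =
         (w + of_nat j) ^ 2 * (1 - of_real (u ^ 2) / (w + of_nat j) ^ 2)" for j
        using nz [of j] by (simp add: right_diff_distrib) (simp add: power2_eq_square algebra_simps)
      thus ?thesis
        unfolding pochhammer_prod Q_def by (simp add: prod.distrib [symmetric] prod_power_distrib atLeast0LessThan lessThan_Suc_atMost)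
    qed
    moreover have "pochhammer w (Suc n) \<noteq> 0" using nz by (metis pochhammer_eq_0_iff add.left_inverse)
    ultimately show ?thesis using e unfolding Q_def [symmetric]
      by (simp add: rGamma_series_def divide_simps power2_eq_square)
  qed
  ultimately show ?thesis
    by (rule Lim_transform_eventually [OF _ eventually_mono [OF eventually_gt_at_top [of 0]]])
qed

lemma holomorphic_on_suminf:
  fixes f :: "nat \<Rightarrow> complex \<Rightarrow> complex"
  assumes "open S" "\<And>k. f k holomorphic_on S" "\<And>k w. w \<in> S \<Longrightarrow> norm (f k w) \<le> M k" "summable M"
  shows "(\<lambda>w. \<Sum>k. f k w) holomorphic_on S"
proof (rule holomorphic_uniform_sequence [where f = "\<lambda>n w. \<Sum>k<n. f k w"])
  fix x assume "x \<in> S"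
  with assms(1) obtain d where d: "d > 0" "cball x d \<subseteq> S" by (auto simp: open_contains_cball)
  have "uniform_limit (cball x d) (\<lambda>n w. \<Sum>k<n. f k w) (\<lambda>w. \<Sum>k. f k w) sequentially"
    by (rule Weierstrass_m_test) (use assms(3,4) d in auto)
  with d show "\<exists>d>0. cball x d \<subseteq> S \<and> uniform_limit (cball x d) (\<lambda>n w. \<Sum>k<n. f k w) (\<lambda>w. \<Sum>k. f k w) sequentially"
    by blast
qed (use assms in \<open>auto intro!: holomorphic_intros\<close>)

lemma gamma_series_holomorphic:
  assumes "0 < u"
  shows "gamma_series u holomorphic_on {w. - (u / 2) < Re w}"
proof -
  have nz: "of_nat k + of_real u + w \<noteq> 0" and ge: "u / 2 \<le> norm (of_nat k + of_real u + w)" if "- (u / 2) < Re w" for w k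
  proof -
    have "u / 2 \<le> Re (of_nat k + of_real u + w)" using that assms by simp
    also have "\<dots> \<le> norm (of_nat k + of_real u + w)" by (rule complex_Re_le_cmod)
    finally show "u / 2 \<le> norm (of_nat k + of_real u + w)" .
    with assms show "of_nat k + of_real u + w \<noteq> 0" by auto
  qed
  show ?thesis unfolding gamma_series_def [abs_def]
  proof (rule holomorphic_on_suminf [where M = "\<lambda>k. gamma_coeff u k / (u / 2)"])
    show "summable (\<lambda>k. gamma_coeff u k / (u / 2))"
      using gamma_coeff_sums [OF assms] by (intro summable_divide) (rule sums_summable)
    fix k and w :: complex assume w: "w \<in> {w. - (u / 2) < Re w}"
    hence "norm (of_nat k + of_real u + w) \<noteq> 0" using nz [of w k] by simp
    hence "norm (of_nat k + of_real u + w) > 0" using norm_ge_zero by (metis less_eq_real_def)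
    thus "norm (of_real (gamma_coeff u k) / (of_nat k + of_real u + w)) \<le> gamma_coeff u k / (u / 2)"
      using ge [of w k] w gamma_coeff_nonneg [OF assms, of k] assms
      unfolding norm_divide norm_of_real by (intro frac_le) auto
  qed (use nz in \<open>auto intro!: holomorphic_intros open_halfspace_Re_gt\<close>)
qed

text \<open>R without the terms for k = 0 and k = 1, the only ones with a pole in the half-plane Re
  w < 7/4.\<close>

definition sine_series_tail :: "real \<Rightarrow> complex \<Rightarrow> complex" where
  "sine_series_tail u w = (\<Sum>k. of_real (sine_coeff u (k + 2)) / (of_nat (k + 2) - w))"

text \<open>Valid for every \<open>w\<close>: at the poles 0 and 1 division by zero removes the
  singular term on both sides alike. The case w = 0 is used later.\<close>

lemma sine_series_split:
  assumes "0 < u" "u < 1"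
  shows "sine_series u w = - 1 / w - of_real (u ^ 2) / (1 - w) + sine_series_tail u w"
proof -
  have "sine_series u w = sine_series_tail u w + (\<Sum>k<2. of_real (sine_coeff u k) / (of_nat k - w))"
    unfolding sine_series_def sine_series_tail_def by (rule suminf_split_initial_segment [OF summable_sine_series [OF assms]])
  thus ?thesis using sine_coeff_simps(2) [of u 0] by (simp add: numeral_2_eq_2 sine_coeff_simps(1) sine_product_def)
qed

lemma sine_series_tail_holomorphic:
  assumes "0 < u" "u < 1"
  shows "sine_series_tail u holomorphic_on {w. Re w < 7/4}"
proof -
  have ge: "1 / 4 \<le> norm (of_nat (k + 2) - w)" if "Re w < 7/4" for w k
  proof -
    have "1 / 4 \<le> Re (of_nat (k + 2) - w)" using that by simp
    also have "\<dots> \<le> norm (of_nat (k + 2) - w)" by (rule complex_Re_le_cmod)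
    finally show ?thesis .
  qed
  show ?thesis unfolding sine_series_tail_def [abs_def]
  proof (rule holomorphic_on_suminf [where M = "\<lambda>k. \<bar>sine_coeff u (k + 2)\<bar> / (1 / 4)"])
    show "summable (\<lambda>k. \<bar>sine_coeff u (k + 2)\<bar> / (1 / 4))"
      using summable_iff_shift [of "\<lambda>k. \<bar>sine_coeff u k\<bar>" 2] summable_abs_sine_coeff [OF assms] by (intro summable_divide) simp
    fix k and w :: complex assume w: "w \<in> {w. Re w < 7/4}"
    have "1 / 4 \<le> norm (of_nat (k + 2) - w)" by (rule ge) (use w in simp)
    hence "norm (of_nat (k + 2) - w) > 0" by linarith
    thus "norm (of_real (sine_coeff u (k + 2)) / (of_nat (k + 2) - w)) \<le> \<bar>sine_coeff u (k + 2)\<bar> / (1 / 4)"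
      unfolding norm_divide norm_of_real using ge [of w k] w by (intro divide_left_mono) auto
  next
    fix k
    have "of_nat (k + 2) - w \<noteq> 0" if "Re w < 7/4" for w
    proof -
      have "norm (of_nat (k + 2) - w) > 0" using ge [of w k] that by linarith
      thus ?thesis by (simp only: zero_less_norm_iff not_False_eq_True)
    qed
    thus "(\<lambda>w. of_real (sine_coeff u (k + 2)) / (of_nat (k + 2) - w)) holomorphic_on {w. Re w < 7/4}"
      by (intro holomorphic_intros) auto
  qed (rule open_halfspace_Re_lt)
qed

section \<open>Periodicity and vanishing of the combination\<close>

definition periodic_comb :: "real \<Rightarrow> complex \<Rightarrow> complex" where
  "periodic_comb u w = w ^ 2 * rGamma_quot u w * (gamma_series u w + of_real (pi / (u * sin (pi * u))) * sine_series u w) +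
     of_real (pi / sin (pi * u)) * sin (of_real pi * (w - of_real u)) / sin (of_real pi * w)"

lemma sin_pi_pos: "0 < u \<Longrightarrow> u < 1 \<Longrightarrow> 0 < sin (pi * u)"
  by (rule sin_gt_zero) auto

lemma sin_complex_pi_eq_0: "sin (of_real pi * w) = 0 \<longleftrightarrow> w \<in> \<int>"
  for w :: complex
proof -
  have "sin (of_real pi * w) = 0 \<longleftrightarrow> (\<exists>n::int. of_real pi * w = of_real (of_int n * pi))"
    by (subst sin_eq_0) (simp add: mult.commute)
  also have "\<dots> \<longleftrightarrow> (\<exists>n::int. w = of_int n)"
    by (simp add: mult.commute)
  also have "\<dots> \<longleftrightarrow> w \<in> \<int>" by (auto elim: Ints_cases)
  finally show ?thesis .
qed

lemma Re_pos_nonpos_Ints: "0 < Re w \<Longrightarrow> w \<notin> \<int>\<^sub>\<le>\<^sub>0"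
  by (auto elim!: nonpos_Ints_cases)

text \<open>The constants of the two recurrences cancel because 1/u^2 = pi/(u sin(pi u)) times
  sin(pi u)/(pi u). In the trigonometric quotient numerator and denominator both change sign under w
  -> w + 1.\<close>

lemma periodic_comb_plus1:
  assumes u: "0 < u" "u < 1" and w: "0 < Re w" "w \<notin> \<int>"
  shows "periodic_comb u (w + 1) = periodic_comb u w"
proof -
  define D where "D w = gamma_series u w + of_real (pi / (u * sin (pi * u))) * sine_series u w" for w :: complex
  have "(w ^ 2 - of_real (u ^ 2)) * gamma_series u w - (w + 1) ^ 2 * gamma_series u (w + 1) = - of_real (1 / u ^ 2)"
    by (rule gamma_series_shift_w) (use u w in auto)
  moreover have "(w ^ 2 - of_real (u ^ 2)) * sine_series u w - (w + 1) ^ 2 * sine_series u (w + 1) =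
     of_real (sin (pi * u) / (pi * u))"
  proof (rule sine_series_shift_w)
    have "w + 1 \<notin> \<int>" using w(2) by (metis Ints_1 Ints_diff add_diff_cancel_right')
    thus "w \<notin> range of_nat" "w + 1 \<notin> range of_nat" using w(2) by (metis Ints_of_nat rangeE)+
  qed (use u in auto)
  moreover have "1 / u ^ 2 = pi / (u * sin (pi * u)) * (sin (pi * u) / (pi * u))"
    using sin_pi_pos [OF u] u by (simp add: power2_eq_square)
  hence "of_real (1 / u ^ 2) = of_real (pi / (u * sin (pi * u))) * complex_of_real (sin (pi * u) / (pi * u))"
    by (simp only: of_real_mult)
  moreover have "(w ^ 2 - of_real (u ^ 2)) * D w - (w + 1) ^ 2 * D (w + 1) =
      ((w ^ 2 - of_real (u ^ 2)) * gamma_series u w - (w + 1) ^ 2 * gamma_series u (w + 1)) +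
      of_real (pi / (u * sin (pi * u))) * ((w ^ 2 - of_real (u ^ 2)) * sine_series u w - (w + 1) ^ 2 * sine_series u (w + 1))"
    unfolding D_def by (simp only: ring_distribs mult_ac) simp
  ultimately have D: "(w ^ 2 - of_real (u ^ 2)) * D w = (w + 1) ^ 2 * D (w + 1)"
    by simp
  have "w ^ 2 * rGamma_quot u w = (w ^ 2 - of_real (u ^ 2)) * rGamma_quot u (w + 1)"
    by (rule rGamma_quot_shift) (use w Re_pos_nonpos_Ints [of "w + 1"] in auto)
  hence "w ^ 2 * rGamma_quot u w * D w = (w + 1) ^ 2 * rGamma_quot u (w + 1) * D (w + 1)"
    using D by (metis mult.assoc mult.left_commute)
  moreover have "of_real pi * (w + 1 - of_real u) = of_real pi * (w - of_real u) + of_real pi"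
    "of_real pi * (w + 1) = of_real pi * w + of_real pi" by (simp_all add: algebra_simps)
  ultimately show ?thesis
    unfolding periodic_comb_def D_def by (simp add: sin_plus_pi)
qed


lemma strip_Ints: "1/4 < Re w \<Longrightarrow> Re w < 7/4 \<Longrightarrow> w \<in> \<int> \<longleftrightarrow> w = 1"
  by (auto elim!: Ints_cases)

lemma rGamma_quot_holomorphic: "rGamma_quot u holomorphic_on {w. 0 < Re w}"
  unfolding rGamma_quot_def [abs_def]
  by (intro holomorphic_intros) (auto simp: rGamma_eq_zero_iff Re_pos_nonpos_Ints)

text \<open>Wider than one period, so that integer translates overlap and a periodic extension is
  holomorphic across their edges; narrow enough that 1 is the only integer inside.\<close>

definition strip :: "complex set" where "strip = {w. 1/4 < Re w \<and> Re w < 7/4}"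

lemma open_strip: "open strip"
proof -
  have "strip = {w. 1/4 < Re w} \<inter> {w. Re w < 7/4}" by (auto simp: strip_def)
  moreover have "open \<dots>" by (intro open_Int open_halfspace_Re_gt open_halfspace_Re_lt)
  ultimately show ?thesis by simp
qed

lemma periodic_comb_holomorphic:
  assumes u: "0 < u" "u < 1"
  shows "periodic_comb u holomorphic_on strip - {1}"
proof -
  have "(\<lambda>w. w ^ 2 * rGamma_quot u w * (gamma_series u w + of_real (pi / (u * sin (pi * u))) * (- 1 / w - of_real (u ^ 2) / (1 - w) + sine_series_tail u w)) +
     of_real (pi / sin (pi * u)) * sin (of_real pi * (w - of_real u)) / sin (of_real pi * w)) holomorphic_on strip - {1}"
    by (intro holomorphic_intros holomorphic_on_subset [OF rGamma_quot_holomorphic] holomorphic_on_subset [OF gamma_series_holomorphic]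
          holomorphic_on_subset [OF sine_series_tail_holomorphic])
       (use u in \<open>auto simp: strip_def sin_complex_pi_eq_0 strip_Ints\<close>)
  thus ?thesis by (simp only: periodic_comb_def [abs_def] sine_series_split [OF u])
qed

lemma rGamma_quot_1:
  assumes "0 < u" "u < 1"
  shows "rGamma_quot u 1 = of_real (sin (pi * u) / (pi * u))"
proof -
  have "rGamma (of_real u) * rGamma (1 - of_real u) = sin (of_real pi * of_real u :: complex) / of_real pi"
    by (rule rGamma_reflection_complex)
  moreover have "rGamma (of_real u :: complex) = of_real u * rGamma (1 + of_real u)"
    using rGamma_plus1 [of "of_real u :: complex"] by (simp add: add.commute)
  ultimately have "of_real u * rGamma_quot u 1 = sin (of_real pi * of_real u) / of_real pi"
    by (simp add: rGamma_quot_def mult_ac)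
  also have "sin (of_real pi * of_real u :: complex) = of_real (sin (pi * u))"
    by (simp flip: sin_of_real)
  finally show ?thesis using assms by (simp add: field_simps)
qed

text \<open>At w = 1 the pole of R contributes u^2 times pi/(u sin(pi u)) times
  \<open>rGamma_quot u 1\<close>, which is 1, and the trigonometric quotient contributes -1. The
  residue vanishes and the singularity is removable.\<close>

lemma periodic_comb_limit_1:
  assumes u: "0 < u" "u < 1"
  shows "((\<lambda>w. (w - 1) * periodic_comb u w) \<longlongrightarrow> 0) (at 1)"
proof -
  let ?c = "of_real (pi / (u * sin (pi * u))) :: complex" and ?s = "of_real (pi / sin (pi * u)) :: complex"
  define A where "A w = w ^ 2 * rGamma_quot u w * (gamma_series u w + ?c * (- 1 / w + sine_series_tail u w))" for w
  have cont: "f \<midarrow>1\<rightarrow> f 1" if "f holomorphic_on strip" for f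
  proof -
    have "1 \<in> strip" by (simp add: strip_def)
    with holomorphic_on_imp_continuous_on [OF that] have "isCont f 1"
      unfolding continuous_on_eq_continuous_at [OF open_strip] by blast
    thus ?thesis by (simp add: isCont_def)
  qed
  have holo: "rGamma_quot u holomorphic_on strip" "A holomorphic_on strip"
    unfolding A_def [abs_def]
    by (intro holomorphic_intros holomorphic_on_subset [OF rGamma_quot_holomorphic] holomorphic_on_subset [OF gamma_series_holomorphic]
          holomorphic_on_subset [OF sine_series_tail_holomorphic]; use u in \<open>auto simp: strip_def\<close>)+
  have "((\<lambda>w. sin (of_real pi * w)) has_field_derivative cos (of_real pi * 1) * of_real pi) (at (1 :: complex))"
    by (auto intro!: derivative_eq_intros)
  hence "(\<lambda>w. (sin (of_real pi * w) - sin (of_real pi * 1)) / (w - 1)) \<midarrow>(1 :: complex)\<rightarrow>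
           cos (of_real pi * 1) * of_real pi"
    unfolding has_field_derivative_iff .
  moreover have "sin (of_real pi * 1 :: complex) = 0" "cos (of_real pi * 1 :: complex) = -1"
    by (simp_all flip: sin_of_real cos_of_real)
  ultimately have "(\<lambda>w. sin (of_real pi * w) / (w - 1)) \<midarrow>1\<rightarrow> - (of_real pi :: complex)" by simp
  from tendsto_inverse [OF this]
  have sinc: "(\<lambda>w. (w - 1) / sin (of_real pi * w)) \<midarrow>1\<rightarrow> - 1 / (of_real pi :: complex)"
    by (simp add: divide_inverse mult.commute)
  have "(\<lambda>w. (w - 1) * A w + w ^ 2 * rGamma_quot u w * ?c * of_real (u ^ 2) +
          ?s * sin (of_real pi * (w - of_real u)) * ((w - 1) / sin (of_real pi * w))) \<midarrow>1\<rightarrow>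
        (1 - 1) * A 1 + 1 ^ 2 * rGamma_quot u 1 * ?c * of_real (u ^ 2) +
          ?s * sin (of_real pi * (1 - of_real u)) * (- 1 / of_real pi)"
    by (intro tendsto_intros sinc holo [THEN cont])
  also have "sin (of_real pi * (1 - of_real u)) = (of_real (sin (pi * u)) :: complex)"
  proof -
    have "of_real pi * (1 - of_real u) = (of_real (pi - pi * u) :: complex)" by (simp add: algebra_simps)
    thus ?thesis by (simp only: sin_of_real sin_pi_minus)
  qed
  also have "(1 - 1) * A 1 + 1 ^ 2 * rGamma_quot u 1 * ?c * of_real (u ^ 2) + ?s * of_real (sin (pi * u)) * (- 1 / of_real pi) = 0"
  proof -
    have "1 ^ 2 * (sin (pi * u) / (pi * u)) * (pi / (u * sin (pi * u))) * u ^ 2 + pi / sin (pi * u) * sin (pi * u) * (- 1 / pi) = 0"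
      using u sin_pi_pos [OF u] by (simp add: power2_eq_square)
    from arg_cong [OF this, of complex_of_real] show ?thesis
      unfolding rGamma_quot_1 [OF u]
      by (simp only: of_real_add of_real_mult of_real_power of_real_minus of_real_divide of_real_1 of_real_0
            diff_self mult_zero_left add_0_left)
  qed
  finally show ?thesis
  proof (rule Lim_transform_eventually)
    have "eventually (\<lambda>w. w \<in> strip - {1}) (at 1)"
      using open_strip by (intro eventually_at_in_open) (auto simp: strip_def)
    thus "eventually (\<lambda>w. (w - 1) * A w + w ^ 2 * rGamma_quot u w * ?c * of_real (u ^ 2) +
          ?s * sin (of_real pi * (w - of_real u)) * ((w - 1) / sin (of_real pi * w)) = (w - 1) * periodic_comb u w) (at 1)"
    proof eventually_elim
      case (elim w)
      have "(w - 1) * (of_real (u ^ 2) / (1 - w)) = - of_real (u ^ 2)"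
      proof -
        have "1 - w \<noteq> 0" using elim by auto
        moreover have "w - 1 = - (1 - w)" by simp
        ultimately show ?thesis
          by (metis mult_minus_left nonzero_mult_div_cancel_left times_divide_eq_right)
      qed
      moreover have "(w - 1) * periodic_comb u w = (w - 1) * A w - w ^ 2 * rGamma_quot u w * ?c * ((w - 1) * (of_real (u ^ 2) / (1 - w))) +
          ?s * sin (of_real pi * (w - of_real u)) * ((w - 1) / sin (of_real pi * w))"
      proof -
        have "(w - 1) * (W * (l + c * (x - y + r)) + S / T) =
           (w - 1) * (W * (l + c * (x + r))) - W * c * ((w - 1) * y) + S * ((w - 1) / T)"
          for W l c x y r S T :: complex
          by (simp add: algebra_simps diff_divide_distrib)
        thus ?thesis unfolding periodic_comb_def A_def sine_series_split [OF u] .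
      qed
      ultimately show ?case by simp
    qed
  qed
qed


text \<open>Re w > 1/4 gives |w + j| \<ge> (j + 1)/4, hence the constant 16. Comparing every factor
  with an exponential then bounds the partial products on the whole half-plane.\<close>

lemma rGamma_quot_bounded:
  assumes "0 < u" "u < 1"
  obtains K where "0 < K" "\<And>w. 1/4 < Re w \<Longrightarrow> norm (rGamma_quot u w) \<le> K"
proof -
  have summ: "summable (\<lambda>j. 16 * inverse ((real j + 1) ^ 2))"
    by (intro summable_mult summable_inverse_square)
  define K where "K = exp (\<Sum>j. 16 * inverse ((real j + 1) ^ 2))"
  have "norm (rGamma_quot u w) \<le> K" if w: "1/4 < Re w" for w
  proof (rule LIMSEQ_le_const2)
    show "(\<lambda>n. norm (\<Prod>j\<le>n. 1 - of_real (u ^ 2) / (w + of_nat j) ^ 2)) \<longlonglongrightarrow> norm (rGamma_quot u w)"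
      by (intro tendsto_norm rGamma_quot_LIMSEQ Re_pos_nonpos_Ints) (use w in simp)
    have "norm (\<Prod>j\<le>n. 1 - of_real (u ^ 2) / (w + of_nat j) ^ 2) \<le> K" for n
    proof -
      have "norm (1 - of_real (u ^ 2) / (w + of_nat j) ^ 2) \<le> exp (16 * inverse ((real j + 1) ^ 2))" for j
      proof -
        have "(real j + 1) / 4 \<le> Re (w + of_nat j)" using w by simp
        also have "\<dots> \<le> norm (w + of_nat j)" by (rule complex_Re_le_cmod)
        finally have "((real j + 1) / 4) ^ 2 \<le> norm (w + of_nat j) ^ 2"
          by (rule power_mono) simp
        moreover have "u ^ 2 \<le> 1 ^ 2" by (rule power_mono) (use assms in auto)
        moreover have "0 < ((real j + 1) / 4) ^ 2" by (intro zero_less_power) simp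
        ultimately have "u ^ 2 / norm (w + of_nat j) ^ 2 \<le> 1 ^ 2 / ((real j + 1) / 4) ^ 2"
          by (intro frac_le) simp_all
        also have "\<dots> = 16 * inverse ((real j + 1) ^ 2)"
          by (simp add: power_divide inverse_eq_divide)
        finally have "norm (of_real (u ^ 2) / (w + of_nat j) ^ 2) \<le> 16 * inverse ((real j + 1) ^ 2)"
          by (simp add: norm_divide norm_power)
        with norm_triangle_ineq4 [of 1 "of_real (u ^ 2) / (w + of_nat j) ^ 2"]
        have "norm (1 - of_real (u ^ 2) / (w + of_nat j) ^ 2) \<le> 1 + 16 * inverse ((real j + 1) ^ 2)"
          by simp
        also have "\<dots> \<le> exp (16 * inverse ((real j + 1) ^ 2))" by (rule exp_ge_add_one_self)
        finally show ?thesis .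
      qed
      hence "norm (\<Prod>j\<le>n. 1 - of_real (u ^ 2) / (w + of_nat j) ^ 2) \<le> (\<Prod>j\<le>n. exp (16 * inverse ((real j + 1) ^ 2)))"
        by (subst prod_norm [symmetric]) (intro prod_mono conjI norm_ge_zero)
      also have "\<dots> = exp (\<Sum>j\<le>n. 16 * inverse ((real j + 1) ^ 2))" by (rule exp_sum [symmetric]) simp
      also have "\<dots> \<le> K"
        unfolding K_def exp_le_cancel_iff by (intro sum_le_suminf summ) auto
      finally show ?thesis .
    qed
    thus "\<exists>N. \<forall>n\<ge>N. norm (\<Prod>j\<le>n. 1 - of_real (u ^ 2) / (w + of_nat j) ^ 2) \<le> K" by blast
  qed
  moreover have "0 < K" unfolding K_def by (rule exp_gt_zero)
  ultimately show ?thesis using that by blast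
qed

lemma norm_gamma_series_le:
  assumes "0 < u" "0 < Re w"
  shows "norm (w * gamma_series u w) \<le> 1 / u ^ 2"
proof -
  have "norm (\<Sum>k. w * (of_real (gamma_coeff u k) / (of_nat k + of_real u + w))) \<le> (\<Sum>k. gamma_coeff u k)"
  proof (rule norm_suminf_le)
    fix k
    have "norm w \<le> norm (of_nat k + of_real u + w)"
    proof -
      have "Re w ^ 2 \<le> Re (of_nat k + of_real u + w) ^ 2"
        using assms by (intro power_mono) auto
      thus ?thesis unfolding cmod_def by (intro real_sqrt_le_mono) simp
    qed
    moreover have "norm w > 0" using assms by auto
    ultimately have "norm w / norm (of_nat k + of_real u + w) \<le> 1" by (simp add: divide_le_eq)
    from mult_right_mono [OF this gamma_coeff_nonneg [OF assms(1), of k]]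
    show "norm (w * (of_real (gamma_coeff u k) / (of_nat k + of_real u + w))) \<le> gamma_coeff u k"
      using gamma_coeff_nonneg [OF assms(1), of k] by (simp add: norm_mult norm_divide)
  qed (use gamma_coeff_sums [OF assms(1)] in \<open>rule sums_summable\<close>)
  also have "(\<Sum>k. gamma_coeff u k) = 1 / u ^ 2" using gamma_coeff_sums [OF assms(1)] by (rule sums_unique [symmetric])
  also have "(\<Sum>k. w * (of_real (gamma_coeff u k) / (of_nat k + of_real u + w))) = w * gamma_series u w"
    unfolding gamma_series_def by (rule suminf_mult [OF summable_gamma_series [OF assms(1)]])
  finally show ?thesis .
qed

lemma norm_sine_series_le:
  assumes "0 < u" "u < 1" "w \<in> strip" "1 \<le> \<bar>Im w\<bar>"
  shows "norm (w * sine_series u w) \<le> (\<Sum>k. 3 * \<bar>sine_coeff u k\<bar>)"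
proof -
  have summ: "summable (\<lambda>k. 3 * \<bar>sine_coeff u k\<bar>)" by (intro summable_mult summable_abs_sine_coeff assms)
  have "norm (\<Sum>k. w * (of_real (sine_coeff u k) / (of_nat k - w))) \<le> (\<Sum>k. 3 * \<bar>sine_coeff u k\<bar>)"
  proof (rule norm_suminf_le [OF _ summ])
    fix k
    \<comment> \<open>In the strip |Re w| < 7/4 \<le> 2 |Im w|, so |w| \<le> 3 |Im w|, and Im(k - w)
      = -Im w.\<close>
    have "norm w \<le> \<bar>Re w\<bar> + \<bar>Im w\<bar>" by (rule cmod_le)
    also have "\<dots> \<le> 3 * \<bar>Im (of_nat k - w)\<bar>" using assms(3,4) by (auto simp: strip_def)
    also have "\<dots> \<le> 3 * norm (of_nat k - w)" using abs_Im_le_cmod [of "of_nat k - w"] by linarith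
    finally have "norm w \<le> 3 * norm (of_nat k - w)" .
    moreover have "norm (of_nat k - w) > 0"
      using assms(4) abs_Im_le_cmod [of "of_nat k - w"] by (auto simp del: zero_less_norm_iff)
    ultimately have "norm w / norm (of_nat k - w) \<le> 3" by (simp add: divide_le_eq)
    from mult_right_mono [OF this, of "\<bar>sine_coeff u k\<bar>"]
    show "norm (w * (of_real (sine_coeff u k) / (of_nat k - w))) \<le> 3 * \<bar>sine_coeff u k\<bar>"
      by (simp add: norm_mult norm_divide)
  qed
  also have "(\<Sum>k. w * (of_real (sine_coeff u k) / (of_nat k - w))) = w * sine_series u w"
    unfolding sine_series_def by (rule suminf_mult [OF summable_sine_series [OF assms(1,2)]])
  finally show ?thesis .
qed

lemma norm_sin_ratio_le:
  assumes "1 \<le> \<bar>Im w\<bar>"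
  shows "norm (sin (of_real pi * (w - of_real u)) / sin (of_real pi * w)) \<le> 3"
proof -
  define Y where "Y = \<bar>pi * Im w\<bar>"
  have Y: "Y \<ge> 3" using assms pi_gt3 by (auto simp: Y_def abs_mult intro: order_trans [OF _ mult_mono [of 3 pi 1]])
  have "norm (sin (of_real pi * (w - of_real u))) \<le> exp Y"
    using cmod_sin_le_exp [of 1 "of_real pi * (w - of_real u)"] by (simp add: Y_def)
  \<comment> \<open>From 4 |sin|^2 \<ge> exp(2Y) - 2 the claim reduces to exp(2Y) \<le>
    (9/4)(exp(2Y) - 2), for which exp(2Y) \<ge> 1 + 2Y \<ge> 7 is more than enough.\<close>
  also have "exp Y \<le> 3 * norm (sin (of_real pi * w))"
  proof (rule power2_le_imp_le)
    have "exp (2 * Y) \<le> exp (2 * (pi * Im w)) + inverse (exp (2 * (pi * Im w)))"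
      by (cases "Im w \<ge> 0") (auto simp: Y_def abs_mult exp_minus [symmetric] mult_ac)
    moreover have "cos (2 * (pi * Re w)) \<le> 1" by simp
    moreover have "1 + 2 * Y \<le> exp (2 * Y)" by (rule exp_ge_add_one_self)
    ultimately have "exp (2 * Y) \<le> 9 * ((exp (2 * (pi * Im w)) + inverse (exp (2 * (pi * Im w))) - 2 * cos (2 * (pi * Re w))) / 4)"
      using Y by argo
    also have "\<dots> = (3 * norm (sin (of_real pi * w))) ^ 2"
      by (simp add: power_mult_distrib norm_sin_squared)
    finally show "exp Y ^ 2 \<le> (3 * norm (sin (of_real pi * w))) ^ 2" by (simp add: exp_double)
  qed simp
  finally show ?thesis
    by (simp add: norm_divide divide_le_eq)
qed

text \<open>One of the two factors w is absorbed into w L and w R, which are bounded away from the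
  real axis; the other one produces the linear growth.\<close>

lemma periodic_comb_bounded:
  assumes u: "0 < u" "u < 1"
  obtains K where "0 \<le> K" "\<And>w. w \<in> strip \<Longrightarrow> 1 \<le> \<bar>Im w\<bar> \<Longrightarrow> norm (periodic_comb u w) \<le> K * norm w"
proof -
  obtain G where G: "0 < G" "\<And>w. 1/4 < Re w \<Longrightarrow> norm (rGamma_quot u w) \<le> G" using rGamma_quot_bounded [OF u] by blast
  define c s where "c = pi / (u * sin (pi * u))" and "s = pi / sin (pi * u)"
  have cs: "c > 0" "s > 0" using u sin_pi_pos [OF u] by (auto simp: c_def s_def)
  define R where "R = (\<Sum>k. 3 * \<bar>sine_coeff u k\<bar>)"
  have "R \<ge> 0" unfolding R_def by (intro suminf_nonneg summable_mult summable_abs_sine_coeff u) auto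
  define K where "K = G * (1 / u ^ 2 + c * R) + s * 3"
  have "norm (periodic_comb u w) \<le> K * norm w" if w: "w \<in> strip" "1 \<le> \<bar>Im w\<bar>" for w
  proof -
    have w1: "norm w \<ge> 1" using w(2) abs_Im_le_cmod [of w] by linarith
    have Re: "0 < Re w" "1/4 < Re w" using w(1) by (auto simp: strip_def)
    have "norm (w * gamma_series u w + of_real c * (w * sine_series u w)) \<le> norm (w * gamma_series u w) + norm (of_real c * (w * sine_series u w))"
      by (rule norm_triangle_ineq)
    also have "norm (of_real c * (w * sine_series u w)) \<le> c * R"
      using norm_sine_series_le [OF u w] cs unfolding norm_mult [of "of_real c"] R_def by (simp add: mult_left_mono)
    also have "norm (w * gamma_series u w) \<le> 1 / u ^ 2" by (rule norm_gamma_series_le) (use u Re in auto)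
    finally have 1: "norm (w * gamma_series u w + of_real c * (w * sine_series u w)) \<le> 1 / u ^ 2 + c * R" by simp
    have "periodic_comb u w = w * (rGamma_quot u w * (w * gamma_series u w + of_real c * (w * sine_series u w))) +
        of_real s * (sin (of_real pi * (w - of_real u)) / sin (of_real pi * w))"
      by (simp add: periodic_comb_def c_def s_def power2_eq_square algebra_simps)
    also have "norm \<dots> \<le> norm w * (G * (1 / u ^ 2 + c * R)) + s * 3"
      using cs G Re w 1
      by (intro order_trans [OF norm_triangle_ineq] add_mono)
         (auto simp: norm_mult simp del: times_divide_eq_right intro!: mult_mono norm_sin_ratio_le mult_nonneg_nonneg)
    also have "s * 3 \<le> s * 3 * norm w" using cs w1 by simp
    finally show ?thesis by (simp add: K_def algebra_simps)
  qed
  moreover have "0 \<le> K" using cs G \<open>R \<ge> 0\<close> by (simp add: K_def)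
  ultimately show ?thesis using that by blast
qed

theorem periodic_comb_eq_0:
  assumes u: "0 < u" "u < 1 / 2" and t: "0 < t" "t < 1 / 2"
  shows "periodic_comb u (of_real t) = 0"
proof -
  have u1: "u < 1" using u by simp
  obtain g where g: "g holomorphic_on strip" "\<And>w. w \<in> strip - {1} \<Longrightarrow> g w = periodic_comb u w"
  proof -
    have "1 \<in> interior strip" using open_strip by (simp add: interior_open strip_def)
    from holomorphic_on_extend_lim [OF periodic_comb_holomorphic [OF u(1) u1] this]
    show ?thesis using periodic_comb_limit_1 [OF u(1) u1] that by blast
  qed
  have g_plus1: "g (w + 1) = g w" if "1/4 < Re w" "Re w < 3/4" for w
  proof -
    have "w + 1 \<noteq> 1" "w \<noteq> 1" using that by auto
    hence "g (w + 1) = periodic_comb u (w + 1)" "g w = periodic_comb u w" using that by (auto intro!: g simp: strip_def)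
    moreover have "periodic_comb u (w + 1) = periodic_comb u w"
      using u that by (intro periodic_comb_plus1) (auto simp: strip_Ints)
    ultimately show ?thesis by simp
  qed
  \<comment> \<open>The floor selects the translate with real part in [1/2, 3/2). Because
    \<open>g\<close> is periodic on the overlap, \<open>P_local\<close> allows any other translate
    that stays inside the strip, so near each point \<open>P\<close> is a single translate of
    \<open>g\<close>.\<close>
  define P where "P z = g (z - of_int \<lfloor>Re z - 1/2\<rfloor>)" for z
  have P_local: "P z = g (z - of_int n)" if "\<bar>Re z - of_int n - 1\<bar> < 3/4" for z n
  proof -
    define m where "m = \<lfloor>Re z - 1/2\<rfloor>"
    have m: "of_int m \<le> Re z - 1/2" "Re z - 1/2 < of_int m + 1" by (auto simp: m_def)
    have "m < n + 2" "n - 2 < m" using m that by linarith+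
    then consider "m = n" | "m = n - 1" | "m = n + 1" by linarith
    hence "g (z - of_int m) = g (z - of_int n)"
    proof cases
      case 2
      hence "z - of_int m = z - of_int n + 1" by simp
      moreover have "g (z - of_int n + 1) = g (z - of_int n)"
        by (rule g_plus1) (use 2 m that in auto)
      ultimately show ?thesis by (simp only:)
    next
      case 3
      hence "z - of_int n = z - of_int m + 1" by simp
      moreover have "g (z - of_int m + 1) = g (z - of_int m)"
        by (rule g_plus1) (use 3 m that in auto)
      ultimately show ?thesis by (simp only:)
    qed simp
    thus ?thesis by (simp add: P_def m_def)
  qed
  have P_holo: "P holomorphic_on UNIV"
  proof -
    let ?A = "\<lambda>n::int. {z. \<bar>Re z - of_int n - 1\<bar> < 3/4}"
    have "P holomorphic_on (\<Union>n\<in>UNIV. ?A n)"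
    proof (rule holomorphic_on_UN_open)
      fix n :: int
      have "?A n = {z. of_int n + 1/4 < Re z} \<inter> {z. Re z < of_int n + 7/4}"
        unfolding abs_less_iff by auto
      moreover have "open \<dots>" by (intro open_Int open_halfspace_Re_gt open_halfspace_Re_lt)
      ultimately show "open (?A n)" by simp
      have "(g \<circ> (\<lambda>z. z - of_int n)) holomorphic_on ?A n"
      proof (rule holomorphic_on_compose_gen [OF _ g(1)])
        have "z - of_int n \<in> strip" if "z \<in> ?A n" for z
        proof -
          have "Re z - of_int n - 1 < 3/4" "- (Re z - of_int n - 1) < 3/4"
            using that by (simp_all only: mem_Collect_eq abs_less_iff)
          thus ?thesis by (simp add: strip_def)
        qed
        thus "(\<lambda>z. z - of_int n) ` ?A n \<subseteq> strip" by blast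
      qed (intro holomorphic_intros)
      thus "P holomorphic_on ?A n"
        by (rule holomorphic_transform) (use P_local in auto)
    qed
    moreover have "(\<Union>n\<in>UNIV. ?A n) = UNIV"
    proof safe
      fix z :: complex
      have "\<bar>Re z - of_int \<lfloor>Re z - 1/2\<rfloor> - 1\<bar> < 3/4" by linarith
      thus "z \<in> (\<Union>n\<in>UNIV. ?A n)" by blast
    qed auto
    ultimately show ?thesis by simp
  qed
  have P_plus1: "P (z + 1) = P z" for z
  proof -
    have "Re (z + 1) - 1/2 = (Re z - 1/2) + 1" by simp
    hence "\<lfloor>Re (z + 1) - 1/2\<rfloor> = \<lfloor>Re z - 1/2\<rfloor> + 1" by (simp only: one_add_floor)
    thus ?thesis by (simp add: P_def)
  qed
  obtain K where K: "0 \<le> K" "\<And>w. w \<in> strip \<Longrightarrow> 1 \<le> \<bar>Im w\<bar> \<Longrightarrow> norm (periodic_comb u w) \<le> K * norm w"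
    using periodic_comb_bounded [OF u(1) u1] by blast
  obtain B where B: "\<And>w. 1/2 \<le> Re w \<Longrightarrow> Re w \<le> 3/2 \<Longrightarrow> \<bar>Im w\<bar> \<le> 1 \<Longrightarrow> norm (g w) \<le> B"
  proof -
    let ?C = "cbox (Complex (1/2) (-1)) (Complex (3/2) 1)"
    have "?C \<subseteq> strip" by (auto simp: strip_def in_cbox_complex_iff)
    hence "compact (g ` ?C)"
      by (intro compact_continuous_image holomorphic_on_imp_continuous_on holomorphic_on_subset [OF g(1)] compact_cbox)
    then obtain B where "\<And>w. w \<in> ?C \<Longrightarrow> norm (g w) \<le> B"
      by (meson bounded_iff compact_imp_bounded image_eqI)
    thus ?thesis using that by (auto simp: in_cbox_complex_iff abs_le_iff)
  qed
  have B0: "0 \<le> B" by (rule order_trans [OF norm_ge_zero B [of 1]]) simp_all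
  have g_bound: "norm (g w) \<le> B + K * norm w" if "1/2 \<le> Re w" "Re w \<le> 3/2" for w
  proof (cases "\<bar>Im w\<bar> \<le> 1")
    case True
    hence "norm (g w) \<le> B" using that by (intro B)
    moreover have "0 \<le> K * norm w" using K(1) by simp
    ultimately show ?thesis by linarith
  next
    case False
    hence "w \<in> strip - {1}" using that by (auto simp: strip_def)
    hence "norm (g w) = norm (periodic_comb u w)" using g by simp
    also have "\<dots> \<le> K * norm w" using \<open>w \<in> strip - {1}\<close> False by (intro K) auto
    finally show ?thesis using B0 by linarith
  qed
  have P_bound: "norm (P z) \<le> (B + 3 * K) * norm z ^ 1" if "1 \<le> norm z" for z
  proof -
    let ?w = "z - of_int \<lfloor>Re z - 1/2\<rfloor>"
    have "of_int \<lfloor>Re z - 1/2\<rfloor> \<le> Re z - 1/2" "Re z - 1/2 < of_int \<lfloor>Re z - 1/2\<rfloor> + 1"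
      by (rule of_int_floor_le, rule floor_correct [THEN conjunct2, simplified])
    moreover have "Re ?w = Re z - of_int \<lfloor>Re z - 1/2\<rfloor>" by simp
    ultimately have w: "1/2 \<le> Re ?w" "Re ?w \<le> 3/2" by linarith+
    have "norm ?w \<le> \<bar>Re ?w\<bar> + \<bar>Im ?w\<bar>" by (rule cmod_le)
    also have "\<dots> \<le> 2 + norm z" using w abs_Im_le_cmod [of z] by simp
    also have "\<dots> \<le> 3 * norm z" using that by simp
    finally have "K * norm ?w \<le> K * (3 * norm z)" using K(1) by (rule mult_left_mono)
    moreover have "B * 1 \<le> B * norm z" using that B0 by (rule mult_left_mono)
    moreover have "norm (P z) \<le> B + K * norm ?w" unfolding P_def by (rule g_bound [OF w])
    ultimately show ?thesis by (simp add: algebra_simps)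
  qed
  \<comment> \<open>An entire function of linear growth is affine by the extended Liouville theorem,
    and period 1 forces the slope to be zero.\<close>
  have P_eq: "P z = P 0 + deriv P 0 * z" for z
    using Liouville_polynomial [OF P_holo P_bound, where \<xi> = z] by simp
  have "P 1 = P 0" using P_plus1 [of 0] by simp
  hence "deriv P 0 = 0" using P_eq [of 1] by simp
  hence P_const: "P z = P 0" for z using P_eq [of z] by simp
  \<comment> \<open>A small \<open>x\<close> may lie to the left of the strip; \<open>x + 1\<close>
    lies in (1, 3/2), inside it and away from the removed point 1.\<close>
  have P_p: "P (of_real x + 1) = periodic_comb u (of_real x)" if "0 < x" "x < 1/2" for x
  proof -
    have "P (of_real x + 1) = g (of_real x + 1)"
      using P_local [of "of_real x + 1" 0] that by simp
    also have "\<dots> = periodic_comb u (of_real x + 1)"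
      using that by (intro g) (auto simp: strip_def)
    also have "\<dots> = periodic_comb u (of_real x)"
    proof (rule periodic_comb_plus1 [OF u(1) u1])
      have "(x :: real) \<notin> \<int>" using that by (auto elim!: Ints_cases)
      thus "complex_of_real x \<notin> \<int>" by simp
    qed (use that in auto)
    finally show ?thesis .
  qed
  \<comment> \<open>At w = u both \<open>rGamma (w - u)\<close> = \<open>rGamma 0\<close> and sin(pi
    (w - u)) are zero. This single evaluation fixes the constant.\<close>
  have "periodic_comb u (of_real u) = 0" by (simp add: periodic_comb_def rGamma_quot_def)
  hence "P 0 = 0" using P_p [OF u] P_const [of "of_real u + 1"] by (simp only:)
  thus ?thesis using P_p [OF t] P_const [of "of_real t + 1"] by (simp only:)
qed

section \<open>Complex extension of f4 and Taylor coefficients of the shifted sum\<close>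

definition f4_complex :: "complex \<Rightarrow> complex" where
  "f4_complex z = exp (of_real pi * \<i> * z) * (7 * z - 2) * Gamma (z + 1) ^ 3 / ((2 * z - 1) * z ^ 2 * Gamma (3 * z + 1))"

lemma f4_eq_f4_complex: "f4 x = f4_complex (of_real x)"
proof -
  have "of_real (Gamma (x + 1)) = (Gamma (of_real x + 1) :: complex)"
    "of_real (Gamma (3 * x + 1)) = (Gamma (3 * of_real x + 1) :: complex)"
    by (simp_all flip: Gamma_complex_of_real)
  thus ?thesis by (simp add: f4_def f4_complex_def)
qed

lemma Re_pos_not_nonpos_Int: "0 < Re z \<Longrightarrow> z \<notin> \<int>\<^sub>\<le>\<^sub>0"
  by (auto elim!: nonpos_Ints_cases)

lemma f4_complex_holomorphic: "f4_complex holomorphic_on {z. 1 / 2 < Re z}"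
proof -
  have "z + 1 \<notin> \<int>\<^sub>\<le>\<^sub>0" "3 * z + 1 \<notin> \<int>\<^sub>\<le>\<^sub>0" "2 * z - 1 \<noteq> 0" "z \<noteq> 0" if "1 / 2 < Re z" for z
  proof -
    show "z + 1 \<notin> \<int>\<^sub>\<le>\<^sub>0" "3 * z + 1 \<notin> \<int>\<^sub>\<le>\<^sub>0"
      using that by (auto intro!: Re_pos_not_nonpos_Int)
    show "2 * z - 1 \<noteq> 0"
    proof
      assume "2 * z - 1 = 0"
      hence "Re (2 * z - 1) = 0" by (simp only: zero_complex.sel)
      thus False using that by simp
    qed
    show "z \<noteq> 0" using that by auto
  qed
  thus ?thesis
    unfolding f4_complex_def [abs_def]
    by (intro holomorphic_intros) (auto simp: Gamma_eq_zero_iff)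
qed

lemma f4_complex_step_algebra:
  fixes E P p q r c z D1 D2 G G3 :: complex
  assumes "p \<noteq> 0" "q \<noteq> 0" "r \<noteq> 0" "c \<noteq> 0" "z \<noteq> 0" "D1 \<noteq> 0" "D2 \<noteq> 0" "G3 \<noteq> 0"
  shows "(- E) * P * (c * G) ^ 3 / (r * c ^ 2 * ((3 * c) * (D2 * (D1 * G3)))) =
    - (E * p * G ^ 3 / (q * z ^ 2 * G3)) * (P / p * (q / r) * ((z / D1) * (z / D2) * (1 / 3)))"
  using assms by (simp add: field_simps power2_eq_square power3_eq_cube)

text \<open>Gamma(z+1)^3/Gamma(3z+1) contributes at most 1/27 per step and (2z-1)/(2z+1) at most 1.
  Since Re z \<ge> 3/4 gives |7z - 2| \<ge> 3, the linear factors contribute at most 1 + 7/3 \<le>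
  4, and 4/27 < 1/2.\<close>

lemma norm_f4_complex_step:
  assumes "3 / 4 \<le> Re z"
  shows "norm (f4_complex (z + 1)) \<le> norm (f4_complex z) / 2"
proof -
  have nz: "3 * z + 1 \<noteq> 0" "3 * z + 2 \<noteq> 0" "3 * z + 3 \<noteq> 0" "z + 1 \<noteq> 0" "z \<noteq> 0" "2 * z + 1 \<noteq> 0" "2 * z - 1 \<noteq> 0" "7 * z - 2 \<noteq> 0"
    using assms by (auto simp: complex_eq_iff)
  have g1: "Gamma (z + 1 + 1) = (z + 1) * Gamma (z + 1)"
    by (rule Gamma_plus1) (use assms in \<open>auto intro!: Re_pos_not_nonpos_Int\<close>)
  have g3: "Gamma (3 * (z + 1) + 1) = (3 * z + 3) * ((3 * z + 2) * ((3 * z + 1) * Gamma (3 * z + 1)))"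
  proof -
    have "Gamma (3 * z + 1 + 1) = (3 * z + 1) * Gamma (3 * z + 1)"
      by (rule Gamma_plus1) (use assms in \<open>auto intro!: Re_pos_not_nonpos_Int\<close>)
    moreover have "Gamma (3 * z + 1 + 1 + 1) = (3 * z + 1 + 1) * Gamma (3 * z + 1 + 1)"
      by (rule Gamma_plus1) (use assms in \<open>auto intro!: Re_pos_not_nonpos_Int\<close>)
    moreover have "Gamma (3 * z + 1 + 1 + 1 + 1) = (3 * z + 1 + 1 + 1) * Gamma (3 * z + 1 + 1 + 1)"
      by (rule Gamma_plus1) (use assms in \<open>auto intro!: Re_pos_not_nonpos_Int\<close>)
    moreover have "3 * (z + 1) + 1 = 3 * z + 1 + 1 + 1 + 1" by simp
    ultimately show ?thesis by (simp add: add_ac)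
  qed
  have e: "exp (of_real pi * \<i> * (z + 1)) = - exp (of_real pi * \<i> * z)"
    by (simp add: ring_distribs exp_add)
  have G3: "Gamma (3 * z + 1) \<noteq> 0"
    using Re_pos_not_nonpos_Int [of "3 * z + 1"] assms by (auto simp: Gamma_eq_zero_iff)
  have l: "7 * (z + 1) - 2 = 7 * z + 5" "2 * (z + 1) - 1 = 2 * z + 1" "3 * z + 3 = 3 * (z + 1)"
    by simp_all
  have f: "f4_complex (z + 1) = - f4_complex z * ((7 * z + 5) / (7 * z - 2) * ((2 * z - 1) / (2 * z + 1)) *
       ((z / (3 * z + 1)) * (z / (3 * z + 2)) * (1 / 3)))"
    unfolding f4_complex_def g1 g3 e l by (rule f4_complex_step_algebra, (fact nz G3)+)
  have r1: "norm ((7 * z + 5) / (7 * z - 2)) \<le> 4"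
  proof -
    have "3 \<le> Re (7 * z - 2)" using assms by simp
    also have "\<dots> \<le> norm (7 * z - 2)" by (rule complex_Re_le_cmod)
    finally have "3 \<le> norm (7 * z - 2)" .
    moreover have "norm (7 * z + 5) \<le> norm (7 * z - 2) + 7"
    proof -
      have "7 * z + 5 = (7 * z - 2) + 7" by simp
      thus ?thesis using norm_triangle_ineq [of "7 * z - 2" 7] by (simp only: norm_numeral)
    qed
    ultimately show ?thesis by (simp add: norm_divide divide_le_eq)
  qed
  have cmod_le_iff: "norm a \<le> norm b" if "\<bar>Re a\<bar> \<le> \<bar>Re b\<bar>" "\<bar>Im a\<bar> \<le> \<bar>Im b\<bar>" for a b :: complex
    unfolding cmod_def using that by (intro real_sqrt_le_mono add_mono) (simp_all add: abs_le_square_iff)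
  have quot_le: "norm (a / b) \<le> c" if "norm a \<le> c * norm b" "0 \<le> c" for a b :: complex and c
    using that by (cases "b = 0") (simp_all add: norm_divide divide_le_eq)
  have "norm (2 * z - 1) \<le> norm (2 * z + 1)" "norm (3 * z) \<le> norm (3 * z + 1)" "norm (3 * z) \<le> norm (3 * z + 2)"
    by (rule cmod_le_iff; use assms in simp)+
  hence r2: "norm ((2 * z - 1) / (2 * z + 1)) \<le> 1"
    and r3: "norm (z / (3 * z + 1)) \<le> 1 / 3" "norm (z / (3 * z + 2)) \<le> 1 / 3"
    by - (rule quot_le; simp add: norm_mult)+
  have "norm (f4_complex (z + 1)) = norm (f4_complex z) * (norm ((7 * z + 5) / (7 * z - 2)) * norm ((2 * z - 1) / (2 * z + 1)) *
       (norm (z / (3 * z + 1)) * norm (z / (3 * z + 2)) * (1 / 3)))"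
    unfolding f norm_mult norm_minus_cancel by (simp only: norm_divide norm_one norm_numeral)
  also have "\<dots> \<le> norm (f4_complex z) * (4 * 1 * ((1 / 3) * (1 / 3) * (1 / 3)))"
    by (intro mult_left_mono mult_mono r1 r2 r3) auto
  also have "\<dots> \<le> norm (f4_complex z) / 2" by simp
  finally show ?thesis .
qed

lemma f4_complex_bound:
  "\<exists>C. \<forall>k z. norm z \<le> 1 / 4 \<longrightarrow> norm (f4_complex (of_nat (Suc k) + z)) \<le> C * (1 / 2) ^ k"
proof -
  have "compact (f4_complex ` cball 1 (1 / 4))"
  proof (intro compact_continuous_image holomorphic_on_imp_continuous_on holomorphic_on_subset [OF f4_complex_holomorphic] compact_cball)
    show "cball 1 (1 / 4) \<subseteq> {z. 1 / 2 < Re z}"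
    proof safe
      fix z :: complex assume "z \<in> cball 1 (1 / 4)"
      hence "norm (1 - z) \<le> 1 / 4" by (simp add: dist_norm)
      hence "\<bar>Re (1 - z)\<bar> \<le> 1 / 4" using abs_Re_le_cmod [of "1 - z"] by linarith
      hence "Re (1 - z) \<le> 1 / 4" by (rule abs_le_D1)
      hence "1 - Re z \<le> 1 / 4" by (simp only: minus_complex.sel one_complex.sel)
      thus "1 / 2 < Re z" by linarith
    qed
  qed
  hence "bounded (f4_complex ` cball 1 (1 / 4))" by (rule compact_imp_bounded)
  then obtain C where "\<forall>w\<in>f4_complex ` cball 1 (1 / 4). norm w \<le> C" unfolding bounded_iff by (elim exE)
  hence C: "norm (f4_complex w) \<le> C" if "w \<in> cball 1 (1 / 4)" for w using that by blast
  have "norm (f4_complex (of_nat (Suc k) + z)) \<le> C * (1 / 2) ^ k" if z: "norm z \<le> 1 / 4" for k z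
  proof (induction k)
    case 0
    have "1 + z \<in> cball 1 (1 / 4)" using z by (simp add: dist_norm)
    from C [OF this] show ?case by simp
  next
    case (Suc k)
    have "- Re z \<le> 1 / 4" using abs_Re_le_cmod [of z] z by linarith
    moreover have "1 \<le> real (Suc k)" by simp
    ultimately have "3 / 4 \<le> real (Suc k) + Re z" by linarith
    hence "norm (f4_complex (of_nat (Suc k) + z + 1)) \<le> norm (f4_complex (of_nat (Suc k) + z)) / 2"
      by (intro norm_f4_complex_step) (simp only: plus_complex.sel complex_Re_of_nat)
    also have "\<dots> \<le> C * (1 / 2) ^ k / 2" using Suc by (intro divide_right_mono) auto
    also have "of_nat (Suc k) + z + 1 = of_nat (Suc (Suc k)) + z" by simp
    finally show ?case by (simp only: power_Suc times_divide_eq_right mult_1 mult.commute [of "1/2"] mult.assoc times_divide_eq_left mult_1_right)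
  qed
  thus ?thesis by blast
qed

text \<open>Iterated real derivatives equal complex ones because the half-line x > 1/2 is open: the
  induction hypothesis holds in a neighbourhood of \<open>x\<close>, so it can be
  differentiated.\<close>

lemma nth_deriv_f4:
  assumes "1 / 2 < x"
  shows "nth_deriv m f4 x = (deriv ^^ m) f4_complex (of_real x)"
  using assms
proof (induction m arbitrary: x)
  case 0
  thus ?case by (simp add: nth_deriv_def f4_eq_f4_complex)
next
  case (Suc m)
  have holo: "(deriv ^^ m) f4_complex holomorphic_on {z. 1 / 2 < Re z}"
    by (intro holomorphic_higher_deriv f4_complex_holomorphic open_halfspace_Re_gt)
  have "((deriv ^^ m) f4_complex has_field_derivative deriv ((deriv ^^ m) f4_complex) (of_real x)) (at (of_real x))"
    by (rule holomorphic_derivI [OF holo open_halfspace_Re_gt]) (use Suc.prems in simp)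
  hence "((\<lambda>y. (deriv ^^ m) f4_complex (of_real y)) has_vector_derivative deriv ((deriv ^^ m) f4_complex) (of_real x)) (at x)"
    by (rule has_vector_derivative_real_field)
  moreover have "open (greaterThan (1 / 2 :: real))" "x \<in> greaterThan (1 / 2)" using Suc.prems by auto
  ultimately have "(nth_deriv m f4 has_vector_derivative deriv ((deriv ^^ m) f4_complex) (of_real x)) (at x)"
    by (rule has_vector_derivative_transform_within_open) (use Suc.IH in auto)
  thus ?case
    by (simp add: nth_deriv_def vector_derivative_at)
qed

definition f4_series :: "complex \<Rightarrow> complex" where
  "f4_series z = (\<Sum>k. f4_complex (of_nat (Suc k) + z))"

text \<open>Each summand has Taylor coefficients f4^(m)(k)/m! at 0, and the geometric majorant
  \<open>C * (1 / 2) ^ k\<close> on a fixed disc permits summing them termwise. Convergence of all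
  derivative series comes from the same majorant.\<close>

lemma f4_series_expansion:
  shows "f4_series has_fps_expansion Abs_fps (\<lambda>m. (\<Sum>k. nth_deriv m f4 (real (Suc k))) / fact m)"
    and "summable (\<lambda>k. nth_deriv m f4 (real (Suc k)))"
proof -
  obtain C where "\<forall>k z. norm z \<le> 1 / 4 \<longrightarrow> norm (f4_complex (of_nat (Suc k) + z)) \<le> C * (1 / 2) ^ k"
    using f4_complex_bound by (elim exE)
  hence C: "norm (f4_complex (of_nat (Suc k) + z)) \<le> C * (1 / 2) ^ k" if "norm z \<le> 1 / 4" for k z
    using that by blast
  let ?F = "\<lambda>k. Abs_fps (\<lambda>m. nth_deriv m f4 (real (Suc k)) / fact m)"
  have holo: "(\<lambda>z. f4_complex (of_nat (Suc k) + z)) holomorphic_on ball 0 (1 / 4)" for k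
  proof -
    have "(f4_complex \<circ> (\<lambda>z. of_nat (Suc k) + z)) holomorphic_on ball 0 (1 / 4)"
    proof (rule holomorphic_on_compose_gen [OF _ f4_complex_holomorphic])
      show "(\<lambda>z. of_nat (Suc k) + z) ` ball 0 (1 / 4) \<subseteq> {z. 1 / 2 < Re z}"
      proof safe
        fix z :: complex assume "z \<in> ball 0 (1 / 4)"
        hence "\<bar>Re z\<bar> < 1 / 4" using abs_Re_le_cmod [of z] by simp
        thus "1 / 2 < Re (of_nat (Suc k) + z)" by simp
      qed
    qed (intro holomorphic_intros)
    thus ?thesis by (simp add: o_def)
  qed
  have F: "(\<lambda>z. f4_complex (of_nat (Suc k) + z)) has_fps_expansion ?F k" for k
  proof -
    have "(\<lambda>z. f4_complex (of_nat (Suc k) + z)) analytic_on {0}"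
      unfolding analytic_at using holo [of k] by (intro exI [of _ "ball 0 (1 / 4)"]) auto
    then obtain G where G: "(\<lambda>z. f4_complex (of_nat (Suc k) + z)) has_fps_expansion G"
      using analytic_at_imp_has_fps_expansion_0 by blast
    have half: "1 / 2 < real (Suc k)" by simp
    have "fps_nth G m = fps_nth (?F k) m" for m
    proof -
      have "fps_nth G m = (deriv ^^ m) (\<lambda>z. f4_complex (of_nat (Suc k) + z)) 0 / fact m"
        by (rule fps_nth_fps_expansion [OF G])
      also have "(deriv ^^ m) (\<lambda>z. f4_complex (of_nat (Suc k) + z)) 0 = (deriv ^^ m) f4_complex (of_nat (Suc k))"
        using higher_deriv_shift_0 [of m f4_complex "of_nat (Suc k)"] by (simp only: o_def)
      also have "\<dots> = nth_deriv m f4 (real (Suc k))"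
        using nth_deriv_f4 [of "real (Suc k)" m, OF half] by (simp only: of_real_of_nat_eq)
      finally show ?thesis by simp
    qed
    hence "G = ?F k" by (rule fps_ext)
    with G show ?thesis by simp
  qed
  have M: "norm (f4_complex (of_nat (Suc k) + z)) \<le> C * (1 / 2) ^ k" if "norm z < 1 / 4" for k z
    using that by (intro C) simp
  have summ: "summable (\<lambda>k. C * (1 / 2) ^ k)" by (intro summable_mult summable_geometric) simp
  have quarter: "(0 :: real) < 1 / 4" by simp
  note expansion = has_fps_expansion_suminf_holomorphic [where f = "\<lambda>k z. f4_complex (of_nat (Suc k) + z)"
      and F = ?F and R = "1 / 4" and M = "\<lambda>k. C * (1 / 2) ^ k", OF holo quarter M summ F]
  have s: "summable (\<lambda>k. nth_deriv m f4 (real (Suc k)))" for m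
  proof -
    have "summable (\<lambda>k. nth_deriv m f4 (real (Suc k)) / fact m)"
      using expansion(2) [of m] unfolding fps_nth_Abs_fps by (rule summable_norm_cancel)
    from summable_mult [OF this, of "fact m"] show ?thesis by (simp del: of_nat_Suc)
  qed
  show "summable (\<lambda>k. nth_deriv m f4 (real (Suc k)))" by (rule s)
  show "f4_series has_fps_expansion Abs_fps (\<lambda>m. (\<Sum>k. nth_deriv m f4 (real (Suc k))) / fact m)"
    using expansion(1) unfolding fps_nth_Abs_fps suminf_divide [OF s] f4_series_def [abs_def] .
qed

section \<open>Telescoping of the shifted sum\<close>

lemma gamma_series_real_bounds:
  fixes u w :: real
  assumes "0 < u" "0 \<le> w"
  shows "0 \<le> gamma_series u w" "gamma_series u w \<le> 1 / (u ^ 2 * (u + w))"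
proof -
  have s: "summable (\<lambda>k. gamma_coeff u k / (real k + u + w))" using summable_gamma_series [OF assms(1), of w] by simp
  show "0 \<le> gamma_series u w"
    unfolding gamma_series_def
    using s gamma_coeff_nonneg [OF assms(1)] assms by (intro suminf_nonneg) simp_all
  have "gamma_series u w \<le> (\<Sum>k. gamma_coeff u k / (u + w))"
    unfolding gamma_series_def
  proof (intro suminf_le)
    show "summable (\<lambda>k. of_real (gamma_coeff u k) / (real k + of_real u + w))" using s by simp
    show "summable (\<lambda>k. gamma_coeff u k / (u + w))"
      by (rule summable_divide [OF sums_summable [OF gamma_coeff_sums [OF assms(1)]]])
    show "of_real (gamma_coeff u k) / (real k + of_real u + w) \<le> gamma_coeff u k / (u + w)" for k
      using gamma_coeff_nonneg [OF assms(1), of k] assms by (auto intro!: divide_left_mono)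
  qed
  also have "\<dots> = 1 / (u ^ 2 * (u + w))"
    using sums_divide [OF gamma_coeff_sums [OF assms(1)], of "u + w"] by (simp add: sums_iff)
  finally show "gamma_series u w \<le> 1 / (u ^ 2 * (u + w))" .
qed

definition gamma_cube_quot :: "real \<Rightarrow> real" where
  "gamma_cube_quot t = Gamma (1 + t) ^ 3 / Gamma (1 + 3 * t)"

text \<open>An alternating antidifference: the sum of its values at s and s + 1, times -exp(pi i s),
  is f4(s + 1). It contains L on the diagonal u = 2t, w = t.\<close>

definition half_term :: "real \<Rightarrow> real" where
  "half_term t = gamma_cube_quot t / 2 * (1 / (2 * t) ^ 2 - 3 * t * gamma_series (2 * t) t)"

lemma Gamma_real_plus1: "0 < (x :: real) \<Longrightarrow> Gamma (x + 1) = x * Gamma x"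
  by (rule Gamma_plus1) (auto elim: nonpos_Ints_cases)

lemma Gamma_3_step:
  assumes "0 < (t :: real)"
  shows "Gamma (3 + 3 * t) = (2 + 3 * t) * (1 + 3 * t) * Gamma (1 + 3 * t)"
    "Gamma (1 + 3 * (t + 1)) = (3 + 3 * t) * Gamma (3 + 3 * t)"
    "Gamma (1 + (t + 1)) = (1 + t) * Gamma (1 + t)"
  using Gamma_real_plus1 [of "1 + 3 * t"] Gamma_real_plus1 [of "2 + 3 * t"] Gamma_real_plus1 [of "3 + 3 * t"]
    Gamma_real_plus1 [of "1 + t"] assms by (simp_all add: add_ac)

lemma gamma_cube_quot_pos: "0 < t \<Longrightarrow> 0 < gamma_cube_quot t"
  unfolding gamma_cube_quot_def by (intro divide_pos_pos zero_less_power Gamma_real_pos) auto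

lemma gamma_cube_quot_Suc:
  assumes "0 < t"
  shows "gamma_cube_quot (t + 1) = gamma_cube_quot t * ((1 + t) ^ 3 / ((1 + 3 * t) * (2 + 3 * t) * (3 + 3 * t)))"
  unfolding gamma_cube_quot_def Gamma_3_step [OF assms] power_mult_distrib by (simp only: times_divide_times_eq mult_ac)

lemma gamma_cube_quot_Suc_le:
  assumes "0 < t"
  shows "gamma_cube_quot (t + 1) \<le> gamma_cube_quot t * (1 / 3)"
  unfolding gamma_cube_quot_Suc [OF assms]
proof (intro mult_left_mono)
  have "3 * (1 + t) ^ 3 \<le> (1 + 3 * t) * (2 + 3 * t) * (3 + 3 * t)"
    using assms by (simp add: power3_eq_cube algebra_simps)
  thus "(1 + t) ^ 3 / ((1 + 3 * t) * (2 + 3 * t) * (3 + 3 * t)) \<le> 1 / 3"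
    using assms by (simp add: divide_simps)
qed (use gamma_cube_quot_pos [OF assms] in simp)

lemma gamma_cube_quot_add_le:
  assumes "0 < t"
  shows "gamma_cube_quot (t + real n) \<le> gamma_cube_quot t * (1 / 3) ^ n"
proof (induction n)
  case (Suc n)
  have "gamma_cube_quot (t + real n + 1) \<le> gamma_cube_quot (t + real n) * (1 / 3)" by (rule gamma_cube_quot_Suc_le) (use assms in simp)
  also have "\<dots> \<le> gamma_cube_quot t * (1 / 3) ^ n * (1 / 3)" by (rule mult_right_mono [OF Suc]) simp
  finally show ?case by (simp add: add_ac)
qed simp

text \<open>Replacing every denominator k + 3t of L(2t, t) by 3t gives 3t L(2t, t) \<le> 1/(2t)^2,
  so the bracket lies between 0 and 1/(2t)^2.\<close>

lemma half_term_bounds: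
  assumes "0 < t"
  shows "0 \<le> half_term t" "half_term t \<le> gamma_cube_quot t / 2 * (1 / (2 * t) ^ 2)"
proof -
  have "3 * t * gamma_series (2 * t) t \<le> 3 * t * (1 / ((2 * t) ^ 2 * (2 * t + t)))"
    by (rule mult_left_mono [OF gamma_series_real_bounds(2)]) (use assms in auto)
  also have "\<dots> = 1 / (2 * t) ^ 2" using assms by (simp add: field_simps)
  finally have 1: "3 * t * gamma_series (2 * t) t \<le> 1 / (2 * t) ^ 2" .
  have 2: "0 \<le> 3 * t * gamma_series (2 * t) t"
    using assms gamma_series_real_bounds(1) [of "2 * t" t] by simp
  show "0 \<le> half_term t" unfolding half_term_def
    using 1 gamma_cube_quot_pos [OF assms] by (intro mult_nonneg_nonneg) auto
  show "half_term t \<le> gamma_cube_quot t / 2 * (1 / (2 * t) ^ 2)" unfolding half_term_def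
    using 2 gamma_cube_quot_pos [OF assms] by (intro mult_left_mono) auto
qed

lemma half_term_LIMSEQ:
  assumes "0 < t"
  shows "(\<lambda>n. half_term (t + real n)) \<longlonglongrightarrow> 0"
proof (rule tendsto_sandwich)
  show "\<forall>\<^sub>F n in sequentially. 0 \<le> half_term (t + real n)"
    using half_term_bounds(1) assms by (intro always_eventually allI) simp
  show "\<forall>\<^sub>F n in sequentially. half_term (t + real n) \<le> gamma_cube_quot t * (1 / 3) ^ n / 2 * (1 / (2 * t) ^ 2)"
  proof (intro always_eventually allI)
    fix n
    have tn: "0 < t + real n" using assms by simp
    have "half_term (t + real n) \<le> gamma_cube_quot (t + real n) / 2 * (1 / (2 * (t + real n)) ^ 2)"
      by (rule half_term_bounds(2) [OF tn])
    also have "\<dots> \<le> gamma_cube_quot t * (1 / 3) ^ n / 2 * (1 / (2 * t) ^ 2)"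
      using gamma_cube_quot_pos [OF tn] gamma_cube_quot_pos [OF assms] assms
      by (intro mult_mono divide_right_mono gamma_cube_quot_add_le divide_left_mono power_mono) auto
    finally show "half_term (t + real n) \<le> gamma_cube_quot t * (1 / 3) ^ n / 2 * (1 / (2 * t) ^ 2)" .
  qed
  have "(\<lambda>n. gamma_cube_quot t * (1 / 3) ^ n / 2 * (1 / (2 * t) ^ 2)) \<longlonglongrightarrow> gamma_cube_quot t * 0 / 2 * (1 / (2 * t) ^ 2)"
    by (intro tendsto_mult tendsto_divide tendsto_const LIMSEQ_power_zero) auto
  thus "(\<lambda>n. gamma_cube_quot t * (1 / 3) ^ n / 2 * (1 / (2 * t) ^ 2)) \<longlonglongrightarrow> 0" by simp
qed simp

text \<open>\<open>A\<close>, \<open>B\<close>, \<open>C\<close>, \<open>D\<close> stand for L(2t,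
  t), L(2t+1, t), L(2t+2, t), L(2t+2, t+1). The step t -> t + 1 on the diagonal is thus two steps in
  u and one in w. Eliminating \<open>B\<close> and \<open>C\<close> expresses \<open>D\<close>
  through \<open>A\<close>, and \<open>A\<close> cancels from the left-hand side.\<close>

lemma contiguous_elimination:
  fixes t A B C D :: real
  assumes t: "0 < t"
    and eq1: "(1 + t) * B + 3 * t * A = 1 / (2 * t) ^ 2 - 1 / (2 * t + 1) ^ 2"
    and eq2: "(t + 2) * C + (3 * t + 1) * B = 1 / (2 * t + 1) ^ 2 - 1 / (2 * t + 2) ^ 2"
    and eq3: "(t + 2) * (3 * t + 2) * C + (t + 1) ^ 2 * D = 1 / (2 * t + 2) ^ 2"
  shows "1 / (2 * t) ^ 2 - 3 * t * A + (1 + t) ^ 3 / ((1 + 3 * t) * (2 + 3 * t) * (3 + 3 * t)) * (1 / (2 * (t + 1)) ^ 2 - 3 * (t + 1) * D)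
    = 2 * ((7 * t + 5) / (3 * (2 * t + 1) * ((2 + 3 * t) * (1 + 3 * t))))"
proof -
  define a b c where "a = 1 / (2 * t) ^ 2" and "b = 1 / (2 * t + 1) ^ 2" and "c = 1 / (2 * t + 2) ^ 2"
  note eqs = eq1 [folded a_def b_def] eq2 [folded b_def c_def] eq3 [folded c_def]
  have D: "(1 + t) ^ 3 * (c - 3 * (t + 1) * D) = (1 + t) ^ 3 * c - 3 * (t + 1) ^ 2 * (c - (3 * t + 2) * (b - c))
      - 3 * (t + 1) * (3 * t + 2) * (3 * t + 1) * (a - b - 3 * t * A)"
    using eqs by algebra
  have "b + ((1 + t) ^ 3 * c - 3 * (t + 1) ^ 2 * (c - (3 * t + 2) * (b - c))) / ((1 + 3 * t) * (2 + 3 * t) * (3 + 3 * t))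
      = 2 * ((7 * t + 5) / (3 * (2 * t + 1) * ((2 + 3 * t) * (1 + 3 * t))))"
    unfolding b_def c_def using t
    by (simp add: divide_simps) (simp add: algebra_simps power2_eq_square power3_eq_cube)?
  moreover have "3 * (t + 1) * (3 * t + 2) * (3 * t + 1) * (a - b - 3 * t * A) / ((1 + 3 * t) * (2 + 3 * t) * (3 + 3 * t)) = a - b - 3 * t * A"
  proof -
    have "3 * (t + 1) * (3 * t + 2) * (3 * t + 1) = (1 + 3 * t) * (2 + 3 * t) * (3 + 3 * t)" by algebra
    thus ?thesis using t by simp
  qed
  moreover have "1 / (2 * (t + 1)) ^ 2 = c" unfolding c_def by (simp add: distrib_left)
  ultimately show ?thesis
    unfolding a_def [symmetric] times_divide_eq_left by (simp only: D diff_divide_distrib)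
qed

lemma half_term_add_Suc:
  assumes t: "0 < t"
  shows "half_term t + half_term (t + 1) = (7 * t + 5) * Gamma (1 + t) ^ 3 / (3 * (2 * t + 1) * Gamma (3 + 3 * t))"
proof -
  have notin: "t \<notin> of_real ` {..-(2 * t)}" "t \<notin> of_real ` {..-(2 * t + 1)}" "t \<notin> of_real ` {..-(2 * t + 1 + 1)}"
    using t by auto
  have "(1 + t) * gamma_series (2 * t + 1) t + 3 * t * gamma_series (2 * t) t = 1 / (2 * t) ^ 2 - 1 / (2 * t + 1) ^ 2"
    using gamma_series_shift_u [OF _ notin(1)] t by (simp add: add.commute)
  moreover have "(t + 2) * gamma_series (2 * t + 2) t + (3 * t + 1) * gamma_series (2 * t + 1) t = 1 / (2 * t + 1) ^ 2 - 1 / (2 * t + 2) ^ 2"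
    using gamma_series_shift_u [OF _ notin(2)] t by (simp add: add_ac)
  moreover have "(t + 2) * (3 * t + 2) * gamma_series (2 * t + 2) t + (t + 1) ^ 2 * gamma_series (2 * t + 2) (t + 1) = 1 / (2 * t + 2) ^ 2"
  proof -
    have "(t ^ 2 - (2 * t + 2) ^ 2) * gamma_series (2 * t + 2) t - (t + 1) ^ 2 * gamma_series (2 * t + 2) (t + 1) = - (1 / (2 * t + 2) ^ 2)"
      using gamma_series_shift_w [OF _ notin(3)] t by (simp add: add_ac)
    moreover have "t ^ 2 - (2 * t + 2) ^ 2 = - ((t + 2) * (3 * t + 2))" by algebra
    ultimately show ?thesis by simp
  qed
  ultimately have E: "1 / (2 * t) ^ 2 - 3 * t * gamma_series (2 * t) t + (1 + t) ^ 3 / ((1 + 3 * t) * (2 + 3 * t) * (3 + 3 * t)) *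
      (1 / (2 * (t + 1)) ^ 2 - 3 * (t + 1) * gamma_series (2 * t + 2) (t + 1))
    = 2 * ((7 * t + 5) / (3 * (2 * t + 1) * ((2 + 3 * t) * (1 + 3 * t))))"
    by (rule contiguous_elimination [OF t])
  have l: "2 * (t + 1) = 2 * t + 2" by simp
  have "half_term t + half_term (t + 1) = gamma_cube_quot t / 2 * (1 / (2 * t) ^ 2 - 3 * t * gamma_series (2 * t) t + (1 + t) ^ 3 / ((1 + 3 * t) * (2 + 3 * t) * (3 + 3 * t)) *
      (1 / (2 * (t + 1)) ^ 2 - 3 * (t + 1) * gamma_series (2 * t + 2) (t + 1)))"
  proof -
    have "q / 2 * x + q * r / 2 * y = q / 2 * (x + r * y)" for q r x y :: real by (simp add: algebra_simps)
    thus ?thesis unfolding half_term_def gamma_cube_quot_Suc [OF t] l by blast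
  qed
  also have "\<dots> = gamma_cube_quot t * ((7 * t + 5) / (3 * (2 * t + 1) * ((2 + 3 * t) * (1 + 3 * t))))"
  proof -
    have "q / 2 * (2 * x) = q * x" for q x :: real by simp
    thus ?thesis unfolding E by blast
  qed
  also have "\<dots> = (7 * t + 5) * Gamma (1 + t) ^ 3 / (3 * (2 * t + 1) * Gamma (3 + 3 * t))"
    unfolding gamma_cube_quot_def Gamma_3_step(1) [OF t] by (simp only: times_divide_times_eq mult_ac)
  finally show ?thesis .
qed

lemma f4_Suc_half_term:
  assumes "0 < s"
  shows "f4 (s + 1) = - exp (of_real pi * \<i> * of_real s) * of_real (half_term s + half_term (s + 1))"
proof -
  have e: "exp (of_real pi * \<i> * of_real (s + 1)) = - exp (of_real pi * \<i> * of_real s)"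
    by (simp add: ring_distribs exp_add)
  have g: "Gamma (s + 1 + 1) = (1 + s) * Gamma (1 + s)" "Gamma (3 * (s + 1) + 1) = (3 * (s + 1)) * Gamma (3 + 3 * s)"
    using Gamma_3_step(2,3) [OF assms] by (simp_all add: add_ac distrib_left)
  have "Gamma (3 + 3 * s) > 0" using assms by (intro Gamma_real_pos) simp
  hence "(7 * (s + 1) - 2) * ((1 + s) * Gamma (1 + s)) ^ 3 / ((2 * (s + 1) - 1) * (s + 1) ^ 2 * ((3 * (s + 1)) * Gamma (3 + 3 * s)))
     = (7 * s + 5) * Gamma (1 + s) ^ 3 / (3 * (2 * s + 1) * Gamma (3 + 3 * s))"
    using assms by (simp add: divide_simps) (simp add: algebra_simps power2_eq_square power3_eq_cube)?
  hence "of_real ((7 * (s + 1) - 2) * ((1 + s) * Gamma (1 + s)) ^ 3 / ((2 * (s + 1) - 1) * (s + 1) ^ 2 * ((3 * (s + 1)) * Gamma (3 + 3 * s))))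
     = complex_of_real (half_term s + half_term (s + 1))"
    unfolding half_term_add_Suc [OF assms] by (simp only:)
  thus ?thesis
    unfolding f4_def e g by (simp only: of_real_mult [symmetric] of_real_divide [symmetric] of_real_power [symmetric] mult.assoc times_divide_eq_right [symmetric])
qed

text \<open>exp(pi i (t + k)) = (-1)^k exp(pi i t) alternates along the integers, so the sums of
  consecutive half terms telescope; the remainder vanishes because half terms decay
  geometrically.\<close>

lemma f4_series_of_real:
  assumes "0 < t"
  shows "f4_series (of_real t) = - exp (of_real pi * \<i> * of_real t) * of_real (half_term t)"
proof -
  let ?E = "exp (of_real pi * \<i> * of_real t)"
  have "(\<lambda>k. (-1) ^ k * (half_term (t + real k) + half_term (t + real (Suc k)))) sums half_term t"
  proof -
    have "(\<lambda>k. (-1) ^ k * half_term (t + real k)) \<longlonglongrightarrow> 0"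
      by (rule tendsto_norm_zero_cancel)
         (use tendsto_norm_zero [OF half_term_LIMSEQ [OF assms]] in \<open>simp add: abs_mult power_abs\<close>)
    from telescope_sums' [OF this]
    show ?thesis by (simp add: distrib_left algebra_simps)
  qed
  hence "(\<lambda>k. - ?E * of_real ((-1) ^ k * (half_term (t + real k) + half_term (t + real (Suc k))))) sums (- ?E * of_real (half_term t))"
    by (intro sums_mult sums_of_real)
  moreover have "- ?E * of_real ((-1) ^ k * (half_term (t + real k) + half_term (t + real (Suc k)))) = f4_complex (of_nat (Suc k) + of_real t)" for k
  proof -
    have e: "exp (of_real pi * \<i> * of_real (t + real k)) = ?E * (-1) ^ k"
    proof -
      have "of_real pi * \<i> * of_real (t + real k) = of_real pi * \<i> * of_real t + of_nat k * (of_real pi * \<i>)"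
        by (simp add: algebra_simps)
      thus ?thesis by (simp add: exp_add exp_of_nat_mult)
    qed
    have "f4_complex (of_nat (Suc k) + of_real t) = f4 (t + real k + 1)"
      unfolding f4_eq_f4_complex by (simp add: add_ac)
    also have "\<dots> = - (?E * (-1) ^ k) * of_real (half_term (t + real k) + half_term (t + real k + 1))"
      by (subst f4_Suc_half_term) (use assms in simp, simp only: e)
    finally show ?thesis by (simp add: add_ac)
  qed
  ultimately show ?thesis unfolding f4_series_def by (simp add: sums_iff)
qed

section \<open>Closed form of the shifted sum for small t\<close>

lemma gamma_series_of_real: "0 < u \<Longrightarrow> gamma_series u (complex_of_real w) = of_real (gamma_series u w)"
proof -
  assume "0 < u"
  have "of_real (gamma_series u w) = (\<Sum>k. complex_of_real (gamma_coeff u k / (real k + u + w)))"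
    unfolding gamma_series_def using summable_gamma_series [OF \<open>0 < u\<close>, of w] by (subst suminf_of_real) simp_all
  thus ?thesis unfolding gamma_series_def by simp
qed

text \<open>The hypothesis \<alpha> z^2 = u^2 identifies the partial sine products with those in
  \<open>product_series\<close>. For \<beta> = 0 the undefined pole term is zero on both sides,
  which is the form needed at w = 0.\<close>

lemma sine_series_eq_product_series:
  assumes "0 < u" "u < 1" and "\<alpha> * z ^ 2 = complex_of_real (u ^ 2)"
  shows "sine_series u (\<beta> * z) = - 1 / (\<beta> * z) - of_real (u ^ 2) * product_series \<alpha> \<beta> z"
proof -
  let ?f = "\<lambda>k. complex_of_real (sine_coeff u k) / (of_nat k - \<beta> * z)"
  let ?h = "\<lambda>k. (\<Prod>j<k. 1 - \<alpha> * z ^ 2 / of_nat (Suc j) ^ 2) * (1 / of_nat (Suc k) ^ 2 * (1 / (of_nat (Suc k) - \<beta> * z)))"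
  have P: "complex_of_real (sine_product u k) = (\<Prod>j<k. 1 - \<alpha> * z ^ 2 / of_nat (Suc j) ^ 2)" for k
    unfolding sine_product_def assms(3) by (simp add: add.commute)
  have c: "?f (Suc k) = - of_real (u ^ 2) * ?h k" for k
    unfolding P [symmetric] sine_coeff_simps by (simp add: add.commute)
  have s: "summable ?f" by (rule summable_sine_series [OF assms(1,2)])
  hence "summable (\<lambda>k. ?f (Suc k))" by (subst summable_Suc_iff)
  hence "summable (\<lambda>k. - of_real (u ^ 2) * ?h k)" unfolding c .
  from summable_mult [OF this, of "- 1 / of_real (u ^ 2)"] have sh: "summable ?h"
    using assms(1) by (simp add: mult.assoc [symmetric])
  have "sine_series u (\<beta> * z) = (\<Sum>k. ?f (Suc k)) + ?f 0"
    unfolding sine_series_def by (rule suminf_split_head [OF s, THEN eq_diff_eq [THEN iffD1], symmetric])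
  also have "(\<Sum>k. ?f (Suc k)) = - of_real (u ^ 2) * product_series \<alpha> \<beta> z"
    unfolding c product_series_def by (rule suminf_mult [OF sh])
  also have "?f 0 = - 1 / (\<beta> * z)" by (simp add: sine_coeff_simps)
  finally show ?thesis by simp
qed

lemma Gamma_reflected_sin:
  assumes "0 < t" "t < 1"
  shows "Gamma (1 + complex_of_real t) * Gamma (1 - of_real t) = of_real (pi * t / sin (pi * t))"
proof -
  have "Gamma (of_real t) * Gamma (1 - of_real t) = of_real pi / sin (of_real pi * complex_of_real t)"
    by (rule Gamma_reflection_complex)
  moreover have "Gamma (of_real t + 1) = of_real t * Gamma (complex_of_real t)"
    by (rule Gamma_plus1) (use assms in \<open>auto elim!: nonpos_Ints_cases simp: complex_eq_iff\<close>)
  moreover have "sin (of_real pi * complex_of_real t) = of_real (sin (pi * t))"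
    by (simp flip: sin_of_real)
  ultimately have "Gamma (1 + complex_of_real t) * Gamma (1 - of_real t) = of_real t * (of_real pi / of_real (sin (pi * t)))"
    by (simp only: add.commute mult.assoc)
  thus ?thesis by simp
qed

text \<open>With w = z and u = 2z the trigonometric quotient is sin(-pi z)/sin(pi z) = -1, so the
  vanishing of \<open>periodic_comb\<close> can be solved for L(2z, z). The bound t < 1/4 ensures u
  < 1/2.\<close>

lemma gamma_series_diagonal:
  assumes t: "0 < t" "t < 1 / 4"
  defines "s1 \<equiv> \<lambda>z. Gamma (1 + z) * Gamma (1 - z) :: complex"
    and "G \<equiv> \<lambda>z. Gamma (1 + z) ^ 3 / Gamma (1 + 3 * z) :: complex"
    and "z \<equiv> complex_of_real t"
  shows "3 * z ^ 2 * G z * gamma_series (2 * t) z = - s1 z * s1 (2 * z) / (2 * z) + 3 * G z * s1 (2 * z) / (4 * z) * (1 + 4 * z ^ 3 * product_series 4 1 z)"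
proof -
  define u where "u = 2 * t"
  have u: "0 < u" "u < 1 / 2" and z0: "z \<noteq> 0" and uz: "complex_of_real u = 2 * z" using t by (auto simp: u_def z_def)
  have R: "sine_series u z = - 1 / z - 4 * z ^ 2 * product_series 4 1 z"
    using sine_series_eq_product_series [of u 4 z 1] u uz by (simp add: u_def z_def power_mult_distrib)
  have s2: "s1 (2 * z) = of_real (pi * u / sin (pi * u))"
    using Gamma_reflected_sin [of u] u by (simp add: s1_def flip: uz)
  have "0 < sin (pi * u)" by (rule sin_pi_pos) (use u in auto)
  hence c: "of_real (pi / (u * sin (pi * u))) = s1 (2 * z) / (4 * z ^ 2)" "of_real (pi / sin (pi * u)) = s1 (2 * z) / (2 * z)"
    unfolding s2 using u z0 t
    by (simp_all add: u_def z_def power2_eq_square)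
  have sinz: "sin (of_real pi * z) \<noteq> 0"
  proof -
    have "0 < sin (pi * t)" by (rule sin_pi_pos) (use t in auto)
    hence "complex_of_real (sin (pi * t)) \<noteq> 0" by simp
    thus ?thesis by (simp add: z_def sin_of_real [symmetric] del: sin_of_real flip: of_real_mult)
  qed
  have q: "sin (of_real pi * (z - of_real u)) / sin (of_real pi * z) = -1"
  proof -
    have "of_real pi * (z - of_real u) = - (of_real pi * z)" unfolding uz by simp
    thus ?thesis using sinz by (simp only: sin_minus) simp
  qed
  have rp: "rGamma w = w * rGamma (1 + w)" for w :: complex
    using rGamma_plus1 [of w] by (simp add: add.commute)
  have nz: "rGamma (1 + z) \<noteq> 0" "rGamma (1 - z) \<noteq> 0"
    using t by (auto simp: rGamma_eq_zero_iff z_def elim!: nonpos_Ints_cases dest: arg_cong [of _ _ Re])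
  \<comment> \<open>Raising the arguments -z, 3z and z of the reciprocal Gamma factors by one
    produces (-z)(3z)/z^2 = -3; multiplication by \<open>s1 z\<close> completes the cube of Gamma(1
    + z).\<close>
  have g: "z ^ 2 * rGamma_quot u z * s1 z = - 3 * z ^ 2 * G z"
  proof -
    have "rGamma_quot u z = (- z * rGamma (1 - z)) * (3 * z * rGamma (1 + 3 * z)) / (z * rGamma (1 + z)) ^ 2"
      unfolding rGamma_quot_def uz using rp [of "- z"] rp [of "3 * z"] rp [of z] by simp
    thus ?thesis unfolding s1_def G_def Gamma_def using nz z0
      by (simp add: field_simps power2_eq_square power3_eq_cube)
  qed
  have scale: "a * s * X = s * b / c" if "a * X = b / c" for a s X b c :: complex
  proof -
    have "a * s * X = s * (a * X)" by (simp only: mult_ac)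
    thus ?thesis unfolding that by simp
  qed
  have "periodic_comb u z = 0" unfolding z_def by (rule periodic_comb_eq_0) (use t u in auto)
  hence "z ^ 2 * rGamma_quot u z * (gamma_series u z + s1 (2 * z) / (4 * z ^ 2) * sine_series u z) = s1 (2 * z) / (2 * z)"
    unfolding periodic_comb_def c times_divide_eq_right [symmetric] q by (simp add: add_eq_0_iff2)
  hence "(z ^ 2 * rGamma_quot u z * s1 z) * (gamma_series u z + s1 (2 * z) / (4 * z ^ 2) * sine_series u z) = s1 z * s1 (2 * z) / (2 * z)"
    by (rule scale)
  hence "- 3 * z ^ 2 * G z * (gamma_series u z + s1 (2 * z) / (4 * z ^ 2) * (- 1 / z - 4 * z ^ 2 * product_series 4 1 z)) = s1 z * s1 (2 * z) / (2 * z)"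
    unfolding g R .
  moreover have "- 3 * z ^ 2 * b * (L + s / (4 * z ^ 2) * (- 1 / z - 4 * z ^ 2 * Q)) =
     - (3 * z ^ 2 * b * L) + 3 * b * s / (4 * z) * (1 + 4 * z ^ 3 * Q)" for b L s Q
    using z0 by (simp add: field_simps power2_eq_square power3_eq_cube)
  ultimately have "- (3 * z ^ 2 * G z * gamma_series u z) + 3 * G z * s1 (2 * z) / (4 * z) * (1 + 4 * z ^ 3 * product_series 4 1 z) =
      s1 z * s1 (2 * z) / (2 * z)" by (simp only:)
  moreover have "P = - x * y / w + Q" if "- P + Q = x * y / w" for P Q x y w :: complex
  proof -
    have "- x * y / w = - (x * y / w)" by simp
    thus ?thesis by (simp add: that [symmetric])
  qed
  ultimately show ?thesis unfolding u_def by blast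
qed

text \<open>The factor 4 z^2 clears the denominator (2z)^2 of the half term and the 1/z in the
  diagonal value of L, so every factor on the right has a power series at 0.\<close>

lemma f4_series_closed_form:
  assumes t: "0 < t" "t < 1 / 4"
  defines "s1 \<equiv> \<lambda>z. Gamma (1 + z) * Gamma (1 - z) :: complex"
    and "G \<equiv> \<lambda>z. Gamma (1 + z) ^ 3 / Gamma (1 + 3 * z) :: complex"
    and "z \<equiv> complex_of_real t"
  shows "4 * z ^ 2 * f4_series z = - exp (of_real pi * \<i> * z) *
     (s1 z * s1 (2 * z) + G z * (1 / 2 - 3 / 2 * s1 (2 * z) * (1 + 4 * z ^ 3 * product_series 4 1 z)))"
proof -
  have z0: "z \<noteq> 0" using t by (simp add: z_def)
  have Gr: "of_real (gamma_cube_quot t) = G z"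
    using Gamma_complex_of_real [of "1 + t"] Gamma_complex_of_real [of "1 + 3 * t"] by (simp add: G_def gamma_cube_quot_def z_def)
  have "of_real (half_term t) = G z / 2 * (1 / (2 * z) ^ 2 - 3 * z * gamma_series (2 * t) z)"
    using t Gr gamma_series_of_real [of "2 * t" t] by (simp add: half_term_def z_def)
  hence "4 * z ^ 2 * of_real (half_term t) = G z / 2 - 2 * z * (3 * z ^ 2 * G z * gamma_series (2 * t) z)"
    using z0 by (simp add: field_simps power2_eq_square)
  also have "3 * z ^ 2 * G z * gamma_series (2 * t) z = - s1 z * s1 (2 * z) / (2 * z) + 3 * G z * s1 (2 * z) / (4 * z) * (1 + 4 * z ^ 3 * product_series 4 1 z)"
    unfolding s1_def G_def z_def by (rule gamma_series_diagonal [OF t])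
  also have "G z / 2 - 2 * z * (- s1 z * s1 (2 * z) / (2 * z) + 3 * G z * s1 (2 * z) / (4 * z) * (1 + 4 * z ^ 3 * product_series 4 1 z))
     = s1 z * s1 (2 * z) + G z * (1 / 2 - 3 / 2 * s1 (2 * z) * (1 + 4 * z ^ 3 * product_series 4 1 z))"
  proof -
    have "b / 2 - 2 * z * (- a * s / (2 * z) + 3 * b * s / (4 * z) * Q) = a * s + b * (1 / 2 - 3 / 2 * s * Q)" for a b s Q
      using z0 by (simp add: field_simps)
    thus ?thesis by blast
  qed
  finally have "- exp (of_real pi * \<i> * z) * (4 * z ^ 2 * of_real (half_term t)) = - exp (of_real pi * \<i> * z) *
    (s1 z * s1 (2 * z) + G z * (1 / 2 - 3 / 2 * s1 (2 * z) * (1 + 4 * z ^ 3 * product_series 4 1 z)))" by (simp only:)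
  moreover have "f4_series z = - exp (of_real pi * \<i> * z) * of_real (half_term t)"
    unfolding z_def by (rule f4_series_of_real [OF t(1)])
  ultimately show ?thesis by (simp only: mult_ac)
qed

section \<open>The limiting case w = 0\<close>

lemma gamma_series_0_expansion:
  assumes "0 < u"
  shows "(\<lambda>n. (-1) ^ n * (1 / (real (Suc n) + u)) ^ 2) sums ((1 / u ^ 2 - u * gamma_series u 0) / 2)"
proof -
  define M where "M v = v * gamma_series v (0 :: real)" for v
  define a where "a k = 1 / (real k + u) ^ 2" for k
  \<comment> \<open>At w = 0 the contiguous relation in u involves only v L(v, 0) at v = u + k and v
    = u + k + 1. Summing it with alternating signs isolates u L(u, 0) as an alternating sum of
    inverse squares.\<close>
  have rec: "M (u + real k) + M (u + real (Suc k)) = a k - a (Suc k)" for k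
  proof -
    have "(0 :: real) \<notin> of_real ` {..-(u + real k)}" using assms by auto
    from gamma_series_shift_u [OF _ this] assms show ?thesis unfolding M_def a_def by (simp add: add_ac)
  qed
  have M: "(\<lambda>n. M (u + real n)) \<longlonglongrightarrow> 0"
  proof (rule tendsto_sandwich)
    have bounds: "0 \<le> M v \<and> M v \<le> 1 / v ^ 2" if "0 < v" for v
    proof -
      have "v * gamma_series v 0 \<le> v * (1 / (v ^ 2 * (v + 0)))"
        by (rule mult_left_mono [OF gamma_series_real_bounds(2)]) (use that in auto)
      also have "\<dots> = 1 / v ^ 2" using that by simp
      finally show ?thesis using that gamma_series_real_bounds(1) [of v 0] by (simp add: M_def)
    qed
    show "\<forall>\<^sub>F n in sequentially. 0 \<le> M (u + real n)" "\<forall>\<^sub>F n in sequentially. M (u + real n) \<le> 1 / (u + real n) ^ 2"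
      using bounds assms by (intro always_eventually allI; simp)+
    show "(\<lambda>n. 1 / (u + real n) ^ 2) \<longlonglongrightarrow> 0" by real_asymp
  qed simp
  have "(\<lambda>k. (-1) ^ k * M (u + real k)) \<longlonglongrightarrow> 0"
    by (rule tendsto_norm_zero_cancel) (use tendsto_norm_zero [OF M] in \<open>simp add: abs_mult power_abs\<close>)
  from telescope_sums' [OF this]
  have 1: "(\<lambda>k. (-1) ^ k * (a k - a (Suc k))) sums M u"
    unfolding rec [symmetric] by (simp add: algebra_simps)
  have "summable (\<lambda>k. (-1) ^ k * a k)"
  proof (rule summable_comparison_test' [of "\<lambda>k. 1 / (real k + u) ^ 2" 0])
    have "summable (\<lambda>k. inverse (real (Suc k) ^ 2))" by (rule summable_inverse_Suc_square)
    hence "summable (\<lambda>k. 1 / (real (Suc k) + u) ^ 2)"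
    proof (rule summable_comparison_test' [of _ 0])
      fix k :: nat
      have "1 / (real (Suc k) + u) ^ 2 \<le> 1 / real (Suc k) ^ 2"
        using assms by (intro divide_left_mono power_mono) auto
      thus "norm (1 / (real (Suc k) + u) ^ 2) \<le> inverse (real (Suc k) ^ 2)"
        by (simp add: inverse_eq_divide del: of_nat_Suc)
    qed
    thus "summable (\<lambda>k. 1 / (real k + u) ^ 2)" by (subst (asm) summable_Suc_iff)
  qed (simp add: a_def abs_mult power_abs)
  hence s: "(\<lambda>k. (-1) ^ k * a k) sums (\<Sum>k. (-1) ^ k * a k)" by (rule summable_sums)
  hence "(\<lambda>k. (-1) ^ Suc k * a (Suc k)) sums ((\<Sum>k. (-1) ^ k * a k) - a 0)"
    by (subst sums_Suc_iff) simp
  from sums_minus [OF this] have t: "(\<lambda>k. (-1) ^ k * a (Suc k)) sums (a 0 - (\<Sum>k. (-1) ^ k * a k))" by simp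
  from sums_diff [OF s t] have "(\<lambda>k. (-1) ^ k * (a k - a (Suc k))) sums ((\<Sum>k. (-1) ^ k * a k) - (a 0 - (\<Sum>k. (-1) ^ k * a k)))"
    by (simp add: right_diff_distrib)
  with 1 have "M u = (\<Sum>k. (-1) ^ k * a k) - (a 0 - (\<Sum>k. (-1) ^ k * a k))" by (rule sums_unique2)
  hence "a 0 - (\<Sum>k. (-1) ^ k * a k) = (1 / u ^ 2 - u * gamma_series u 0) / 2"
    by (simp add: M_def a_def)
  moreover have "(\<lambda>k. (-1) ^ k * a (Suc k)) = (\<lambda>n. (-1) ^ n * (1 / (real (Suc n) + u)) ^ 2)"
    by (simp add: a_def power_divide)
  ultimately show ?thesis using t by (simp only:)
qed

lemma sine_series_tail_0:
  assumes "0 < u" "u < 1"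
  shows "- of_real (u ^ 2) + sine_series_tail u 0 = - of_real (u ^ 2) * product_series 1 0 (complex_of_real u)"
proof -
  have s: "summable (\<lambda>k. complex_of_real (sine_coeff u k) / (of_nat k - 0))" by (rule summable_sine_series [OF assms])
  have "sine_series u 0 = - of_real (u ^ 2) * product_series 1 0 (of_real u)"
    using sine_series_eq_product_series [OF assms, of 1 "of_real u" 0] by simp
  moreover have "sine_series u 0 = - of_real (u ^ 2) + sine_series_tail u 0"
    using sine_series_split [OF assms, of 0] by simp
  ultimately show ?thesis by simp
qed

text \<open>The reflection formula turns \<open>rGamma (t - u)\<close> into sin(pi (t - u)) times a
  nonvanishing factor, and that sine also occurs in the trigonometric term. For t \<noteq> u it
  cancels, leaving -c h(t)/t with h regular at 0, ready for the limit t -> 0.\<close>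

lemma periodic_comb_real_cleared:
  assumes u: "0 < u" "u < 1 / 2" and t: "0 < t" "t < 1 / 2" "t \<noteq> u"
  shows "gamma_series u (of_real t) + of_real (pi / (u * sin (pi * u))) * sine_series u (of_real t) =
    - of_real (pi / (u * sin (pi * u))) * (of_real u * rGamma (1 + of_real u - of_real t) * rGamma (1 + of_real t) *
      Gamma (1 - of_real t) * Gamma (of_real t + of_real u)) / complex_of_real t"
proof -
  let ?t = "complex_of_real t" and ?u = "complex_of_real u"
  let ?X = "gamma_series u ?t + of_real (pi / (u * sin (pi * u))) * sine_series u ?t"
  have p0: "periodic_comb u ?t = 0" by (rule periodic_comb_eq_0 [OF u t(1,2)])
  define S where "S = sin (of_real pi * (?t - ?u))"
  have S0: "S \<noteq> 0"
    unfolding S_def sin_complex_pi_eq_0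
  proof
    assume "?t - ?u \<in> \<int>"
    then obtain n :: int where "?t - ?u = of_int n" by (elim Ints_cases)
    hence "t - u = of_int n" by (metis of_real_diff of_real_eq_iff of_real_of_int_eq)
    moreover have "\<bar>t - u\<bar> < 1" "t - u \<noteq> 0" using u t by auto
    ultimately show False by (cases "n = 0") auto
  qed
  have r1: "rGamma (?t - ?u) * rGamma (1 + ?u - ?t) = S / of_real pi"
    using rGamma_reflection_complex [of "?t - ?u"] by (simp add: S_def algebra_simps)
  have r2: "rGamma ?t * rGamma (1 - ?t) = sin (of_real pi * ?t) / of_real pi"
    by (rule rGamma_reflection_complex)
  have r3: "rGamma ?t = ?t * rGamma (1 + ?t)"
    using rGamma_plus1 [of ?t] by (simp add: add.commute)
  have pos: "w \<notin> \<int>\<^sub>\<le>\<^sub>0" if "0 < Re w" for w using that by (auto elim!: nonpos_Ints_cases)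
  have nz: "rGamma (1 + ?t) \<noteq> 0" "rGamma (1 - ?t) \<noteq> 0" "rGamma (?t + ?u) \<noteq> 0" "rGamma (1 + ?u - ?t) \<noteq> 0" "?t \<noteq> 0" "?u \<noteq> 0"
    using u t pos [of "1 + ?t"] pos [of "1 - ?t"] pos [of "?t + ?u"] pos [of "1 + ?u - ?t"]
    by (auto simp: rGamma_eq_zero_iff)
  have sp: "complex_of_real (sin (pi * u)) \<noteq> 0" using sin_pi_pos [of u] u by simp
  have st: "sin (of_real pi * ?t) = of_real pi * (?t * rGamma (1 + ?t) * rGamma (1 - ?t))"
    using r2 unfolding r3 by simp
  have rS: "rGamma (?t - ?u) = S / of_real pi / rGamma (1 + ?u - ?t)" unfolding r1 [symmetric] using nz by simp
  have "?t ^ 2 * rGamma_quot u ?t * ?X + of_real (pi / sin (pi * u)) * S / sin (of_real pi * ?t) = 0"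
    using p0 unfolding periodic_comb_def S_def .
  moreover have "?t ^ 2 * rGamma_quot u ?t = S / of_real pi / rGamma (1 + ?u - ?t) * rGamma (?t + ?u) / rGamma (1 + ?t) ^ 2"
    unfolding rGamma_quot_def rS r3 using nz by (simp add: power_mult_distrib)
  ultimately have "S / of_real pi / rGamma (1 + ?u - ?t) * rGamma (?t + ?u) / rGamma (1 + ?t) ^ 2 * ?X +
     of_real (pi / sin (pi * u)) * S / (of_real pi * (?t * rGamma (1 + ?t) * rGamma (1 - ?t))) = 0" unfolding st by (simp only:)
  moreover have "X = - (p / (w * s)) * (w * g4 * g1 * inverse g2 * inverse g3) / c"
    if "S' / p / g4 * g3 / g1 ^ 2 * X + p / s * S' / (p * (c * g1 * g2)) = 0" "S' \<noteq> 0" "p \<noteq> 0" "g1 \<noteq> 0" "g2 \<noteq> 0" "g3 \<noteq> 0" "g4 \<noteq> 0"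
      "c \<noteq> 0" "w \<noteq> 0" "s \<noteq> 0" for X S' p g1 g2 g3 g4 c w s :: complex
  proof -
    have "S' / p / g4 * g3 / g1 ^ 2 * X = - (p / s * S' / (p * (c * g1 * g2)))" using that(1) by (simp add: add_eq_0_iff2)
    moreover have "S' / p / g4 * g3 / g1 ^ 2 \<noteq> 0" using that(2-) by simp
    moreover have "X = a * X / a" if "a \<noteq> 0" for a :: complex using that by simp
    ultimately have "X = - (p / s * S' / (p * (c * g1 * g2))) / (S' / p / g4 * g3 / g1 ^ 2)" by metis
    also have "\<dots> = - (p / (w * s)) * (w * g4 * g1 * inverse g2 * inverse g3) / c"
      using that(2-) by (simp add: divide_simps power2_eq_square)
    finally show ?thesis .
  qed
  ultimately show ?thesis
    unfolding Gamma_def of_real_divide of_real_mult using S0 nz sp by simp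
qed

text \<open>Both sides of the cleared relation have the polar part -c/t, on the left from the k = 0
  term of R and on the right because h(0) = 1. Removing it and letting t -> 0 leaves -c h'(0), and
  the logarithmic derivative of h brings in Digamma.\<close>

lemma digamma_limit:
  assumes u: "0 < u" "u < 1 / 2"
  defines "z \<equiv> complex_of_real u"
  shows "gamma_series u 0 - of_real (pi / (u * sin (pi * u))) * (z ^ 2 * product_series 1 0 z) =
    - of_real (pi / (u * sin (pi * u))) * (2 * Digamma (1 + z) + 2 * euler_mascheroni - 1 / z)"
proof -
  define c where "c = complex_of_real (pi / (u * sin (pi * u)))"
  define K where "K w = gamma_series u w + c * (- (z ^ 2) / (1 - w) + sine_series_tail u w)" for w :: complex
  define h where "h w = z * rGamma (1 + z - w) * rGamma (1 + w) * Gamma (1 - w) * Gamma (w + z)" for w :: complex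
  have pos: "w \<notin> \<int>\<^sub>\<le>\<^sub>0" if "0 < Re w" for w using that by (auto elim!: nonpos_Ints_cases)
  have z: "z \<notin> \<int>\<^sub>\<le>\<^sub>0" "1 + z \<notin> \<int>\<^sub>\<le>\<^sub>0" "z \<noteq> 0" using u by (auto intro!: pos simp: z_def)
  have G: "z * rGamma (1 + z) * Gamma z = 1"
    using z rGamma_plus1 [of z] by (simp add: Gamma_def add.commute rGamma_eq_zero_iff)
  have h0: "h 0 = 1" unfolding h_def using G by simp
  have "continuous_on {w. - (u / 2) < Re w} (\<lambda>w :: complex. gamma_series u w)"
    by (rule holomorphic_on_imp_continuous_on [OF gamma_series_holomorphic [OF u(1)]])
  hence "isCont (\<lambda>w. gamma_series u w) (0 :: complex)"
    unfolding continuous_on_eq_continuous_at [OF open_halfspace_Re_gt] using u by simp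
  moreover have "continuous_on {w. Re w < 7 / 4} (sine_series_tail u)"
    by (rule holomorphic_on_imp_continuous_on [OF sine_series_tail_holomorphic]) (use u in auto)
  hence "isCont (sine_series_tail u) (0 :: complex)"
    unfolding continuous_on_eq_continuous_at [OF open_halfspace_Re_lt] by simp
  ultimately have cont: "isCont K 0" unfolding K_def by (intro continuous_intros) auto
  have "(h has_field_derivative
     (2 * Digamma (1 + z) + 2 * euler_mascheroni - 1 / z)) (at 0)"
  proof -
    have 1: "((\<lambda>w. rGamma (1 + z - w)) has_field_derivative rGamma (1 + z) * Digamma (1 + z)) (at 0)"
      using z by (auto intro!: derivative_eq_intros)
    have 2: "((\<lambda>w. rGamma (1 + w)) has_field_derivative euler_mascheroni) (at (0 :: complex))"
      by (auto intro!: derivative_eq_intros)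
    have 3: "((\<lambda>w. Gamma (1 - w)) has_field_derivative euler_mascheroni) (at (0 :: complex))"
      by (auto intro!: derivative_eq_intros)
    have 4: "((\<lambda>w. Gamma (w + z)) has_field_derivative Gamma z * Digamma z) (at 0)"
      using z by (auto intro!: derivative_eq_intros)
    have D: "Digamma (1 + z) = Digamma z + 1 / z" using Digamma_plus1 [OF z(3)] by (simp add: add.commute)
    have "(h has_field_derivative (z * rGamma (1 + z) * Gamma z) * (Digamma (1 + z) + 2 * euler_mascheroni + Digamma z)) (at 0)"
      unfolding h_def [abs_def]
      by (rule DERIV_cong [OF DERIV_mult [OF DERIV_mult [OF DERIV_mult [OF DERIV_cmult [OF 1] 2] 3] 4]])
         (simp add: algebra_simps)
    thus ?thesis unfolding G D by (simp add: algebra_simps)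
  qed
  hence lim: "((\<lambda>w. (h w - 1) / w) \<longlongrightarrow> 2 * Digamma (1 + z) + 2 * euler_mascheroni - 1 / z) (at 0)"
    by (simp add: has_field_derivative_iff h0)
  \<comment> \<open>Any null sequence in (0, 1/2) avoiding u would serve; here u/(n + 2) \<le> u/2 <
    u.\<close>
  define t where "t n = u / (real n + 2)" for n
  have t: "0 < t n" "t n < 1 / 2" "t n \<noteq> u" for n
  proof -
    have "t n \<le> u / 2" unfolding t_def using u by (intro divide_left_mono) auto
    thus "t n < 1 / 2" "t n \<noteq> u" using u by linarith+
    show "0 < t n" using u by (simp add: t_def)
  qed
  have t0: "t \<longlonglongrightarrow> 0" unfolding t_def by real_asymp
  hence "filterlim (\<lambda>n. complex_of_real (t n)) (at 0) sequentially"
    unfolding filterlim_at using t(1) tendsto_of_real [OF t0] by (auto simp: less_imp_neq [symmetric])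
  from filterlim_compose [OF tendsto_mult_left [OF lim, of "- c"] this]
  have 1: "(\<lambda>n. - c * ((h (of_real (t n)) - 1) / of_real (t n))) \<longlonglongrightarrow> - c * (2 * Digamma (1 + z) + 2 * euler_mascheroni - 1 / z)" .
  have 2: "(\<lambda>n. K (of_real (t n))) \<longlonglongrightarrow> K 0"
    using isCont_tendsto_compose [OF cont, of "\<lambda>n. of_real (t n)"] tendsto_of_real [OF t0] by simp
  have "K (of_real (t n)) = - c * ((h (of_real (t n)) - 1) / of_real (t n))" for n
  proof -
    have "K (of_real (t n)) = gamma_series u (of_real (t n)) + c * sine_series u (of_real (t n)) + c / of_real (t n)"
      unfolding K_def sine_series_split [OF u(1), of "of_real (t n)", OF less_trans [OF u(2)], simplified] z_def
      by (simp add: algebra_simps)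
    also have "gamma_series u (of_real (t n)) + c * sine_series u (of_real (t n)) = - c * h (of_real (t n)) / of_real (t n)"
      using periodic_comb_real_cleared [OF u t] unfolding c_def h_def z_def by (simp only: mult.assoc)
    finally show ?thesis using t(1) [of n] by (simp add: diff_divide_distrib right_diff_distrib)
  qed
  with 1 2 have "K 0 = - c * (2 * Digamma (1 + z) + 2 * euler_mascheroni - 1 / z)"
    by (simp only: LIMSEQ_unique)
  moreover have "K 0 = gamma_series u 0 - c * (z ^ 2 * product_series 1 0 z)"
    using sine_series_tail_0 [OF u(1)] u unfolding K_def z_def by simp
  ultimately show ?thesis unfolding c_def by simp
qed

text \<open>L(u, 0) is eliminated between \<open>digamma_limit\<close> and its evaluation by
  alternating squares. Apart from the generating series of zeta(3, 2, ..., 2) only series with known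
  coefficients remain.\<close>

lemma product_series_1_0_identity:
  assumes u: "0 < u" "u < 1 / 2"
  defines "z \<equiv> complex_of_real u"
  shows "Gamma (1 + z) * Gamma (1 - z) * (z ^ 3 * product_series 1 0 z - 2 * z * (Digamma (1 + z) + euler_mascheroni) + 1) =
    1 - 2 * z ^ 2 * alternating_squares z"
proof -
  have z0: "z \<noteq> 0" using u by (simp add: z_def)
  have s1: "Gamma (1 + z) * Gamma (1 - z) = of_real (pi * u / sin (pi * u))"
    unfolding z_def by (rule Gamma_reflected_sin) (use u in auto)
  have c: "complex_of_real (pi / (u * sin (pi * u))) = Gamma (1 + z) * Gamma (1 - z) / z ^ 2"
    unfolding s1 using u by (simp add: z_def power2_eq_square)
  have "complex_of_real ((1 / u ^ 2 - u * gamma_series u 0) / 2) = alternating_squares z"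
    using sums_of_real [OF gamma_series_0_expansion [OF u(1)], where ?'a = complex]
    unfolding alternating_squares_def z_def by (simp add: sums_iff)
  moreover have "complex_of_real (gamma_series u 0) = gamma_series u 0" using gamma_series_of_real [OF u(1), of 0] by simp
  ultimately have L: "z * gamma_series u 0 = 1 / z ^ 2 - 2 * alternating_squares z" unfolding z_def by (auto simp: field_simps)
  have D: "gamma_series u 0 - s / z ^ 2 * (z ^ 2 * Q) = - (s / z ^ 2) * (2 * d + 2 * g - 1 / z) \<Longrightarrow>
     s * (z ^ 3 * Q - 2 * z * (d + g) + 1) = 1 - 2 * z ^ 2 * alternating_squares z" for s Q d g
  proof -
    assume *: "gamma_series u 0 - s / z ^ 2 * (z ^ 2 * Q) = - (s / z ^ 2) * (2 * d + 2 * g - 1 / z)"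
    have "z ^ 2 * (z * gamma_series u 0) = 1 - 2 * z ^ 2 * alternating_squares z" unfolding L using z0 by (simp add: right_diff_distrib)
    moreover have "z ^ 2 * (z * gamma_series u 0) = z ^ 3 * (s * Q) + z ^ 3 * (- (s / z ^ 2) * (2 * d + 2 * g - 1 / z))"
      unfolding * [symmetric] using z0 by (simp add: power2_eq_square power3_eq_cube algebra_simps)
    moreover have "z ^ 3 * (- (s / z ^ 2) * (2 * d + 2 * g - 1 / z)) = - (s * (2 * z * (d + g) - 1))"
      using z0 by (simp add: power2_eq_square power3_eq_cube field_simps)
    moreover have "s * (z ^ 3 * Q - 2 * z * (d + g) + 1) = z ^ 3 * (s * Q) + - (s * (2 * z * (d + g) - 1))"
      by (simp add: algebra_simps)
    ultimately show ?thesis by (simp only:)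
  qed
  show ?thesis using digamma_limit [OF u, folded z_def] unfolding c by (rule D)
qed

section \<open>Transfer to identities of formal power series\<close>

lemma reflected_mult_sin:
  assumes "(\<lambda>z. Gamma (1 + z) * Gamma (1 - z)) has_fps_expansion s"
  shows "s * fps_sin (of_real pi) = fps_const (complex_of_real pi) * fps_X"
proof (rule has_fps_expansion_eq_real)
  show "(\<lambda>z. (Gamma (1 + z) * Gamma (1 - z)) * sin (of_real pi * z)) has_fps_expansion s * fps_sin (of_real pi)"
    by (intro has_fps_expansion_mult assms has_fps_expansion_sin)
  show "(\<lambda>z. of_real pi * z) has_fps_expansion fps_const (complex_of_real pi) * fps_X"
    by (intro has_fps_expansion_cmult_left has_fps_expansion_fps_X)
  fix t :: real assume t: "0 < t" "t < 1"
  have "sin (of_real pi * complex_of_real t) = of_real (sin (pi * t))" by (simp flip: sin_of_real)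
  thus "Gamma (1 + of_real t) * Gamma (1 - of_real t) * sin (of_real pi * of_real t) = complex_of_real pi * of_real t"
    unfolding Gamma_reflected_sin [OF t] using sin_pi_pos [OF t] by simp
qed simp

lemma product_series_1_0_series:
  assumes "(\<lambda>z. Gamma (1 + z) * Gamma (1 - z)) has_fps_expansion s"
  shows "s * (fps_X ^ 3 * Abs_fps (product_coeff 1 0) - fps_const 2 * fps_X * Abs_fps (\<lambda>n. if n = 0 then 0 else (-1) ^ (n + 1) * zeta_n (n + 1)) + 1)
    = 1 - fps_const 2 * fps_X ^ 2 * Abs_fps (\<lambda>j. (-1) ^ j * of_nat (j + 1) * eta_value (j + 2))"
proof (rule has_fps_expansion_eq_real)
  let ?D = "Abs_fps (\<lambda>n. if n = 0 then 0 else (-1) ^ (n + 1) * zeta_n (n + 1))"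
  have "(\<lambda>z. Digamma (1 + z) + euler_mascheroni) has_fps_expansion
      Abs_fps (\<lambda>n. if n = 0 then - euler_mascheroni else (-1) ^ (n + 1) * zeta_n (n + 1)) + fps_const euler_mascheroni"
    by (intro has_fps_expansion_add has_fps_expansion_Digamma_1 has_fps_expansion_const)
  also have "Abs_fps (\<lambda>n. if n = 0 then - euler_mascheroni else (-1) ^ (n + 1) * zeta_n (n + 1)) + fps_const euler_mascheroni = ?D"
    by (rule fps_ext) simp
  finally have D: "(\<lambda>z. Digamma (1 + z) + euler_mascheroni) has_fps_expansion ?D" .
  show "(\<lambda>z. (Gamma (1 + z) * Gamma (1 - z)) * (z ^ 3 * product_series 1 0 z - 2 * z * (Digamma (1 + z) + euler_mascheroni) + 1))
     has_fps_expansion s * (fps_X ^ 3 * Abs_fps (product_coeff 1 0) - fps_const 2 * fps_X * ?D + 1)"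
    by (intro has_fps_expansion_mult has_fps_expansion_add has_fps_expansion_diff assms D product_series_expansion
        has_fps_expansion_power has_fps_expansion_fps_X has_fps_expansion_1 has_fps_expansion_const) simp_all
  show "(\<lambda>z. 1 - 2 * z ^ 2 * alternating_squares z) has_fps_expansion
      1 - fps_const 2 * fps_X ^ 2 * Abs_fps (\<lambda>j. (-1) ^ j * of_nat (j + 1) * eta_value (j + 2))"
    by (intro has_fps_expansion_mult has_fps_expansion_diff alternating_squares_expansion
        has_fps_expansion_power has_fps_expansion_fps_X has_fps_expansion_1 has_fps_expansion_const)
  fix t :: real assume "0 < t" "t < 1 / 2"
  from product_series_1_0_identity [OF this]
  show "Gamma (1 + of_real t) * Gamma (1 - of_real t) * (of_real t ^ 3 * product_series 1 0 (of_real t) -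
      2 * of_real t * (Digamma (1 + of_real t) + euler_mascheroni) + 1) = 1 - 2 * of_real t ^ 2 * alternating_squares (complex_of_real t)" .
qed simp

lemma f4_series_series:
  assumes s: "(\<lambda>z. Gamma (1 + z) * Gamma (1 - z)) has_fps_expansion s"
    and g: "(\<lambda>z. Gamma (1 + z) ^ 3 / Gamma (1 + 3 * z)) has_fps_expansion g"
  defines "s2 \<equiv> Abs_fps (\<lambda>n. 2 ^ n * fps_nth s n)"
  shows "fps_const 4 * fps_X ^ 2 * Abs_fps (\<lambda>m. (\<Sum>k. nth_deriv m f4 (real (Suc k))) / fact m) =
    - fps_exp (of_real pi * \<i>) * (s * s2 + g * (fps_const (1 / 2) - fps_const (3 / 2) * s2 * (1 + fps_const 4 * fps_X ^ 3 * Abs_fps (product_coeff 4 1))))"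
proof (rule has_fps_expansion_eq_real)
  have s2: "(\<lambda>z. Gamma (1 + 2 * z) * Gamma (1 - 2 * z)) has_fps_expansion s2"
    unfolding s2_def by (rule has_fps_expansion_cmult_arg [OF s])
  show "(\<lambda>z. 4 * z ^ 2 * f4_series z) has_fps_expansion fps_const 4 * fps_X ^ 2 * Abs_fps (\<lambda>m. (\<Sum>k. nth_deriv m f4 (real (Suc k))) / fact m)"
    by (intro has_fps_expansion_mult f4_series_expansion has_fps_expansion_power has_fps_expansion_fps_X has_fps_expansion_const)
  show "(\<lambda>z. - exp (of_real pi * \<i> * z) * ((Gamma (1 + z) * Gamma (1 - z)) * (Gamma (1 + 2 * z) * Gamma (1 - 2 * z)) +
      (Gamma (1 + z) ^ 3 / Gamma (1 + 3 * z)) * (1 / 2 - 3 / 2 * (Gamma (1 + 2 * z) * Gamma (1 - 2 * z)) * (1 + 4 * z ^ 3 * product_series 4 1 z))))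
    has_fps_expansion - fps_exp (of_real pi * \<i>) * (s * s2 + g * (fps_const (1 / 2) - fps_const (3 / 2) * s2 * (1 + fps_const 4 * fps_X ^ 3 * Abs_fps (product_coeff 4 1))))"
    by (intro has_fps_expansion_mult has_fps_expansion_minus has_fps_expansion_add has_fps_expansion_diff s s2 g product_series_expansion has_fps_expansion_exp
        has_fps_expansion_power has_fps_expansion_fps_X has_fps_expansion_1 has_fps_expansion_const) simp_all
  fix t :: real assume "0 < t" "t < 1 / 4"
  from f4_series_closed_form [OF this]
  show "4 * of_real t ^ 2 * f4_series (of_real t) = - exp (of_real pi * \<i> * of_real t) *
      ((Gamma (1 + of_real t) * Gamma (1 - of_real t)) * (Gamma (1 + 2 * of_real t) * Gamma (1 - 2 * of_real t)) +
      (Gamma (1 + of_real t) ^ 3 / Gamma (1 + 3 * of_real t)) * (1 / 2 - 3 / 2 * (Gamma (1 + 2 * of_real t) * Gamma (1 - 2 * of_real t)) * (1 + 4 * of_real t ^ 3 * product_series 4 1 (of_real t))))" .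
qed simp

section \<open>Coefficients up to order nine, even zeta values, zeta(3,2,2) and
  zeta(3,2,2,2)\<close>

lemma fps_mult_nth_numeral:
  fixes A B :: "'a :: comm_ring_1 fps"
  shows "fps_nth (A * B) 0 = fps_nth A 0 * fps_nth B 0"
    "fps_nth (A * B) (Suc 0) = fps_nth A 0 * fps_nth B (Suc 0) + fps_nth A (Suc 0) * fps_nth B 0"
    "fps_nth (A * B) 2 = fps_nth A 0 * fps_nth B 2 + fps_nth A (Suc 0) * fps_nth B (Suc 0) + fps_nth A 2 * fps_nth B 0"
    "fps_nth (A * B) 3 = fps_nth A 0 * fps_nth B 3 + fps_nth A (Suc 0) * fps_nth B 2 + fps_nth A 2 * fps_nth B (Suc 0) + fps_nth A 3 * fps_nth B 0"
    "fps_nth (A * B) 4 = fps_nth A 0 * fps_nth B 4 + fps_nth A (Suc 0) * fps_nth B 3 + fps_nth A 2 * fps_nth B 2 + fps_nth A 3 * fps_nth B (Suc 0) + fps_nth A 4 * fps_nth B 0"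
    "fps_nth (A * B) 5 = fps_nth A 0 * fps_nth B 5 + fps_nth A (Suc 0) * fps_nth B 4 + fps_nth A 2 * fps_nth B 3 + fps_nth A 3 * fps_nth B 2 + fps_nth A 4 * fps_nth B (Suc 0) + fps_nth A 5 * fps_nth B 0"
    "fps_nth (A * B) 6 = fps_nth A 0 * fps_nth B 6 + fps_nth A (Suc 0) * fps_nth B 5 + fps_nth A 2 * fps_nth B 4 + fps_nth A 3 * fps_nth B 3 + fps_nth A 4 * fps_nth B 2 + fps_nth A 5 * fps_nth B (Suc 0) + fps_nth A 6 * fps_nth B 0"
    "fps_nth (A * B) 7 = fps_nth A 0 * fps_nth B 7 + fps_nth A (Suc 0) * fps_nth B 6 + fps_nth A 2 * fps_nth B 5 + fps_nth A 3 * fps_nth B 4 + fps_nth A 4 * fps_nth B 3 + fps_nth A 5 * fps_nth B 2 + fps_nth A 6 * fps_nth B (Suc 0) + fps_nth A 7 * fps_nth B 0"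
    "fps_nth (A * B) 8 = fps_nth A 0 * fps_nth B 8 + fps_nth A (Suc 0) * fps_nth B 7 + fps_nth A 2 * fps_nth B 6 + fps_nth A 3 * fps_nth B 5 + fps_nth A 4 * fps_nth B 4 + fps_nth A 5 * fps_nth B 3 + fps_nth A 6 * fps_nth B 2 + fps_nth A 7 * fps_nth B (Suc 0) + fps_nth A 8 * fps_nth B 0"
    "fps_nth (A * B) 9 = fps_nth A 0 * fps_nth B 9 + fps_nth A (Suc 0) * fps_nth B 8 + fps_nth A 2 * fps_nth B 7 + fps_nth A 3 * fps_nth B 6 + fps_nth A 4 * fps_nth B 5 + fps_nth A 5 * fps_nth B 4 + fps_nth A 6 * fps_nth B 3 + fps_nth A 7 * fps_nth B 2 + fps_nth A 8 * fps_nth B (Suc 0) + fps_nth A 9 * fps_nth B 0"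
    "fps_nth (A * B) 10 = fps_nth A 0 * fps_nth B 10 + fps_nth A (Suc 0) * fps_nth B 9 + fps_nth A 2 * fps_nth B 8 + fps_nth A 3 * fps_nth B 7 + fps_nth A 4 * fps_nth B 6 + fps_nth A 5 * fps_nth B 5 + fps_nth A 6 * fps_nth B 4 + fps_nth A 7 * fps_nth B 3 + fps_nth A 8 * fps_nth B 2 + fps_nth A 9 * fps_nth B (Suc 0) + fps_nth A 10 * fps_nth B 0"
  by (simp_all add: fps_mult_nth numeral_eq_Suc)

lemma mult_left_cancel_pi: "complex_of_real pi * a = of_real pi * b \<Longrightarrow> a = b"
  by simp

lemma of_nat_mult_cancel: "of_nat n * a = of_nat n * b \<Longrightarrow> 0 < n \<Longrightarrow> a = (b :: complex)"
  by simp

lemma fps_sin_pi_coeffs: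
  "fps_nth (fps_sin (of_real pi)) 0 = (0 :: complex)"
  "fps_nth (fps_sin (of_real pi)) (Suc 0) = complex_of_real pi"
  "fps_nth (fps_sin (of_real pi)) 2 = (0 :: complex)"
  "fps_nth (fps_sin (of_real pi)) 3 = - 1 / 6 * complex_of_real pi ^ 3"
  "fps_nth (fps_sin (of_real pi)) 4 = (0 :: complex)"
  "fps_nth (fps_sin (of_real pi)) 5 = 1 / 120 * complex_of_real pi ^ 5"
  "fps_nth (fps_sin (of_real pi)) 6 = (0 :: complex)"
  "fps_nth (fps_sin (of_real pi)) 7 = - 1 / 5040 * complex_of_real pi ^ 7"
  "fps_nth (fps_sin (of_real pi)) 8 = (0 :: complex)"
  "fps_nth (fps_sin (of_real pi)) 9 = 1 / 362880 * complex_of_real pi ^ 9"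
  "fps_nth (fps_sin (of_real pi)) 10 = (0 :: complex)"
  by (simp_all add: fps_sin_def fact_numeral)

text \<open>The relation s sin(pi X) = pi X is triangular: order n + 1 determines coefficient n of
  \<open>s\<close> from the earlier ones after cancelling one factor pi.\<close>

lemma reflected_coeffs:
  fixes s :: "complex fps"
  assumes "(\<lambda>z. Gamma (1 + z) * Gamma (1 - z)) has_fps_expansion s"
  shows "fps_nth s 0 = 1"
    "fps_nth s (Suc 0) = 0"
    "fps_nth s 2 = 1 / 6 * of_real pi ^ 2"
    "fps_nth s 3 = 0"
    "fps_nth s 4 = 7 / 360 * of_real pi ^ 4"
    "fps_nth s 5 = 0"
    "fps_nth s 6 = 31 / 15120 * of_real pi ^ 6"
    "fps_nth s 7 = 0"
    "fps_nth s 8 = 127 / 604800 * of_real pi ^ 8"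
    "fps_nth s 9 = 0"
proof -
  have E: "fps_nth (s * fps_sin (of_real pi)) n = fps_nth (fps_const (complex_of_real pi) * fps_X) n" for n
    unfolding reflected_mult_sin [OF assms] ..
  show s0: "fps_nth s 0 = 1"
    by (rule mult_left_cancel_pi) (use E [of 1] in \<open>simp add: fps_mult_nth_numeral fps_sin_pi_coeffs power_numeral_reduce algebra_simps\<close>)
  show s1: "fps_nth s (Suc 0) = 0"
    by (rule mult_left_cancel_pi) (use E [of 2] in \<open>simp add: fps_mult_nth_numeral fps_sin_pi_coeffs s0 power_numeral_reduce algebra_simps\<close>)
  show s2: "fps_nth s 2 = 1 / 6 * of_real pi ^ 2"
    by (rule mult_left_cancel_pi) (use E [of 3] in \<open>simp add: fps_mult_nth_numeral fps_sin_pi_coeffs s0 s1 power_numeral_reduce algebra_simps\<close>)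
  show s3: "fps_nth s 3 = 0"
    by (rule mult_left_cancel_pi) (use E [of 4] in \<open>simp add: fps_mult_nth_numeral fps_sin_pi_coeffs s0 s1 s2 power_numeral_reduce algebra_simps\<close>)
  show s4: "fps_nth s 4 = 7 / 360 * of_real pi ^ 4"
    by (rule mult_left_cancel_pi) (use E [of 5] in \<open>simp add: fps_mult_nth_numeral fps_sin_pi_coeffs s0 s1 s2 s3 power_numeral_reduce algebra_simps\<close>)
  show s5: "fps_nth s 5 = 0"
    by (rule mult_left_cancel_pi) (use E [of 6] in \<open>simp add: fps_mult_nth_numeral fps_sin_pi_coeffs s0 s1 s2 s3 s4 power_numeral_reduce algebra_simps\<close>)
  show s6: "fps_nth s 6 = 31 / 15120 * of_real pi ^ 6"
    by (rule mult_left_cancel_pi) (use E [of 7] in \<open>simp add: fps_mult_nth_numeral fps_sin_pi_coeffs s0 s1 s2 s3 s4 s5 power_numeral_reduce algebra_simps\<close>)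
  show s7: "fps_nth s 7 = 0"
    by (rule mult_left_cancel_pi) (use E [of 8] in \<open>simp add: fps_mult_nth_numeral fps_sin_pi_coeffs s0 s1 s2 s3 s4 s5 s6 power_numeral_reduce algebra_simps\<close>)
  show s8: "fps_nth s 8 = 127 / 604800 * of_real pi ^ 8"
    by (rule mult_left_cancel_pi) (use E [of 9] in \<open>simp add: fps_mult_nth_numeral fps_sin_pi_coeffs s0 s1 s2 s3 s4 s5 s6 s7 power_numeral_reduce algebra_simps\<close>)
  show s9: "fps_nth s 9 = 0"
    by (rule mult_left_cancel_pi) (use E [of 10] in \<open>simp add: fps_mult_nth_numeral fps_sin_pi_coeffs s0 s1 s2 s3 s4 s5 s6 s7 s8 power_numeral_reduce algebra_simps\<close>)
qed

text \<open>Euler's values follow by computing n s_n in two ways: from the sine series, and from s'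
  = s V, where V has the coefficients 2 zeta(n + 1) at odd n.\<close>

lemma zeta_n_even:
  "zeta_n 2 = 1 / 6 * of_real pi ^ 2"
  "zeta_n 4 = 1 / 90 * of_real pi ^ 4"
  "zeta_n 6 = 1 / 945 * of_real pi ^ 6"
  "zeta_n 8 = 1 / 9450 * of_real pi ^ 8"
proof -
  obtain s where s: "(\<lambda>z. Gamma (1 + z) * Gamma (1 - z)) has_fps_expansion s" and "fps_nth s 0 = 1"
    and d: "fps_deriv s = s * Abs_fps (\<lambda>n. if odd n then 2 * zeta_n (n + 1) else 0)"
    by (rule Gamma_reflected_expansion)
  have E: "of_nat n * fps_nth s n = fps_nth (s * Abs_fps (\<lambda>n. if odd n then 2 * zeta_n (n + 1) else 0)) (n - 1)" if "0 < n" for n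
    unfolding d [symmetric] using that by (simp add: fps_deriv_nth)
  show z2: "zeta_n 2 = 1 / 6 * of_real pi ^ 2"
    using E [of 2] by (simp add: fps_mult_nth_numeral reflected_coeffs [OF s]  power_numeral_reduce field_simps flip: numeral_2_eq_2)
  show z4: "zeta_n 4 = 1 / 90 * of_real pi ^ 4"
    using E [of 4] by (simp add: fps_mult_nth_numeral reflected_coeffs [OF s]  z2 power_numeral_reduce field_simps flip: numeral_2_eq_2)
  show z6: "zeta_n 6 = 1 / 945 * of_real pi ^ 6"
    using E [of 6] by (simp add: fps_mult_nth_numeral reflected_coeffs [OF s]  z2 z4 power_numeral_reduce field_simps flip: numeral_2_eq_2)
  show z8: "zeta_n 8 = 1 / 9450 * of_real pi ^ 8"
    using E [of 8] by (simp add: fps_mult_nth_numeral reflected_coeffs [OF s]  z2 z4 z6 power_numeral_reduce field_simps flip: numeral_2_eq_2)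
qed

lemma Gamma_cube_quotient_coeffs:
  assumes "fps_nth g 0 = 1"
    "fps_deriv g = g * Abs_fps (\<lambda>n. if n = 0 then 0 else (-1) ^ (n + 1) * (3 - 3 ^ (n + 1)) * zeta_n (n + 1))" (is "_ = g * ?W")
  shows "fps_nth g (Suc 0) = 0"
    "fps_nth g 2 = - 1 / 2 * of_real pi ^ 2"
    "fps_nth g 3 = 8 * zeta_n 3"
    "fps_nth g 4 = - 11 / 120 * of_real pi ^ 4"
    "fps_nth g 5 = - 4 * of_real pi ^ 2 * zeta_n 3 + 48 * zeta_n 5"
    "fps_nth g 6 = - 613 / 15120 * of_real pi ^ 6 + 32 * zeta_n 3 ^ 2"
    "fps_nth g 7 = - 11 / 15 * of_real pi ^ 4 * zeta_n 3 - 24 * of_real pi ^ 2 * zeta_n 5 + 312 * zeta_n 7"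
    "fps_nth g 8 = - 14353 / 604800 * of_real pi ^ 8 - 16 * of_real pi ^ 2 * zeta_n 3 ^ 2 + 384 * zeta_n 3 * zeta_n 5"
    "fps_nth g 9 = - 613 / 1890 * of_real pi ^ 6 * zeta_n 3 - 22 / 5 * of_real pi ^ 4 * zeta_n 5 - 156 * of_real pi ^ 2 * zeta_n 7 + 256 / 3 * zeta_n 3 ^ 3 + 6560 / 3 * zeta_n 9"
proof -
  have E: "of_nat n * fps_nth g n = fps_nth (g * ?W) (n - 1)" if "0 < n" for n
    unfolding assms(2) [symmetric] using that by (simp add: fps_deriv_nth)
  note g0 = assms(1)
  show g1: "fps_nth g (Suc 0) = 0"
    by (rule of_nat_mult_cancel [of 1]) (use E [of 1] in \<open>simp_all add: fps_mult_nth_numeral zeta_n_even  g0 power_numeral_reduce algebra_simps flip: numeral_2_eq_2\<close>)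
  show g2: "fps_nth g 2 = - 1 / 2 * of_real pi ^ 2"
    by (rule of_nat_mult_cancel [of 2]) (use E [of 2] in \<open>simp_all add: fps_mult_nth_numeral zeta_n_even  g0 g1 power_numeral_reduce algebra_simps flip: numeral_2_eq_2\<close>)
  show g3: "fps_nth g 3 = 8 * zeta_n 3"
    by (rule of_nat_mult_cancel [of 3]) (use E [of 3] in \<open>simp_all add: fps_mult_nth_numeral zeta_n_even  g0 g1 g2 power_numeral_reduce algebra_simps flip: numeral_2_eq_2\<close>)
  show g4: "fps_nth g 4 = - 11 / 120 * of_real pi ^ 4"
    by (rule of_nat_mult_cancel [of 4]) (use E [of 4] in \<open>simp_all add: fps_mult_nth_numeral zeta_n_even  g0 g1 g2 g3 power_numeral_reduce algebra_simps flip: numeral_2_eq_2\<close>)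
  show g5: "fps_nth g 5 = - 4 * of_real pi ^ 2 * zeta_n 3 + 48 * zeta_n 5"
    by (rule of_nat_mult_cancel [of 5]) (use E [of 5] in \<open>simp_all add: fps_mult_nth_numeral zeta_n_even  g0 g1 g2 g3 g4 power_numeral_reduce algebra_simps flip: numeral_2_eq_2\<close>)
  show g6: "fps_nth g 6 = - 613 / 15120 * of_real pi ^ 6 + 32 * zeta_n 3 ^ 2"
    by (rule of_nat_mult_cancel [of 6]) (use E [of 6] in \<open>simp_all add: fps_mult_nth_numeral zeta_n_even  g0 g1 g2 g3 g4 g5 power_numeral_reduce algebra_simps flip: numeral_2_eq_2\<close>)
  show g7: "fps_nth g 7 = - 11 / 15 * of_real pi ^ 4 * zeta_n 3 - 24 * of_real pi ^ 2 * zeta_n 5 + 312 * zeta_n 7"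
    by (rule of_nat_mult_cancel [of 7]) (use E [of 7] in \<open>simp_all add: fps_mult_nth_numeral zeta_n_even  g0 g1 g2 g3 g4 g5 g6 power_numeral_reduce algebra_simps flip: numeral_2_eq_2\<close>)
  show g8: "fps_nth g 8 = - 14353 / 604800 * of_real pi ^ 8 - 16 * of_real pi ^ 2 * zeta_n 3 ^ 2 + 384 * zeta_n 3 * zeta_n 5"
    by (rule of_nat_mult_cancel [of 8]) (use E [of 8] in \<open>simp_all add: fps_mult_nth_numeral zeta_n_even  g0 g1 g2 g3 g4 g5 g6 g7 power_numeral_reduce algebra_simps flip: numeral_2_eq_2\<close>)
  show g9: "fps_nth g 9 = - 613 / 1890 * of_real pi ^ 6 * zeta_n 3 - 22 / 5 * of_real pi ^ 4 * zeta_n 5 - 156 * of_real pi ^ 2 * zeta_n 7 + 256 / 3 * zeta_n 3 ^ 3 + 6560 / 3 * zeta_n 9"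
    by (rule of_nat_mult_cancel [of 9]) (use E [of 9] in \<open>simp_all add: fps_mult_nth_numeral zeta_n_even  g0 g1 g2 g3 g4 g5 g6 g7 g8 power_numeral_reduce algebra_simps flip: numeral_2_eq_2\<close>)
qed

text \<open>With \<beta> = 0 the factor \<open>0 ^ (n - i)\<close> keeps only i = n, hence the pure
  values zeta(3, 2, ..., 2).\<close>

lemma product_coeff_1_0:
  assumes "even n"
  shows "product_coeff 1 0 n = (-1) ^ (n div 2) * of_real (zeta_twos (n div 2) 3)"
proof -
  have "product_coeff 1 0 n = (\<Sum>i\<in>{n}. if even i then (- 1) ^ (i div 2) * 0 ^ (n - i) * of_real (zeta_twos (i div 2) (n - i + 3)) else 0)"
    unfolding product_coeff_def by (rule sum.mono_neutral_right) auto
  thus ?thesis using assms by simp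
qed

lemma product_coeff_4_1:
  "product_coeff 4 1 0 = of_real (zeta_twos 0 3)"
  "product_coeff 4 1 1 = of_real (zeta_twos 0 4)"
  "product_coeff 4 1 2 = of_real (zeta_twos 0 5) - 4 * of_real (zeta_twos 1 3)"
  "product_coeff 4 1 3 = of_real (zeta_twos 0 6) - 4 * of_real (zeta_twos 1 4)"
  "product_coeff 4 1 4 = of_real (zeta_twos 0 7) - 4 * of_real (zeta_twos 1 5) + 16 * of_real (zeta_twos 2 3)"
  "product_coeff 4 1 5 = of_real (zeta_twos 0 8) - 4 * of_real (zeta_twos 1 6) + 16 * of_real (zeta_twos 2 4)"
  "product_coeff 4 1 6 = of_real (zeta_twos 0 9) - 4 * of_real (zeta_twos 1 7) + 16 * of_real (zeta_twos 2 5) - 64 * of_real (zeta_twos 3 3)"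
proof -
  have "{0..0} = {0::nat}" "{0..1} = {0,1::nat}" "{0..2} = {0,1,2::nat}" "{0..3} = {0,1,2,3::nat}" "{0..4} = {0,1,2,3,4::nat}"
    "{0..5} = {0,1,2,3,4,5::nat}" "{0..6} = {0,1,2,3,4,5,6::nat}" by auto
  note sets = this

  show "product_coeff 4 1 0 = of_real (zeta_twos 0 3)"
    unfolding product_coeff_def sets by simp
  show "product_coeff 4 1 1 = of_real (zeta_twos 0 4)"
    unfolding product_coeff_def sets by simp
  show "product_coeff 4 1 2 = of_real (zeta_twos 0 5) - 4 * of_real (zeta_twos 1 3)"
    unfolding product_coeff_def sets by simp
  show "product_coeff 4 1 3 = of_real (zeta_twos 0 6) - 4 * of_real (zeta_twos 1 4)"
    unfolding product_coeff_def sets by simp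
  show "product_coeff 4 1 4 = of_real (zeta_twos 0 7) - 4 * of_real (zeta_twos 1 5) + 16 * of_real (zeta_twos 2 3)"
    unfolding product_coeff_def sets by simp
  show "product_coeff 4 1 5 = of_real (zeta_twos 0 8) - 4 * of_real (zeta_twos 1 6) + 16 * of_real (zeta_twos 2 4)"
    unfolding product_coeff_def sets by simp
  show "product_coeff 4 1 6 = of_real (zeta_twos 0 9) - 4 * of_real (zeta_twos 1 7) + 16 * of_real (zeta_twos 2 5) - 64 * of_real (zeta_twos 3 3)"
    unfolding product_coeff_def sets by simp
qed

text \<open>Multiplying the w = 0 identity by sin(pi X) replaces \<open>s\<close> by pi X, so each
  coefficient of the bracket stands alone on the left while the right side contains only zeta values
  and powers of pi.\<close>

lemma zeta_twos_3_values:
  "of_real (zeta_twos 2 3) = 1 / 40 * of_real pi ^ 4 * zeta_n 3 - 5 / 4 * of_real pi ^ 2 * zeta_n 5 + 157 / 16 * zeta_n 7"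
  "of_real (zeta_twos 3 3) = 1 / 1680 * of_real pi ^ 6 * zeta_n 3 - 1 / 16 * of_real pi ^ 4 * zeta_n 5 + 63 / 32 * of_real pi ^ 2 * zeta_n 7 - 223 / 16 * zeta_n 9"
proof -
  obtain s where s: "(\<lambda>z. Gamma (1 + z) * Gamma (1 - z)) has_fps_expansion s" and "fps_nth s 0 = 1"
    and "fps_deriv s = s * Abs_fps (\<lambda>n. if odd n then 2 * zeta_n (n + 1) else 0)"
    by (rule Gamma_reflected_expansion)
  let ?Y = "fps_X ^ 3 * Abs_fps (product_coeff 1 0) - fps_const 2 * fps_X * Abs_fps (\<lambda>n. if n = 0 then 0 else (-1) ^ (n + 1) * zeta_n (n + 1)) + 1"
  let ?R = "1 - fps_const 2 * fps_X ^ 2 * Abs_fps (\<lambda>j. (-1) ^ j * of_nat (j + 1) * eta_value (j + 2))"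
  have "?Y * (fps_const (of_real pi) * fps_X) = ?R * fps_sin (of_real pi)"
    unfolding product_series_1_0_series [OF s, symmetric] reflected_mult_sin [OF s, symmetric] by (simp only: mult_ac)
  hence E: "fps_nth (?Y * (fps_const (of_real pi) * fps_X)) n = fps_nth (?R * fps_sin (of_real pi)) n" for n by (simp only:)
  have R: "fps_nth ?R 0 = 1"
    "fps_nth ?R (Suc 0) = 0"
    "fps_nth ?R 2 = - 1 / 6 * of_real pi ^ 2"
    "fps_nth ?R 3 = 3 * zeta_n 3"
    "fps_nth ?R 4 = - 7 / 120 * of_real pi ^ 4"
    "fps_nth ?R 5 = 15 / 2 * zeta_n 5"
    "fps_nth ?R 6 = - 31 / 3024 * of_real pi ^ 6"
    "fps_nth ?R 7 = 189 / 16 * zeta_n 7"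
    "fps_nth ?R 8 = - 127 / 86400 * of_real pi ^ 8"
    "fps_nth ?R 9 = 255 / 16 * zeta_n 9"
    by (simp_all add: mult.assoc fps_X_power_mult_nth eta_value_eq zeta_n_even power_numeral_reduce flip: numeral_2_eq_2)
  \<comment> \<open>\<open>fps_X ^ 3\<close> shifts orders 4 and 6 of the product series to 7 and 9,
    with signs (-1)^2 and (-1)^3; the Digamma term adds 2 zeta(7) and 2 zeta(9).\<close>
  have Y: "fps_nth ?Y 7 = of_real (zeta_twos 2 3) + 2 * zeta_n 7" "fps_nth ?Y 9 = - of_real (zeta_twos 3 3) + 2 * zeta_n 9"
    by (simp_all add: mult.assoc fps_X_power_mult_nth product_coeff_1_0)
  have "fps_nth (?Y * (fps_const (of_real pi) * fps_X)) 8 = of_real pi * fps_nth ?Y 7"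
    "fps_nth (?Y * (fps_const (of_real pi) * fps_X)) 10 = of_real pi * fps_nth ?Y 9"
    by (simp_all only: fps_mult_nth_numeral) simp_all
  moreover have "fps_nth (?R * fps_sin (of_real pi)) 8 = of_real pi * (1 / 40 * of_real pi ^ 4 * zeta_n 3 - 5 / 4 * of_real pi ^ 2 * zeta_n 5 + 189 / 16 * zeta_n 7)"
    "fps_nth (?R * fps_sin (of_real pi)) 10 = of_real pi * (- 1 / 1680 * of_real pi ^ 6 * zeta_n 3 + 1 / 16 * of_real pi ^ 4 * zeta_n 5 - 63 / 32 * of_real pi ^ 2 * zeta_n 7 + 255 / 16 * zeta_n 9)"
    unfolding fps_mult_nth_numeral R fps_sin_pi_coeffs by (simp_all add: power_numeral_reduce algebra_simps)
  ultimately have "of_real pi * (of_real (zeta_twos 2 3) + 2 * zeta_n 7) = of_real pi * (1 / 40 * of_real pi ^ 4 * zeta_n 3 - 5 / 4 * of_real pi ^ 2 * zeta_n 5 + 189 / 16 * zeta_n 7)"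
    "of_real pi * (- of_real (zeta_twos 3 3) + 2 * zeta_n 9) = of_real pi * (- 1 / 1680 * of_real pi ^ 6 * zeta_n 3 + 1 / 16 * of_real pi ^ 4 * zeta_n 5 - 63 / 32 * of_real pi ^ 2 * zeta_n 7 + 255 / 16 * zeta_n 9)"
    unfolding E Y by (simp_all only:)
  hence "of_real (zeta_twos 2 3) + 2 * zeta_n 7 = 1 / 40 * of_real pi ^ 4 * zeta_n 3 - 5 / 4 * of_real pi ^ 2 * zeta_n 5 + 189 / 16 * zeta_n 7" "- of_real (zeta_twos 3 3) + 2 * zeta_n 9 = - 1 / 1680 * of_real pi ^ 6 * zeta_n 3 + 1 / 16 * of_real pi ^ 4 * zeta_n 5 - 63 / 32 * of_real pi ^ 2 * zeta_n 7 + 255 / 16 * zeta_n 9"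
    by (blast dest: mult_left_cancel_pi)+
  thus "of_real (zeta_twos 2 3) = 1 / 40 * of_real pi ^ 4 * zeta_n 3 - 5 / 4 * of_real pi ^ 2 * zeta_n 5 + 157 / 16 * zeta_n 7"
    "of_real (zeta_twos 3 3) = 1 / 1680 * of_real pi ^ 6 * zeta_n 3 - 1 / 16 * of_real pi ^ 4 * zeta_n 5 + 63 / 32 * of_real pi ^ 2 * zeta_n 7 - 223 / 16 * zeta_n 9"
    by (simp_all add: power_numeral_reduce field_simps flip: numeral_2_eq_2)
qed

section \<open>Multiple zeta values as non-negative extended sums: shuffle, stuffle and Hoffman
  relations\<close>

lemma suminf_add_ennreal: "(\<Sum>n. f n + g n) = (\<Sum>n. f n) + (\<Sum>n. g n :: ennreal)"
  by (rule suminf_add [symmetric]) auto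

lemma suminf_swap_ennreal: "(\<Sum>i. \<Sum>j. f i j) = (\<Sum>j. \<Sum>i. f i j :: ennreal)"
proof -
  have "(\<Sum>i. \<Sum>j. f i j) = (\<integral>\<^sup>+i. (\<Sum>j. f i j) \<partial>count_space UNIV)"
    by (simp add: nn_integral_count_space_nat)
  also have "\<dots> = (\<Sum>j. \<integral>\<^sup>+i. f i j \<partial>count_space UNIV)"
    by (rule nn_integral_suminf) auto
  also have "\<dots> = (\<Sum>j. \<Sum>i. f i j)"
    by (simp add: nn_integral_count_space_nat)
  finally show ?thesis .
qed

lemma suminf_split_ennreal: "(\<Sum>m. f m) = (\<Sum>m<n. f m) + f n + (\<Sum>d. f (n + d + 1) :: ennreal)"
  using suminf_offset [of f "Suc n"] by (simp add: ac_simps)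

lemma suminf_lessThan_ennreal:
  "(\<Sum>n. \<Sum>m<n. f n m) = (\<Sum>m. \<Sum>d. f (m + d + 1) m :: ennreal)"
proof -
  have "(\<Sum>m<n. f n m) = (\<Sum>m. if m < n then f n m else 0)" for n
    by (subst suminf_finite [of "{..<n}"]) (auto intro!: sum.cong)
  hence "(\<Sum>n. \<Sum>m<n. f n m) = (\<Sum>n. \<Sum>m. if m < n then f n m else 0)" by simp
  also have "\<dots> = (\<Sum>m. \<Sum>n. if m < n then f n m else 0)" by (rule suminf_swap_ennreal)
  also have "\<dots> = (\<Sum>m. \<Sum>d. f (m + d + 1) m)"
  proof (rule suminf_cong)
    fix m show "(\<Sum>n. if m < n then f n m else 0) = (\<Sum>d. f (m + d + 1) m)"
      by (subst suminf_split_ennreal [where n = m]) simp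
  qed
  finally show ?thesis .
qed

lemma suminf_trichotomy_ennreal:
  "(\<Sum>n. \<Sum>m. f n m) = (\<Sum>m. \<Sum>d. f (m + d + 1) m) + (\<Sum>m. f m m) +
     (\<Sum>n. \<Sum>d. f n (n + d + 1) :: ennreal)"
proof -
  have "(\<Sum>n. \<Sum>m. f n m) = (\<Sum>n. (\<Sum>m<n. f n m) + f n n + (\<Sum>d. f n (n + d + 1)))"
    by (intro suminf_cong suminf_split_ennreal)
  thus ?thesis by (simp add: suminf_add_ennreal suminf_lessThan_ennreal)
qed

text \<open>With values in \<open>ennreal\<close> every rearrangement of a multiple sum is
  unconditional; finiteness is needed only when a finished relation is transferred to the
  reals.\<close>

definition inv_pow :: "nat \<Rightarrow> nat \<Rightarrow> ennreal" where
  "inv_pow a n = ennreal (1 / real n ^ a)"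

lemma inv_pow_0 [simp]: "inv_pow 0 n = 1"
  by (simp add: inv_pow_def)

lemma inv_pow_mult: "inv_pow a n * inv_pow b n = inv_pow (a + b) n"
  by (simp add: inv_pow_def ennreal_mult' [symmetric] power_add)

lemma inv_pow_mult': "inv_pow a n * (inv_pow b n * c) = inv_pow (a + b) n * c"
  by (simp add: inv_pow_mult [symmetric] mult.assoc)

text \<open>From 1/(m n) = (1/m + 1/n)/(m + n), the source of all shuffle relations.\<close>

lemma inv_pow_partial_fraction:
  assumes "0 < m" "0 < n"
  shows "inv_pow (Suc a) m * inv_pow (Suc b) n =
     inv_pow a m * inv_pow (Suc b) n * inv_pow 1 (m + n) + inv_pow (Suc a) m * inv_pow b n * inv_pow 1 (m + n)"
proof -
  have "1 / real m ^ Suc a * (1 / real n ^ Suc b) =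
     1 / real m ^ a * (1 / real n ^ Suc b) * (1 / real (m + n) ^ 1) +
     1 / real m ^ Suc a * (1 / real n ^ b) * (1 / real (m + n) ^ 1)"
    using assms by (simp add: divide_simps add_pos_pos)
  thus ?thesis
    by (simp add: inv_pow_def ennreal_mult' [symmetric] ennreal_plus [symmetric] del: ennreal_plus)
qed

definition emzv1 :: "nat \<Rightarrow> ennreal" where
  "emzv1 p = (\<Sum>n. inv_pow p (n + 1))"
text \<open>The sum runs over the smaller index l + 1 and a gap d, so strict inequality is built in
  and both variables range over all naturals. The larger index carries the first exponent;
  \<open>emzv3\<close> uses two gaps in the same way.\<close>

definition emzv2 :: "nat \<Rightarrow> nat \<Rightarrow> ennreal" where
  "emzv2 p q = (\<Sum>l. \<Sum>d. inv_pow p (l + d + 2) * inv_pow q (l + 1))"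
definition emzv3 :: "nat \<Rightarrow> nat \<Rightarrow> nat \<Rightarrow> ennreal" where
  "emzv3 p q r = (\<Sum>l. \<Sum>d. \<Sum>k. inv_pow p (l + d + k + 3) * inv_pow q (l + d + 2) * inv_pow r (l + 1))"
text \<open>Tornheim sums interpolate between the product of two zeta values (c = 0) and double zeta
  values (a = 0 or b = 0); partial fractions lead from one end to the other.\<close>

definition tornheim :: "nat \<Rightarrow> nat \<Rightarrow> nat \<Rightarrow> ennreal" where
  "tornheim a b c = (\<Sum>m. \<Sum>l. inv_pow a (m + 1) * inv_pow b (l + 1) * inv_pow c (m + l + 2))"
definition tornheim1 :: "nat \<Rightarrow> nat \<Rightarrow> nat \<Rightarrow> nat \<Rightarrow> ennreal" where
  "tornheim1 a b c p = (\<Sum>m. \<Sum>l. \<Sum>k.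
     inv_pow a (m + 1) * inv_pow b (l + 1) * inv_pow c (m + l + 2) * inv_pow p (m + l + k + 3))"
text \<open>Shuffles m + 1 with the pair l + k + 2 > l + 1; the last factor is the sum of m + 1 and
  l + k + 2. At p = 0 this is a product of depths one and two. Once b reaches 0 only m + 1 and l + 1
  still interact, under a free outer index, which is \<open>tornheim1\<close> with c = 0.\<close>

definition tornheim2 :: "nat \<Rightarrow> nat \<Rightarrow> nat \<Rightarrow> nat \<Rightarrow> ennreal" where
  "tornheim2 a b c p = (\<Sum>m. \<Sum>l. \<Sum>k.
     inv_pow a (m + 1) * inv_pow b (l + k + 2) * inv_pow c (l + 1) * inv_pow p (m + l + k + 3))"

lemma tornheim_Suc_Suc:
  "tornheim (Suc a) (Suc b) c = tornheim a (Suc b) (Suc c) + tornheim (Suc a) b (Suc c)"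
proof -
  have "inv_pow (Suc a) (m + 1) * inv_pow (Suc b) (l + 1) * inv_pow c (m + l + 2) =
     inv_pow a (m + 1) * inv_pow (Suc b) (l + 1) * inv_pow (Suc c) (m + l + 2) +
     inv_pow (Suc a) (m + 1) * inv_pow b (l + 1) * inv_pow (Suc c) (m + l + 2)" for m l
    using inv_pow_mult [of 1 "m + l + 2" c]
    by (subst inv_pow_partial_fraction) (auto simp: algebra_simps)
  thus ?thesis
    by (simp only: tornheim_def suminf_add_ennreal)
qed

lemma tornheim1_Suc_Suc:
  "tornheim1 (Suc a) (Suc b) c p = tornheim1 a (Suc b) (Suc c) p + tornheim1 (Suc a) b (Suc c) p"
proof -
  have "inv_pow (Suc a) (m + 1) * inv_pow (Suc b) (l + 1) * inv_pow c (m + l + 2) * inv_pow p (m + l + k + 3) =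
     inv_pow a (m + 1) * inv_pow (Suc b) (l + 1) * inv_pow (Suc c) (m + l + 2) * inv_pow p (m + l + k + 3) +
     inv_pow (Suc a) (m + 1) * inv_pow b (l + 1) * inv_pow (Suc c) (m + l + 2) * inv_pow p (m + l + k + 3)" for m l k
    using inv_pow_mult [of 1 "m + l + 2" c]
    by (subst inv_pow_partial_fraction) (auto simp: algebra_simps)
  thus ?thesis
    by (simp only: tornheim1_def suminf_add_ennreal)
qed

lemma tornheim2_Suc_Suc:
  "tornheim2 (Suc a) (Suc b) c p = tornheim2 a (Suc b) c (Suc p) + tornheim2 (Suc a) b c (Suc p)"
proof -
  have "inv_pow (Suc a) (m + 1) * inv_pow (Suc b) (l + k + 2) * inv_pow c (l + 1) * inv_pow p (m + l + k + 3) =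
     inv_pow a (m + 1) * inv_pow (Suc b) (l + k + 2) * inv_pow c (l + 1) * inv_pow (Suc p) (m + l + k + 3) +
     inv_pow (Suc a) (m + 1) * inv_pow b (l + k + 2) * inv_pow c (l + 1) * inv_pow (Suc p) (m + l + k + 3)" for m l k
    using inv_pow_mult [of 1 "m + l + k + 3" p]
    by (subst inv_pow_partial_fraction) (auto simp: algebra_simps numeral_eq_Suc)
  thus ?thesis
    by (simp only: tornheim2_def suminf_add_ennreal)
qed

lemma tornheim_commute: "tornheim a b c = tornheim b a c"
  unfolding tornheim_def by (subst suminf_swap_ennreal) (simp add: ac_simps)

lemma tornheim1_commute: "tornheim1 a b c p = tornheim1 b a c p"
  unfolding tornheim1_def by (subst suminf_swap_ennreal) (simp add: ac_simps)

lemma tornheim_0_left: "tornheim 0 b c = emzv2 c b"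
  unfolding tornheim_def emzv2_def by (subst suminf_swap_ennreal) (simp add: ac_simps)

lemma tornheim_0_middle: "tornheim a 0 c = emzv2 c a"
  by (simp add: tornheim_commute [of a] tornheim_0_left)

lemma tornheim_0_right: "tornheim a b 0 = emzv1 a * emzv1 b"
  by (simp add: tornheim_def emzv1_def)

lemma tornheim1_0_left: "tornheim1 0 b c p = emzv3 p c b"
  unfolding tornheim1_def emzv3_def by (subst suminf_swap_ennreal) (simp add: ac_simps)

lemma tornheim1_0_middle: "tornheim1 a 0 c p = emzv3 p c a"
  by (simp add: tornheim1_commute [of a] tornheim1_0_left)

lemma tornheim2_0_left: "tornheim2 0 b c p = emzv3 p b c"
proof -
  have "tornheim2 0 b c p = (\<Sum>l. \<Sum>m. \<Sum>k. inv_pow b (l + k + 2) * inv_pow c (l + 1) * inv_pow p (m + l + k + 3))"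
    unfolding tornheim2_def by (subst suminf_swap_ennreal) simp
  also have "\<dots> = emzv3 p b c"
    unfolding emzv3_def by (subst (2) suminf_swap_ennreal) (simp add: ac_simps)
  finally show ?thesis .
qed

lemma tornheim2_0_middle: "tornheim2 a 0 c p = tornheim1 a c 0 p"
  by (simp add: tornheim1_def tornheim2_def ac_simps)

lemma tornheim2_0_right: "tornheim2 a b c 0 = emzv1 a * emzv2 b c"
  by (simp add: tornheim2_def emzv1_def emzv2_def mult.assoc)

lemma stuffle_1_1: "emzv1 a * emzv1 b = emzv2 a b + emzv1 (a + b) + emzv2 b a"
proof -
  have "emzv1 a * emzv1 b = (\<Sum>n. \<Sum>m. inv_pow a (n + 1) * inv_pow b (m + 1))"
    by (simp add: emzv1_def)
  also have "\<dots> = emzv2 a b + emzv1 (a + b) + emzv2 b a"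
    by (subst suminf_trichotomy_ennreal)
       (simp add: emzv1_def emzv2_def inv_pow_mult [symmetric] ac_simps flip: numeral_2_eq_2)
  finally show ?thesis .
qed

text \<open>The new index is compared with the smaller index of the double sum and, if it exceeds
  that one, with the larger index as well: three strict positions and two coincidences.\<close>

lemma stuffle_1_2:
  "emzv1 a * emzv2 b c = emzv3 a b c + emzv2 (a + b) c + emzv3 b a c + emzv2 b (a + c) + emzv3 b c a"
proof -
  have "emzv1 a * emzv2 b c = (\<Sum>n. \<Sum>l. \<Sum>d. inv_pow a (n + 1) * (inv_pow b (l + d + 2) * inv_pow c (l + 1)))"
    by (simp add: emzv1_def emzv2_def)
  also have "\<dots> = (\<Sum>l. \<Sum>i. \<Sum>d. inv_pow a (l + i + 2) * (inv_pow b (l + d + 2) * inv_pow c (l + 1))) +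
       emzv2 b (a + c) + emzv3 b c a"
    by (subst suminf_trichotomy_ennreal)
       (simp add: emzv2_def emzv3_def inv_pow_mult [symmetric] ac_simps numeral_2_eq_2 numeral_3_eq_3)
  also have "(\<Sum>l. \<Sum>i. \<Sum>d. inv_pow a (l + i + 2) * (inv_pow b (l + d + 2) * inv_pow c (l + 1))) =
       emzv3 a b c + emzv2 (a + b) c + emzv3 b a c"
    by (subst suminf_trichotomy_ennreal)
       (simp add: emzv2_def emzv3_def inv_pow_mult [symmetric] ac_simps numeral_2_eq_2 numeral_3_eq_3
         suminf_add_ennreal)
  finally show ?thesis .
qed

text \<open>1/((m+1)(m+n+1)) is a difference quotient of the harmonic series, so the divergent parts
  cancel and a finite harmonic sum over n remains.\<close>

lemma suminf_inv_pow_telescope: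
  assumes "0 < n"
  shows "(\<Sum>m. inv_pow 1 (m + 1) * inv_pow 1 (m + n + 1)) = inv_pow 1 n * (\<Sum>j<n. inv_pow 1 (j + 1))"
proof -
  have "(\<lambda>m. 1 / real (m + 1) - 1 / real (m + 1 + n)) sums (\<Sum>j<n. 1 / real (j + 1))"
  proof (induction n)
    case (Suc n)
    have "(\<lambda>m. 1 / real (m + n + 1) - 1 / real (Suc m + n + 1)) sums (1 / real (0 + n + 1) - 0)"
      by (rule telescope_sums') real_asymp
    from sums_add [OF Suc this] show ?case by (simp add: add_ac)
  qed auto
  from sums_divide [OF this, of "real n"]
  moreover have "(1 / real (m + 1) - 1 / real (m + 1 + n)) / real n = 1 / real (m + 1) * (1 / real (m + n + 1))" for m
    using assms by (simp add: divide_simps)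
  ultimately have "(\<lambda>m. 1 / real (m + 1) * (1 / real (m + n + 1))) sums ((\<Sum>j<n. 1 / real (j + 1)) / real n)"
    by simp
  hence "(\<Sum>m. ennreal (1 / real (m + 1) * (1 / real (m + n + 1)))) = ennreal ((\<Sum>j<n. 1 / real (j + 1)) / real n)"
    by (intro suminf_ennreal_eq) auto
  also have "(\<Sum>j<n. 1 / real (j + 1)) / real n = 1 / real n * (\<Sum>j<n. 1 / real (j + 1))" by simp
  also have "ennreal \<dots> = ennreal (1 / real n) * (\<Sum>j<n. ennreal (1 / real (j + 1)))"
    by (subst ennreal_mult) (auto intro!: sum_nonneg)
  finally show ?thesis
    by (simp add: inv_pow_def ennreal_mult' [symmetric])
qed

text \<open>Equated with the partial fraction expansion of the same sum, this is Hoffman's relation: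
  it does the work of comparing shuffle and stuffle products with the divergent zeta(1), while every
  sum involved stays convergent for b \<ge> 1.\<close>

lemma tornheim_1_1: "tornheim 1 b 1 = emzv2 (b + 1) 1 + emzv1 (b + 2)"
proof -
  have "tornheim 1 b 1 = (\<Sum>l. \<Sum>m. inv_pow b (l + 1) * (inv_pow 1 (m + 1) * inv_pow 1 (m + (l + 1) + 1)))"
    unfolding tornheim_def by (subst suminf_swap_ennreal) (simp add: ac_simps)
  also have "\<dots> = (\<Sum>l. inv_pow b (l + 1) * (inv_pow 1 (l + 1) * (\<Sum>j<l+1. inv_pow 1 (j + 1))))"
    by (simp only: ennreal_suminf_cmult suminf_inv_pow_telescope)
  also have "\<dots> = (\<Sum>l. (\<Sum>j<l. inv_pow (b + 1) (l + 1) * inv_pow 1 (j + 1)) + inv_pow (b + 2) (l + 1))"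
    by (simp add: inv_pow_mult inv_pow_mult' ring_distribs add.commute flip: sum_distrib_left)
  also have "\<dots> = emzv2 (b + 1) 1 + emzv1 (b + 2)"
    by (simp add: suminf_add_ennreal suminf_lessThan_ennreal emzv1_def emzv2_def numeral_2_eq_2)
  finally show ?thesis .
qed

lemma sum_lessThan_split:
  fixes g :: "nat \<Rightarrow> 'a :: comm_monoid_add"
  shows "(\<Sum>j<l+k+2. g j) = (\<Sum>j<l. g j) + g l + (\<Sum>j<k. g (l + j + 1)) + g (l + k + 1)"
  by (induction k) (simp_all add: ac_simps)

text \<open>Depth-three counterpart. The harmonic sum up to l + k + 2 is split at l + 1: indices
  below, equal, strictly between, and equal to the top give the four terms.\<close>

lemma tornheim2_1_1: "tornheim2 1 b c 1 = emzv3 (b + 1) 1 c + emzv2 (b + 2) c + emzv2 (b + 1) (c + 1) + emzv3 (b + 1) c 1"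
proof -
  let ?f = "\<lambda>l k. inv_pow (b + 1) (l + k + 2) * inv_pow c (l + 1)"
  have "tornheim2 1 b c 1 = (\<Sum>l. \<Sum>m. \<Sum>k. inv_pow b (l + k + 2) * inv_pow c (l + 1) *
           (inv_pow 1 (m + 1) * inv_pow 1 (m + (l + k + 2) + 1)))"
    unfolding tornheim2_def by (subst suminf_swap_ennreal) (simp add: ac_simps numeral_3_eq_3 numeral_2_eq_2)
  also have "\<dots> = (\<Sum>l. \<Sum>k. \<Sum>m. inv_pow b (l + k + 2) * inv_pow c (l + 1) *
           (inv_pow 1 (m + 1) * inv_pow 1 (m + (l + k + 2) + 1)))"
    by (subst (2) suminf_swap_ennreal) simp
  also have "\<dots> = (\<Sum>l. \<Sum>k. inv_pow b (l + k + 2) * inv_pow c (l + 1) * (inv_pow 1 (l + k + 2) * (\<Sum>j<l+k+2. inv_pow 1 (j + 1))))"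
    by (subst ennreal_suminf_cmult, subst suminf_inv_pow_telescope) simp_all
  also have "\<dots> = (\<Sum>l. \<Sum>k. ?f l k * (\<Sum>j<l+k+2. inv_pow 1 (j + 1)))"
    by (intro suminf_cong) (simp only: inv_pow_mult [symmetric] ac_simps)
  also have "\<dots> = (\<Sum>l. \<Sum>k. (\<Sum>j<l. ?f l k * inv_pow 1 (j + 1)) + ?f l k * inv_pow 1 (l + 1) +
      (\<Sum>j<k. ?f l k * inv_pow 1 (l + j + 2)) + ?f l k * inv_pow 1 (l + k + 2))"
    by (subst sum_lessThan_split) (simp add: ring_distribs sum_distrib_left)
  also have "\<dots> = (\<Sum>l. \<Sum>k. \<Sum>j<l. ?f l k * inv_pow 1 (j + 1)) + (\<Sum>l. \<Sum>k. ?f l k * inv_pow 1 (l + 1)) +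
      (\<Sum>l. \<Sum>k. \<Sum>j<k. ?f l k * inv_pow 1 (l + j + 2)) + (\<Sum>l. \<Sum>k. ?f l k * inv_pow 1 (l + k + 2))"
    by (simp only: suminf_add_ennreal)
  also have "(\<Sum>l. \<Sum>k. \<Sum>j<l. ?f l k * inv_pow 1 (j + 1)) = emzv3 (b + 1) c 1"
  proof -
    have "(\<Sum>l. \<Sum>k. \<Sum>j<l. ?f l k * inv_pow 1 (j + 1)) = (\<Sum>l. \<Sum>j<l. \<Sum>k. ?f l k * inv_pow 1 (j + 1))"
      by (intro suminf_cong suminf_sum) auto
    thus ?thesis
      by (simp add: suminf_lessThan_ennreal emzv3_def ac_simps numeral_2_eq_2 numeral_3_eq_3)
  qed
  also have "(\<Sum>l. \<Sum>k. ?f l k * inv_pow 1 (l + 1)) = emzv2 (b + 1) (c + 1)"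
    by (simp add: emzv2_def mult.assoc inv_pow_mult)
  also have "(\<Sum>l. \<Sum>k. \<Sum>j<k. ?f l k * inv_pow 1 (l + j + 2)) = emzv3 (b + 1) 1 c"
    by (simp add: suminf_lessThan_ennreal emzv3_def ac_simps numeral_2_eq_2 numeral_3_eq_3)
  also have "(\<Sum>l. \<Sum>k. ?f l k * inv_pow 1 (l + k + 2)) = emzv2 (b + 2) c"
  proof -
    have "?f l k * inv_pow 1 (l + k + 2) = inv_pow (b + 2) (l + k + 2) * inv_pow c (l + 1)" for l k
      using inv_pow_mult [of "b + 1" "l + k + 2" 1] by (simp add: ac_simps)
    thus ?thesis by (simp only: emzv2_def)
  qed
  finally show ?thesis by (simp only: ac_simps)
qed

section \<open>Convergence, real multiple zeta values, and the link to the stated zeta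
  functions\<close>

lemma emzv1_less_top: "2 \<le> p \<Longrightarrow> emzv1 p < top"
proof -
  assume "2 \<le> p"
  hence "summable (\<lambda>n. 1 / real n ^ p)"
    using inverse_power_summable [of p, where ?'a = real] by (simp add: inverse_eq_divide power_one_over)
  hence "summable (\<lambda>n. 1 / real (n + 1) ^ p)"
    using summable_iff_shift [of "\<lambda>n. 1 / real n ^ p" 1] by simp
  thus ?thesis
    unfolding emzv1_def inv_pow_def by (intro ennreal_suminf_neq_top [THEN top.not_eq_extremum [THEN iffD1]]) auto
qed

lemma summable_powr_4_3: "summable (\<lambda>n. 1 / real (n + 1) powr (4/3))"
  using summable_iff_shift [of "\<lambda>n. real n powr (-(4/3))" 1] summable_real_powr_iff [of "-(4/3)"]
  by (simp add: powr_minus_divide)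

text \<open>In the extremal case (2, 1, 1) the square of the largest index x is distributed as
  x^(4/3) x^(1/3) x^(1/3). Each of the three free variables then receives the exponent 4/3 > 1, and
  the sum is dominated by a product of three convergent series.\<close>

lemma emzv3_less_top:
  assumes "2 \<le> p" "1 \<le> q" "1 \<le> r"
  shows "emzv3 p q r < top"
proof -
  define h where "h n = ennreal (1 / real (n + 1) powr (4/3))" for n
  have h: "suminf h < top"
    unfolding h_def using summable_powr_4_3
    by (intro ennreal_suminf_neq_top [THEN top.not_eq_extremum [THEN iffD1]]) auto
  have "inv_pow p (l + d + k + 3) * inv_pow q (l + d + 2) * inv_pow r (l + 1) \<le> h k * h d * h l" for l d k
  proof -
    let ?x = "real (l + d + k + 3)" and ?y = "real (l + d + 2)" and ?z = "real (l + 1)"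
    have "real (k + 1) powr (4/3) * real (d + 1) powr (4/3) * real (l + 1) powr (4/3)
          \<le> ?x powr (4/3) * (?x powr (1/3) * ?y powr 1) * (?x powr (1/3) * ?z powr 1)"
    proof (intro mult_mono)
      have "real (d + 1) powr (4/3) = real (d + 1) powr (1/3) * real (d + 1) powr 1"
        by (subst powr_add [symmetric]) simp
      also have "\<dots> \<le> ?x powr (1/3) * ?y powr 1" by (intro mult_mono powr_mono2) auto
      finally show "real (d + 1) powr (4/3) \<le> ?x powr (1/3) * ?y powr 1" .
      have "real (l + 1) powr (4/3) = real (l + 1) powr (1/3) * real (l + 1) powr 1"
        by (subst powr_add [symmetric]) simp
      also have "\<dots> \<le> ?x powr (1/3) * ?z powr 1" by (intro mult_mono powr_mono2) auto
      finally show "real (l + 1) powr (4/3) \<le> ?x powr (1/3) * ?z powr 1" .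
    qed (auto intro!: powr_mono2)
    also have "\<dots> = ?x powr (4/3 + 1/3 + 1/3) * ?y * ?z"
      by (simp only: powr_add powr_one') simp
    also have "?x powr (4/3 + 1/3 + 1/3) = ?x ^ 2"
      using powr_realpow [of ?x 2] by simp
    also have "?x ^ 2 * ?y * ?z \<le> ?x ^ p * ?y ^ q * ?z ^ r"
      using assms by (intro mult_mono power_increasing self_le_power) auto
    finally have "1 / (?x ^ p * ?y ^ q * ?z ^ r) \<le>
        1 / (real (k + 1) powr (4/3) * real (d + 1) powr (4/3) * real (l + 1) powr (4/3))"
      by (intro divide_left_mono mult_pos_pos) auto
    thus ?thesis
      by (simp add: inv_pow_def h_def ennreal_mult' [symmetric])
  qed
  hence "emzv3 p q r \<le> (\<Sum>l. \<Sum>d. \<Sum>k. h k * h d * h l)"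
    unfolding emzv3_def by (intro suminf_le) auto
  also have "\<dots> = suminf h * suminf h * suminf h" by simp
  also have "\<dots> < top" using h by (simp add: ennreal_mult_less_top)
  finally show ?thesis .
qed

lemma emzv2_less_top:
  assumes "2 \<le> p" "1 \<le> q"
  shows "emzv2 p q < top"
proof -
  define h where "h n = ennreal (1 / real (n + 1) powr (4/3))" for n
  have h: "suminf h < top"
    unfolding h_def using summable_powr_4_3
    by (intro ennreal_suminf_neq_top [THEN top.not_eq_extremum [THEN iffD1]]) auto
  have "inv_pow p (l + d + 2) * inv_pow q (l + 1) \<le> h d * h l" for l d
  proof -
    let ?x = "real (l + d + 2)" and ?z = "real (l + 1)"
    have "real (d + 1) powr (4/3) * real (l + 1) powr (4/3) \<le> ?x powr (4/3) * (?x powr (2/3) * ?z powr 1)"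
    proof (intro mult_mono)
      have "real (l + 1) powr (4/3) = real (l + 1) powr (1/3) * real (l + 1) powr 1"
        by (subst powr_add [symmetric]) simp
      also have "real (l + 1) powr (1/3) \<le> real (l + 1) powr (2/3)"
        by (intro powr_mono) auto
      also have "\<dots> \<le> ?x powr (2/3)" by (intro powr_mono2) auto
      finally show "real (l + 1) powr (4/3) \<le> ?x powr (2/3) * ?z powr 1"
        by simp
    qed (auto intro!: powr_mono2)
    also have "\<dots> = ?x powr (4/3 + 2/3) * ?z"
      by (simp only: powr_add powr_one')
    also have "?x powr (4/3 + 2/3) = ?x ^ 2"
      using powr_realpow [of ?x 2] by simp
    also have "?x ^ 2 * ?z \<le> ?x ^ p * ?z ^ q"
      using assms by (intro mult_mono power_increasing self_le_power) auto
    finally have "1 / (?x ^ p * ?z ^ q) \<le> 1 / (real (d + 1) powr (4/3) * real (l + 1) powr (4/3))"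
      by (intro divide_left_mono mult_pos_pos) auto
    thus ?thesis
      by (simp add: inv_pow_def h_def ennreal_mult' [symmetric])
  qed
  hence "emzv2 p q \<le> (\<Sum>l. \<Sum>d. h d * h l)"
    unfolding emzv2_def by (intro suminf_le) auto
  also have "\<dots> = suminf h * suminf h" by simp
  also have "\<dots> < top" using h by (simp add: ennreal_mult_less_top)
  finally show ?thesis .
qed

definition mzv1 :: "nat \<Rightarrow> real" where "mzv1 p = enn2real (emzv1 p)"
definition mzv2 :: "nat \<Rightarrow> nat \<Rightarrow> real" where "mzv2 p q = enn2real (emzv2 p q)"
definition mzv3 :: "nat \<Rightarrow> nat \<Rightarrow> nat \<Rightarrow> real" where "mzv3 p q r = enn2real (emzv3 p q r)"

lemma emzv1_eq: "2 \<le> p \<Longrightarrow> emzv1 p = ennreal (mzv1 p)"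
  by (simp add: mzv1_def emzv1_less_top)
lemma emzv2_eq: "2 \<le> p \<Longrightarrow> 1 \<le> q \<Longrightarrow> emzv2 p q = ennreal (mzv2 p q)"
  by (simp add: mzv2_def emzv2_less_top)
lemma emzv3_eq: "2 \<le> p \<Longrightarrow> 1 \<le> q \<Longrightarrow> 1 \<le> r \<Longrightarrow> emzv3 p q r = ennreal (mzv3 p q r)"
  by (simp add: mzv3_def emzv3_less_top)

lemma mzv_nonneg [simp]: "0 \<le> mzv1 p" "0 \<le> mzv2 p q" "0 \<le> mzv3 p q r"
  by (simp_all add: mzv1_def mzv2_def mzv3_def)

lemmas emzv_eq = emzv1_eq emzv2_eq emzv3_eq

lemma tornheim_rec:
  "0 < a \<Longrightarrow> 0 < b \<Longrightarrow> tornheim a b c = tornheim (a - 1) b (c + 1) + tornheim a (b - 1) (c + 1)"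
  using tornheim_Suc_Suc [of "a - 1" "b - 1"] by simp
lemma tornheim1_rec:
  "0 < a \<Longrightarrow> 0 < b \<Longrightarrow> tornheim1 a b c p = tornheim1 (a - 1) b (c + 1) p + tornheim1 a (b - 1) (c + 1) p"
  using tornheim1_Suc_Suc [of "a - 1" "b - 1"] by simp
lemma tornheim2_rec:
  "0 < a \<Longrightarrow> 0 < b \<Longrightarrow> tornheim2 a b c p = tornheim2 (a - 1) b c (p + 1) + tornheim2 a (b - 1) c (p + 1)"
  using tornheim2_Suc_Suc [of "a - 1" "b - 1"] by simp

lemmas tornheim_all_0 = tornheim_0_left tornheim_0_middle tornheim1_0_left tornheim1_0_middle tornheim2_0_left tornheim2_0_middle
lemmas tornheim_all_rec = tornheim_rec tornheim1_rec tornheim2_rec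

text \<open>A rewriting system: the recursions lower the first two exponents until one of them is
  zero, the boundary rules then produce multiple zeta values, and the remaining rules turn the
  \<open>ennreal\<close> equation into one between reals.\<close>

lemmas emzv_double_shuffle = tornheim_all_rec tornheim_all_0 emzv_eq ennreal_mult' [symmetric] ennreal_plus [symmetric]

lemma zeta_twos_nonneg: "2 \<le> s \<Longrightarrow> 0 \<le> zeta_twos i s"
  unfolding zeta_twos_def by (intro suminf_nonneg summable_zeta_twos divide_nonneg_nonneg nested_sum_nonneg) auto

lemma ennreal_zeta_twos:
  assumes "2 \<le> s"
  shows "ennreal (zeta_twos i s) = (\<Sum>k. ennreal (nested_sum i k) * inv_pow s (k + 1))"
proof -
  have "ennreal (zeta_twos i s) = (\<Sum>k. ennreal (nested_sum i k / real (Suc k) ^ s))"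
    unfolding zeta_twos_def by (rule suminf_ennreal2 [symmetric, OF _ summable_zeta_twos [OF assms]]) (simp add: nested_sum_nonneg)
  also have "\<dots> = (\<Sum>k. ennreal (nested_sum i k) * inv_pow s (k + 1))"
    unfolding inv_pow_def by (intro suminf_cong) (simp add: ennreal_mult' [symmetric] nested_sum_nonneg)
  finally show ?thesis .
qed

lemma ennreal_nested_sum_Suc: "ennreal (nested_sum (Suc i) k) = (\<Sum>j<k. inv_pow 2 (j + 1) * ennreal (nested_sum i j))"
proof -
  have "ennreal (nested_sum (Suc i) k) = (\<Sum>j<k. ennreal (nested_sum i j / real (Suc j) ^ 2))"
    unfolding nested_sum.simps by (intro sum_ennreal [symmetric]) (simp add: nested_sum_nonneg)
  thus ?thesis
    unfolding inv_pow_def by (simp add: ennreal_mult' [symmetric] nested_sum_nonneg)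
qed

lemma mzv1_eq_zeta_twos:
  assumes "2 \<le> s"
  shows "mzv1 s = zeta_twos 0 s"
proof -
  have "emzv1 s = ennreal (zeta_twos 0 s)" unfolding emzv1_def ennreal_zeta_twos [OF assms] by simp
  thus ?thesis using zeta_twos_nonneg [OF assms] by (simp add: mzv1_def)
qed

lemma mzv2_eq_zeta_twos:
  assumes "2 \<le> s"
  shows "mzv2 s 2 = zeta_twos 1 s"
proof -
  have "emzv2 s 2 = (\<Sum>n. \<Sum>m<n. inv_pow s (n + 1) * inv_pow 2 (m + 1))"
    unfolding emzv2_def by (subst suminf_lessThan_ennreal) (simp add: numeral_2_eq_2)
  also have "\<dots> = (\<Sum>n. ennreal (nested_sum (Suc 0) n) * inv_pow s (n + 1))"
    unfolding ennreal_nested_sum_Suc by (simp add: sum_distrib_left mult.commute)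
  also have "\<dots> = ennreal (zeta_twos 1 s)" using ennreal_zeta_twos [OF assms, of 1] by simp
  finally show ?thesis using zeta_twos_nonneg [OF assms] by (simp add: mzv2_def)
qed

lemma mzv3_eq_zeta_twos:
  assumes "2 \<le> s"
  shows "mzv3 s 2 2 = zeta_twos 2 s"
proof -
  have "emzv3 s 2 2 = (\<Sum>l. \<Sum>d. (\<Sum>k. inv_pow s ((l + d + 1) + k + 1 + 1)) * inv_pow 2 ((l + d + 1) + 1) * inv_pow 2 (l + 1))"
    unfolding emzv3_def by (simp add: numeral_3_eq_3 numeral_2_eq_2)
  also have "\<dots> = (\<Sum>n. \<Sum>m<n. (\<Sum>k. inv_pow s (n + k + 1 + 1)) * inv_pow 2 (n + 1) * inv_pow 2 (m + 1))"
    by (rule suminf_lessThan_ennreal [symmetric])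
  also have "\<dots> = (\<Sum>n. (\<Sum>k. inv_pow s (n + k + 1 + 1)) * (inv_pow 2 (n + 1) * ennreal (nested_sum (Suc 0) n)))"
    unfolding ennreal_nested_sum_Suc by (simp add: sum_distrib_left mult.assoc)
  also have "\<dots> = (\<Sum>n. \<Sum>k. inv_pow s ((n + k + 1) + 1) * (inv_pow 2 (n + 1) * ennreal (nested_sum (Suc 0) n)))"
    by simp
  also have "\<dots> = (\<Sum>m. \<Sum>n<m. inv_pow s (m + 1) * (inv_pow 2 (n + 1) * ennreal (nested_sum (Suc 0) n)))"
    by (rule suminf_lessThan_ennreal [symmetric])
  also have "\<dots> = (\<Sum>m. ennreal (nested_sum (Suc (Suc 0)) m) * inv_pow s (m + 1))"
    unfolding ennreal_nested_sum_Suc [of "Suc 0"] by (simp only: sum_distrib_left mult.commute [of "sum _ _"])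
  also have "\<dots> = ennreal (zeta_twos 2 s)" using ennreal_zeta_twos [OF assms, of 2] by (simp add: numeral_2_eq_2)
  finally show ?thesis using zeta_twos_nonneg [OF assms] by (simp add: mzv3_def)
qed

lemma zeta_n_eq_mzv1:
  assumes "2 \<le> s"
  shows "zeta_n s = of_real (mzv1 s)"
proof -
  have "of_real (zeta_twos 0 s) = (\<Sum>k. complex_of_real (1 / real (Suc k) ^ s))"
    using summable_zeta_twos [OF assms, of 0] unfolding zeta_twos_def by (subst suminf_of_real) simp_all
  thus ?thesis unfolding zeta_n_def mzv1_eq_zeta_twos [OF assms] by (simp add: inverse_eq_divide)
qed

lemma mzv1_even_pi:
  "mzv1 2 = pi ^ 2 / 6" "mzv1 4 = pi ^ 4 / 90" "mzv1 6 = pi ^ 6 / 945" "mzv1 8 = pi ^ 8 / 9450"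
proof -
  have "of_real (mzv1 2) = complex_of_real (pi ^ 2 / 6)" "of_real (mzv1 4) = complex_of_real (pi ^ 4 / 90)"
    "of_real (mzv1 6) = complex_of_real (pi ^ 6 / 945)" "of_real (mzv1 8) = complex_of_real (pi ^ 8 / 9450)"
    using zeta_n_eq_mzv1 [of 2] zeta_n_eq_mzv1 [of 4] zeta_n_eq_mzv1 [of 6] zeta_n_eq_mzv1 [of 8] by (simp_all add: zeta_n_even)
  thus "mzv1 2 = pi ^ 2 / 6" "mzv1 4 = pi ^ 4 / 90" "mzv1 6 = pi ^ 6 / 945" "mzv1 8 = pi ^ 8 / 9450"
    by (simp_all only: of_real_eq_iff)
qed

text \<open>Products of even zeta values collapse to a single zeta value. After this reduction the
  relations are linear in the remaining products, which linear arithmetic treats as atoms.\<close>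

lemma mzv1_even:
  "mzv1 2 * mzv1 2 = 5 / 2 * mzv1 4" "mzv1 2 * mzv1 4 = 7 / 4 * mzv1 6"
  "mzv1 2 * mzv1 6 = 5 / 3 * mzv1 8" "mzv1 4 * mzv1 4 = 7 / 6 * mzv1 8"
  unfolding mzv1_even_pi by (simp_all flip: power_add)

lemma zeta_eq_mzv1:
  "zeta 2 = of_real (mzv1 2)" "zeta 3 = of_real (mzv1 3)" "zeta 4 = of_real (mzv1 4)" "zeta 5 = of_real (mzv1 5)"
  "zeta 6 = of_real (mzv1 6)" "zeta 7 = of_real (mzv1 7)" "zeta 8 = of_real (mzv1 8)" "zeta 9 = of_real (mzv1 9)"
proof -
  have "of_nat (Suc n) powr (- of_nat s) = inverse (of_nat (Suc n) ^ s :: complex)" for n s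
    by (simp add: powr_minus powr_nat' del: of_nat_Suc)
  hence *: "zeta (of_nat s) = of_real (mzv1 s)" if "2 \<le> s" for s
    unfolding zeta_def zeta_n_eq_mzv1 [OF that, symmetric] zeta_n_def by (simp only:)
  show "zeta 2 = of_real (mzv1 2)" "zeta 3 = of_real (mzv1 3)" "zeta 4 = of_real (mzv1 4)" "zeta 5 = of_real (mzv1 5)"
    "zeta 6 = of_real (mzv1 6)" "zeta 7 = of_real (mzv1 7)" "zeta 8 = of_real (mzv1 8)" "zeta 9 = of_real (mzv1 9)"
    using * [of 2] * [of 3] * [of 4] * [of 5] * [of 6] * [of 7] * [of 8] * [of 9] by simp_all
qed

lemma sums_of_ennreal:
  assumes "\<And>i. 0 \<le> f i" "(\<Sum>i. ennreal (f i)) = ennreal t" "0 \<le> t"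
  shows "f sums t"
proof -
  have f: "summable f" by (rule summable_suminf_not_top [OF assms(1)]) (simp add: assms(2))
  have "ennreal (suminf f) = ennreal t"
    using suminf_ennreal2 [OF assms(1) f] assms(2) by (simp only:)
  hence "suminf f = t"
    using assms(1,3) suminf_nonneg [OF f] by (simp only: ennreal_inj)
  thus ?thesis using f by (simp add: sums_iff)
qed

text \<open>The gap parametrisation (l, d) corresponds to the pair (l + d + 2, l + 1).
  Non-negativity upgrades the iterated sums to an unordered \<open>has_sum\<close>, which is what
  \<open>double_zeta\<close> requires.\<close>

lemma double_zeta_eq_mzv2:
  assumes "2 \<le> p" "1 \<le> q"
  shows "double_zeta p q = of_real (mzv2 p q)"
proof -
  let ?f = "\<lambda>l d. 1 / real (l + d + 2) ^ p * (1 / real (l + 1) ^ q)"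
  define S where "S l = enn2real (\<Sum>d. ennreal (?f l d))" for l
  have f: "ennreal (?f l d) = inv_pow p (l + d + 2) * inv_pow q (l + 1)" for l d
    unfolding inv_pow_def by (rule ennreal_mult') simp
  have tot: "(\<Sum>l. \<Sum>d. ennreal (?f l d)) = ennreal (mzv2 p q)"
    unfolding f emzv2_eq [OF assms, symmetric] emzv2_def ..
  have fin: "g l \<noteq> top" if "(\<Sum>l. g l) = ennreal c" for g l c
  proof
    assume "g l = top"
    moreover have "g l \<le> (\<Sum>l. g l)"
      using sum_le_suminf [of g "{l}"] by simp
    ultimately show False unfolding that by (simp add: top_unique)
  qed
  have S: "(\<Sum>d. ennreal (?f l d)) = ennreal (S l)" for l
    unfolding S_def using fin [OF tot, of l] by (intro ennreal_enn2real [symmetric]) (simp only: less_top)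
  have inner: "((\<lambda>d. ?f l d) has_sum S l) UNIV" for l
    by (rule sums_nonneg_imp_has_sum [OF sums_of_ennreal [OF _ S]]) (simp_all add: S_def)
  have "(\<Sum>l. ennreal (S l)) = ennreal (mzv2 p q)" using tot unfolding S .
  hence outer: "(S has_sum mzv2 p q) UNIV"
    by (rule sums_nonneg_imp_has_sum [OF sums_of_ennreal [rotated]]) (simp_all add: S_def)
  have "((\<lambda>(l, d). ?f l d) has_sum mzv2 p q) (UNIV \<times> UNIV)"
  proof (rule has_sum_SigmaI [OF _ outer])
    show "(\<lambda>(l, d). ?f l d) summable_on UNIV \<times> UNIV"
      by (rule summable_on_SigmaI [where g = S]) (use inner outer in \<open>auto intro: has_sum_imp_summable\<close>)
  qed (use inner in simp)
  also have "((\<lambda>(l, d). ?f l d) has_sum mzv2 p q) (UNIV \<times> UNIV) \<longleftrightarrow>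
      ((\<lambda>(k, l). 1 / (real k ^ p * real l ^ q)) has_sum mzv2 p q) {(k, l). k > l \<and> l > 0}"
    by (rule has_sum_reindex_bij_witness [where j = "\<lambda>(l, d). (l + d + 2, l + 1)" and i = "\<lambda>(k, l). (l - 1, k - l - 1)"])
       auto
  finally have "((\<lambda>x. complex_of_real ((\<lambda>(k, l). 1 / (real k ^ p * real l ^ q)) x)) has_sum of_real (mzv2 p q)) {(k, l). k > l \<and> l > 0}"
    by (rule has_sum_of_real)
  moreover have "(\<lambda>x. complex_of_real ((\<lambda>(k, l). 1 / (real k ^ p * real l ^ q)) x)) = (\<lambda>(k, l). 1 / (of_nat k ^ p * of_nat l ^ q))"
    by (auto simp: fun_eq_iff)
  ultimately show ?thesis
    unfolding double_zeta_def by (simp add: infsumI)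
qed

section \<open>Double shuffle relations in weights 4 to 9\<close>

lemma hoffman_mzv_1_3: "mzv1 4 = mzv2 3 1 + mzv2 2 2"
  using tornheim_1_1 [of 2] by (simp add: emzv_double_shuffle del: ennreal_plus One_nat_def; simp)

lemma stuffle_mzv_2_2: "mzv1 2 * mzv1 2 = 2 * mzv2 2 2 + mzv1 4"
  using stuffle_1_1 [of 2 2] by (simp add: emzv_double_shuffle del: ennreal_plus One_nat_def; simp)

lemma hoffman_mzv_1_4: "mzv1 5 = mzv2 4 1 + mzv2 2 3 + mzv2 3 2"
  using tornheim_1_1 [of 3] by (simp add: emzv_double_shuffle del: ennreal_plus One_nat_def; simp)

text \<open>The product expanded here by partial fractions is the one that the stuffle relation
  expands by comparing indices; playing the two expansions against each other gives linear relations
  among double zeta values.\<close>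

lemma shuffle_mzv_2_3: "mzv1 2 * mzv1 3 = mzv2 2 3 + 3 * mzv2 3 2 + 6 * mzv2 4 1"
  using tornheim_0_right [of 2 3] by (simp add: emzv_double_shuffle del: ennreal_plus One_nat_def; simp)

lemma stuffle_mzv_2_3: "mzv1 2 * mzv1 3 = mzv2 2 3 + mzv2 3 2 + mzv1 5"
  using stuffle_1_1 [of 2 3] by (simp add: emzv_double_shuffle del: ennreal_plus One_nat_def; simp)

lemma hoffman_mzv_1_5: "mzv1 6 = mzv2 5 1 + mzv2 2 4 + mzv2 3 3 + mzv2 4 2"
  using tornheim_1_1 [of 4] by (simp add: emzv_double_shuffle del: ennreal_plus One_nat_def; simp)

lemma shuffle_mzv_2_4: "mzv1 2 * mzv1 4 = mzv2 2 4 + 2 * mzv2 3 3 + 4 * mzv2 4 2 + 8 * mzv2 5 1"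
  using tornheim_0_right [of 2 4] by (simp add: emzv_double_shuffle del: ennreal_plus One_nat_def; simp)

lemma shuffle_mzv_3_3: "mzv1 3 * mzv1 3 = 2 * mzv2 3 3 + 6 * mzv2 4 2 + 12 * mzv2 5 1"
  using tornheim_0_right [of 3 3] by (simp add: emzv_double_shuffle del: ennreal_plus One_nat_def; simp)

lemma stuffle_mzv_2_4: "mzv1 2 * mzv1 4 = mzv2 2 4 + mzv2 4 2 + mzv1 6"
  using stuffle_1_1 [of 2 4] by (simp add: emzv_double_shuffle del: ennreal_plus One_nat_def; simp)

lemma stuffle_mzv_3_3: "mzv1 3 * mzv1 3 = 2 * mzv2 3 3 + mzv1 6"
  using stuffle_1_1 [of 3 3] by (simp add: emzv_double_shuffle del: ennreal_plus One_nat_def; simp)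

lemma hoffman_mzv_1_6: "mzv1 7 = mzv2 6 1 + mzv2 2 5 + mzv2 3 4 + mzv2 4 3 + mzv2 5 2"
  using tornheim_1_1 [of 5] by (simp add: emzv_double_shuffle del: ennreal_plus One_nat_def; simp)

lemma shuffle_mzv_2_5: "mzv1 2 * mzv1 5 = mzv2 2 5 + 2 * mzv2 3 4 + 3 * mzv2 4 3 + 5 * mzv2 5 2 + 10 * mzv2 6 1"
  using tornheim_0_right [of 2 5] by (simp add: emzv_double_shuffle del: ennreal_plus One_nat_def; simp)

lemma shuffle_mzv_3_4: "mzv1 3 * mzv1 4 = mzv2 3 4 + 4 * mzv2 4 3 + 10 * mzv2 5 2 + 20 * mzv2 6 1"
  using tornheim_0_right [of 3 4] by (simp add: emzv_double_shuffle del: ennreal_plus One_nat_def; simp)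

lemma stuffle_mzv_2_5: "mzv1 2 * mzv1 5 = mzv2 2 5 + mzv2 5 2 + mzv1 7"
  using stuffle_1_1 [of 2 5] by (simp add: emzv_double_shuffle del: ennreal_plus One_nat_def; simp)

lemma stuffle_mzv_3_4: "mzv1 3 * mzv1 4 = mzv2 3 4 + mzv2 4 3 + mzv1 7"
  using stuffle_1_1 [of 3 4] by (simp add: emzv_double_shuffle del: ennreal_plus One_nat_def; simp)

lemma hoffman_mzv_1_7: "mzv1 8 = mzv2 7 1 + mzv2 2 6 + mzv2 3 5 + mzv2 4 4 + mzv2 5 3 + mzv2 6 2"
  using tornheim_1_1 [of 6] by (simp add: emzv_double_shuffle del: ennreal_plus One_nat_def; simp)

lemma shuffle_mzv_2_6: "mzv1 2 * mzv1 6 = mzv2 2 6 + 2 * mzv2 3 5 + 3 * mzv2 4 4 + 4 * mzv2 5 3 + 6 * mzv2 6 2 + 12 * mzv2 7 1"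
  using tornheim_0_right [of 2 6] by (simp add: emzv_double_shuffle del: ennreal_plus One_nat_def; simp)

lemma shuffle_mzv_3_5: "mzv1 3 * mzv1 5 = mzv2 3 5 + 3 * mzv2 4 4 + 7 * mzv2 5 3 + 15 * mzv2 6 2 + 30 * mzv2 7 1"
  using tornheim_0_right [of 3 5] by (simp add: emzv_double_shuffle del: ennreal_plus One_nat_def; simp)

lemma shuffle_mzv_4_4: "mzv1 4 * mzv1 4 = 2 * mzv2 4 4 + 8 * mzv2 5 3 + 20 * mzv2 6 2 + 40 * mzv2 7 1"
  using tornheim_0_right [of 4 4] by (simp add: emzv_double_shuffle del: ennreal_plus One_nat_def; simp)

lemma stuffle_mzv_2_6: "mzv1 2 * mzv1 6 = mzv2 2 6 + mzv2 6 2 + mzv1 8"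
  using stuffle_1_1 [of 2 6] by (simp add: emzv_double_shuffle del: ennreal_plus One_nat_def; simp)

lemma stuffle_mzv_3_5: "mzv1 3 * mzv1 5 = mzv2 3 5 + mzv2 5 3 + mzv1 8"
  using stuffle_1_1 [of 3 5] by (simp add: emzv_double_shuffle del: ennreal_plus One_nat_def; simp)

lemma stuffle_mzv_4_4: "mzv1 4 * mzv1 4 = 2 * mzv2 4 4 + mzv1 8"
  using stuffle_1_1 [of 4 4] by (simp add: emzv_double_shuffle del: ennreal_plus One_nat_def; simp)

text \<open>The depth-three relations of weight 8 from here on are the ones combined in the
  evaluation of zeta(4,2,2); those of weight 9 further down serve zeta(5,2,2) in the same
  way.\<close>

lemma hoffman_mzv_1_3_4: "mzv2 3 5 + mzv2 4 4 = mzv3 3 1 4 + mzv3 3 4 1 + mzv3 2 2 4 + mzv3 3 2 3 + mzv3 3 3 2"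
  using tornheim2_1_1 [of 2 4] by (simp add: emzv_double_shuffle del: ennreal_plus One_nat_def; simp)

lemma hoffman_mzv_1_4_3: "mzv2 4 4 + mzv2 5 3 = mzv3 4 1 3 + mzv3 4 3 1 + mzv3 2 3 3 + mzv3 3 2 3 + mzv3 4 2 2"
  using tornheim2_1_1 [of 3 3] by (simp add: emzv_double_shuffle del: ennreal_plus One_nat_def; simp)

lemma hoffman_mzv_1_5_2: "mzv2 5 3 + mzv2 6 2 = mzv3 5 1 2 + mzv3 5 2 1 + mzv3 2 4 2 + mzv3 3 3 2 + mzv3 4 2 2"
  using tornheim2_1_1 [of 4 2] by (simp add: emzv_double_shuffle del: ennreal_plus One_nat_def; simp)

lemma shuffle_mzv_3_4_1: "mzv1 3 * mzv2 4 1 = mzv3 3 4 1 + 5 * mzv3 4 3 1 + 14 * mzv3 5 2 1 + 30 * mzv3 6 1 1 + 4 * mzv3 5 1 2 + mzv3 4 2 2 + mzv3 4 1 3"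
  using tornheim2_0_right [of 3 4 1] by (simp add: emzv_double_shuffle del: ennreal_plus One_nat_def; simp)

lemma shuffle_mzv_4_3_1: "mzv1 4 * mzv2 3 1 = 7 * mzv3 4 3 1 + 16 * mzv3 5 2 1 + 30 * mzv3 6 1 1 + 6 * mzv3 5 1 2 + 3 * mzv3 4 2 2 + 3 * mzv3 4 1 3 + 2 * mzv3 3 4 1 + mzv3 3 3 2 + mzv3 3 2 3 + mzv3 3 1 4"
  using tornheim2_0_right [of 4 3 1] by (simp add: emzv_double_shuffle del: ennreal_plus One_nat_def; simp)

lemma stuffle_mzv_2_2_4: "mzv1 2 * mzv2 2 4 = 2 * mzv3 2 2 4 + mzv3 2 4 2 + mzv2 2 6 + mzv2 4 4"
  using stuffle_1_2 [of 2 2 4] by (simp add: emzv_double_shuffle del: ennreal_plus One_nat_def; simp)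

lemma stuffle_mzv_2_3_3: "mzv1 2 * mzv2 3 3 = mzv3 2 3 3 + mzv3 3 2 3 + mzv3 3 3 2 + mzv2 3 5 + mzv2 5 3"
  using stuffle_1_2 [of 2 3 3] by (simp add: emzv_double_shuffle del: ennreal_plus One_nat_def; simp)

lemma stuffle_mzv_2_4_2: "mzv1 2 * mzv2 4 2 = mzv3 2 4 2 + 2 * mzv3 4 2 2 + mzv2 4 4 + mzv2 6 2"
  using stuffle_1_2 [of 2 4 2] by (simp add: emzv_double_shuffle del: ennreal_plus One_nat_def; simp)

lemma hoffman_mzv_1_8: "mzv1 9 = mzv2 8 1 + mzv2 2 7 + mzv2 3 6 + mzv2 4 5 + mzv2 5 4 + mzv2 6 3 + mzv2 7 2"
  using tornheim_1_1 [of 7] by (simp add: emzv_double_shuffle del: ennreal_plus One_nat_def; simp)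

lemma shuffle_mzv_2_7: "mzv1 2 * mzv1 7 = mzv2 2 7 + 2 * mzv2 3 6 + 3 * mzv2 4 5 + 4 * mzv2 5 4 + 5 * mzv2 6 3 + 7 * mzv2 7 2 + 14 * mzv2 8 1"
  using tornheim_0_right [of 2 7] by (simp add: emzv_double_shuffle del: ennreal_plus One_nat_def; simp)

lemma shuffle_mzv_3_6: "mzv1 3 * mzv1 6 = mzv2 3 6 + 3 * mzv2 4 5 + 6 * mzv2 5 4 + 11 * mzv2 6 3 + 21 * mzv2 7 2 + 42 * mzv2 8 1"
  using tornheim_0_right [of 3 6] by (simp add: emzv_double_shuffle del: ennreal_plus One_nat_def; simp)

lemma shuffle_mzv_4_5: "mzv1 4 * mzv1 5 = mzv2 4 5 + 5 * mzv2 5 4 + 15 * mzv2 6 3 + 35 * mzv2 7 2 + 70 * mzv2 8 1"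
  using tornheim_0_right [of 4 5] by (simp add: emzv_double_shuffle del: ennreal_plus One_nat_def; simp)

lemma stuffle_mzv_2_7: "mzv1 2 * mzv1 7 = mzv2 2 7 + mzv2 7 2 + mzv1 9"
  using stuffle_1_1 [of 2 7] by (simp add: emzv_double_shuffle del: ennreal_plus One_nat_def; simp)

lemma stuffle_mzv_3_6: "mzv1 3 * mzv1 6 = mzv2 3 6 + mzv2 6 3 + mzv1 9"
  using stuffle_1_1 [of 3 6] by (simp add: emzv_double_shuffle del: ennreal_plus One_nat_def; simp)

lemma stuffle_mzv_4_5: "mzv1 4 * mzv1 5 = mzv2 4 5 + mzv2 5 4 + mzv1 9"
  using stuffle_1_1 [of 4 5] by (simp add: emzv_double_shuffle del: ennreal_plus One_nat_def; simp)

lemma hoffman_mzv_1_4_4: "mzv2 4 5 + mzv2 5 4 = mzv3 4 1 4 + mzv3 4 4 1 + mzv3 2 3 4 + mzv3 3 2 4 + mzv3 4 2 3 + mzv3 4 3 2"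
  using tornheim2_1_1 [of 3 4] by (simp add: emzv_double_shuffle del: ennreal_plus One_nat_def; simp)

lemma hoffman_mzv_1_5_3: "mzv2 5 4 + mzv2 6 3 = mzv3 5 1 3 + mzv3 5 3 1 + mzv3 2 4 3 + mzv3 3 3 3 + mzv3 4 2 3 + mzv3 5 2 2"
  using tornheim2_1_1 [of 4 3] by (simp add: emzv_double_shuffle del: ennreal_plus One_nat_def; simp)

lemma shuffle_mzv_2_3_4: "mzv1 2 * mzv2 3 4 = mzv3 2 3 4 + 3 * mzv3 3 2 4 + 6 * mzv3 4 1 4 + 3 * mzv3 4 2 3 + 3 * mzv3 4 3 2 + 6 * mzv3 4 4 1 + 2 * mzv3 3 3 3 + 4 * mzv3 3 4 2 + 8 * mzv3 3 5 1"
  using tornheim2_0_right [of 2 3 4] by (simp add: emzv_double_shuffle del: ennreal_plus One_nat_def; simp)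

lemma shuffle_mzv_2_4_3: "mzv1 2 * mzv2 4 3 = mzv3 2 4 3 + 2 * mzv3 3 3 3 + 4 * mzv3 4 2 3 + 8 * mzv3 5 1 3 + 4 * mzv3 5 2 2 + 8 * mzv3 5 3 1 + 3 * mzv3 4 3 2 + 6 * mzv3 4 4 1"
  using tornheim2_0_right [of 2 4 3] by (simp add: emzv_double_shuffle del: ennreal_plus One_nat_def; simp)

lemma shuffle_mzv_3_3_3: "mzv1 3 * mzv2 3 3 = 3 * mzv3 3 3 3 + 6 * mzv3 4 2 3 + 12 * mzv3 5 1 3 + 6 * mzv3 5 2 2 + 12 * mzv3 5 3 1 + 9 * mzv3 4 3 2 + 18 * mzv3 4 4 1 + 6 * mzv3 3 4 2 + 12 * mzv3 3 5 1"
  using tornheim2_0_right [of 3 3 3] by (simp add: emzv_double_shuffle del: ennreal_plus One_nat_def; simp)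

lemma stuffle_mzv_2_3_4: "mzv1 2 * mzv2 3 4 = mzv3 2 3 4 + mzv3 3 2 4 + mzv3 3 4 2 + mzv2 3 6 + mzv2 5 4"
  using stuffle_1_2 [of 2 3 4] by (simp add: emzv_double_shuffle del: ennreal_plus One_nat_def; simp)

lemma stuffle_mzv_2_4_3: "mzv1 2 * mzv2 4 3 = mzv3 2 4 3 + mzv3 4 2 3 + mzv3 4 3 2 + mzv2 4 5 + mzv2 6 3"
  using stuffle_1_2 [of 2 4 3] by (simp add: emzv_double_shuffle del: ennreal_plus One_nat_def; simp)

lemma stuffle_mzv_3_3_3: "mzv1 3 * mzv2 3 3 = 3 * mzv3 3 3 3 + mzv2 3 6 + mzv2 6 3"
  using stuffle_1_2 [of 3 3 3] by (simp add: emzv_double_shuffle del: ennreal_plus One_nat_def; simp)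

lemma stuffle_mzv_3_4_2: "mzv1 3 * mzv2 4 2 = mzv3 3 4 2 + mzv3 4 3 2 + mzv3 4 2 3 + mzv2 4 5 + mzv2 7 2"
  using stuffle_1_2 [of 3 4 2] by (simp add: emzv_double_shuffle del: ennreal_plus One_nat_def; simp)

lemma stuffle_mzv_3_5_1: "mzv1 3 * mzv2 5 1 = mzv3 3 5 1 + mzv3 5 3 1 + mzv3 5 1 3 + mzv2 5 4 + mzv2 8 1"
  using stuffle_1_2 [of 3 5 1] by (simp add: emzv_double_shuffle del: ennreal_plus One_nat_def; simp)

lemma stuffle_mzv_4_3_2: "mzv1 4 * mzv2 3 2 = mzv3 4 3 2 + mzv3 3 4 2 + mzv3 3 2 4 + mzv2 3 6 + mzv2 7 2"
  using stuffle_1_2 [of 4 3 2] by (simp add: emzv_double_shuffle del: ennreal_plus One_nat_def; simp)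

lemma stuffle_mzv_4_4_1: "mzv1 4 * mzv2 4 1 = 2 * mzv3 4 4 1 + mzv3 4 1 4 + mzv2 4 5 + mzv2 8 1"
  using stuffle_1_2 [of 4 4 1] by (simp add: emzv_double_shuffle del: ennreal_plus One_nat_def; simp)

section \<open>Solving the relations for double and triple zeta values\<close>

lemma mzv2_2_2_eq: "mzv2 2 2 = 3 / 4 * mzv1 4"
  using stuffle_mzv_2_2 by (simp only: mzv1_even algebra_simps; linarith)

lemma mzv2_3_1_eq: "mzv2 3 1 = 1 / 4 * mzv1 4"
  using hoffman_mzv_1_3 stuffle_mzv_2_2 by (simp only: mzv1_even algebra_simps; linarith)

lemma mzv2_2_3_eq: "mzv2 2 3 = - 2 * mzv1 3 * mzv1 2 + 9 / 2 * mzv1 5"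
  using hoffman_mzv_1_4 stuffle_mzv_2_3 shuffle_mzv_2_3 by (simp only: mzv1_even algebra_simps; linarith)

lemma mzv2_3_2_eq: "mzv2 3 2 = 3 * mzv1 3 * mzv1 2 - 11 / 2 * mzv1 5"
  using stuffle_mzv_2_3 hoffman_mzv_1_4 shuffle_mzv_2_3 by (simp only: mzv1_even algebra_simps; linarith)

lemma mzv2_4_1_eq: "mzv2 4 1 = - mzv1 3 * mzv1 2 + 2 * mzv1 5"
  using stuffle_mzv_2_3 hoffman_mzv_1_4 by (simp only: mzv1_even algebra_simps; linarith)

lemma mzv2_2_4_eq: "mzv2 2 4 = - mzv1 3 * mzv1 3 + 25 / 12 * mzv1 6"
  using stuffle_mzv_3_3 shuffle_mzv_3_3 shuffle_mzv_2_4 by (simp only: mzv1_even algebra_simps; linarith)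

lemma mzv2_3_3_eq: "mzv2 3 3 = 1 / 2 * mzv1 3 * mzv1 3 - 1 / 2 * mzv1 6"
  using stuffle_mzv_3_3 by (simp only: mzv1_even algebra_simps; linarith)

lemma mzv2_4_2_eq: "mzv2 4 2 = mzv1 3 * mzv1 3 - 4 / 3 * mzv1 6"
  using shuffle_mzv_3_3 stuffle_mzv_3_3 stuffle_mzv_2_4 shuffle_mzv_2_4 by (simp only: mzv1_even algebra_simps; linarith)

lemma mzv2_5_1_eq: "mzv2 5 1 = - 1 / 2 * mzv1 3 * mzv1 3 + 3 / 4 * mzv1 6"
  using stuffle_mzv_3_3 stuffle_mzv_2_4 hoffman_mzv_1_5 by (simp only: mzv1_even algebra_simps; linarith)

lemma mzv2_2_5_eq: "mzv2 2 5 = - 2 * mzv1 3 * mzv1 4 - 4 * mzv1 5 * mzv1 2 + 10 * mzv1 7"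
  using shuffle_mzv_2_5 shuffle_mzv_3_4 stuffle_mzv_2_5 hoffman_mzv_1_6 stuffle_mzv_3_4 by (simp only: mzv1_even algebra_simps; linarith)

lemma mzv2_3_4_eq: "mzv2 3 4 = mzv1 3 * mzv1 4 + 10 * mzv1 5 * mzv1 2 - 18 * mzv1 7"
  using stuffle_mzv_2_5 shuffle_mzv_3_4 shuffle_mzv_2_5 stuffle_mzv_3_4 hoffman_mzv_1_6 by (simp only: mzv1_even algebra_simps; linarith)

lemma mzv2_4_3_eq: "mzv2 4 3 = - 10 * mzv1 5 * mzv1 2 + 17 * mzv1 7"
  using stuffle_mzv_2_5 stuffle_mzv_3_4 hoffman_mzv_1_6 shuffle_mzv_3_4 shuffle_mzv_2_5 by (simp only: mzv1_even algebra_simps; linarith)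

lemma mzv2_5_2_eq: "mzv2 5 2 = 2 * mzv1 3 * mzv1 4 + 5 * mzv1 5 * mzv1 2 - 11 * mzv1 7"
  using hoffman_mzv_1_6 shuffle_mzv_3_4 shuffle_mzv_2_5 stuffle_mzv_2_5 stuffle_mzv_3_4 by (simp only: mzv1_even algebra_simps; linarith)

lemma mzv2_6_1_eq: "mzv2 6 1 = - mzv1 3 * mzv1 4 - mzv1 5 * mzv1 2 + 3 * mzv1 7"
  using stuffle_mzv_3_4 stuffle_mzv_2_5 hoffman_mzv_1_6 by (simp only: mzv1_even algebra_simps; linarith)

text \<open>Up to weight 7 the double values reduce to products of zeta values. In weight 8
  \<open>mzv2 5 3\<close> is kept as an additional generator, which is how zeta(5,3) enters the
  final formulas.\<close>

lemma mzv2_2_6_eq: "mzv2 2 6 = 2 / 5 * mzv2 5 3 - 2 * mzv1 3 * mzv1 5 + 187 / 60 * mzv1 8"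
  using shuffle_mzv_3_5 shuffle_mzv_4_4 shuffle_mzv_2_6 stuffle_mzv_3_5 by (simp only: mzv1_even algebra_simps; linarith)

lemma mzv2_3_5_eq: "mzv2 3 5 = - mzv2 5 3 + mzv1 3 * mzv1 5 - mzv1 8"
  using stuffle_mzv_3_5 by (simp only: mzv1_even algebra_simps; linarith)

lemma mzv2_4_4_eq: "mzv2 4 4 = 1 / 12 * mzv1 8"
  using stuffle_mzv_4_4 by (simp only: mzv1_even algebra_simps; linarith)

lemma mzv2_6_2_eq: "mzv2 6 2 = - 2 / 5 * mzv2 5 3 + 2 * mzv1 3 * mzv1 5 - 49 / 20 * mzv1 8"
  using stuffle_mzv_2_6 stuffle_mzv_4_4 stuffle_mzv_3_5 shuffle_mzv_3_5 shuffle_mzv_2_6 by (simp only: mzv1_even algebra_simps; linarith)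

lemma mzv2_7_1_eq: "mzv2 7 1 = - mzv1 3 * mzv1 5 + 5 / 4 * mzv1 8"
  using stuffle_mzv_4_4 stuffle_mzv_2_6 stuffle_mzv_3_5 hoffman_mzv_1_7 by (simp only: mzv1_even algebra_simps; linarith)

lemma mzv2_2_7_eq: "mzv2 2 7 = - 2 * mzv1 3 * mzv1 6 - 4 * mzv1 5 * mzv1 4 - 6 * mzv1 7 * mzv1 2 + 35 / 2 * mzv1 9"
  using hoffman_mzv_1_8 shuffle_mzv_4_5 shuffle_mzv_2_7 shuffle_mzv_3_6 stuffle_mzv_4_5 stuffle_mzv_2_7 stuffle_mzv_3_6 by (simp only: mzv1_even algebra_simps; linarith)

lemma mzv2_3_6_eq: "mzv2 3 6 = mzv1 3 * mzv1 6 + 6 * mzv1 5 * mzv1 4 + 21 * mzv1 7 * mzv1 2 - 85 / 2 * mzv1 9"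
  using shuffle_mzv_3_6 stuffle_mzv_2_7 stuffle_mzv_3_6 shuffle_mzv_4_5 hoffman_mzv_1_8 shuffle_mzv_2_7 stuffle_mzv_4_5 by (simp only: mzv1_even algebra_simps; linarith)

lemma mzv2_4_5_eq: "mzv2 4 5 = - 4 * mzv1 5 * mzv1 4 - 35 * mzv1 7 * mzv1 2 + 125 / 2 * mzv1 9"
  using stuffle_mzv_2_7 shuffle_mzv_4_5 shuffle_mzv_2_7 hoffman_mzv_1_8 stuffle_mzv_4_5 shuffle_mzv_3_6 stuffle_mzv_3_6 by (simp only: mzv1_even algebra_simps; linarith)

lemma mzv2_5_4_eq: "mzv2 5 4 = 5 * mzv1 5 * mzv1 4 + 35 * mzv1 7 * mzv1 2 - 127 / 2 * mzv1 9"
  using shuffle_mzv_4_5 stuffle_mzv_2_7 shuffle_mzv_2_7 stuffle_mzv_4_5 hoffman_mzv_1_8 stuffle_mzv_3_6 shuffle_mzv_3_6 by (simp only: mzv1_even algebra_simps; linarith)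

lemma mzv2_6_3_eq: "mzv2 6 3 = - 6 * mzv1 5 * mzv1 4 - 21 * mzv1 7 * mzv1 2 + 83 / 2 * mzv1 9"
  using stuffle_mzv_2_7 shuffle_mzv_4_5 shuffle_mzv_3_6 shuffle_mzv_2_7 hoffman_mzv_1_8 stuffle_mzv_4_5 stuffle_mzv_3_6 by (simp only: mzv1_even algebra_simps; linarith)

lemma mzv2_7_2_eq: "mzv2 7 2 = 2 * mzv1 3 * mzv1 6 + 4 * mzv1 5 * mzv1 4 + 7 * mzv1 7 * mzv1 2 - 37 / 2 * mzv1 9"
  using shuffle_mzv_3_6 shuffle_mzv_2_7 stuffle_mzv_2_7 shuffle_mzv_4_5 stuffle_mzv_3_6 hoffman_mzv_1_8 stuffle_mzv_4_5 by (simp only: mzv1_even algebra_simps; linarith)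

lemma mzv2_8_1_eq: "mzv2 8 1 = - mzv1 3 * mzv1 6 - mzv1 5 * mzv1 4 - mzv1 7 * mzv1 2 + 4 * mzv1 9"
  using stuffle_mzv_4_5 stuffle_mzv_3_6 stuffle_mzv_2_7 hoffman_mzv_1_8 by (simp only: mzv1_even algebra_simps; linarith)

lemmas mzv2_eqs = mzv2_2_2_eq mzv2_3_1_eq mzv2_2_3_eq mzv2_3_2_eq mzv2_4_1_eq mzv2_2_4_eq mzv2_3_3_eq mzv2_4_2_eq mzv2_5_1_eq mzv2_2_5_eq mzv2_3_4_eq mzv2_4_3_eq mzv2_5_2_eq mzv2_6_1_eq mzv2_2_6_eq mzv2_3_5_eq mzv2_4_4_eq mzv2_6_2_eq mzv2_7_1_eq mzv2_2_7_eq mzv2_3_6_eq mzv2_4_5_eq mzv2_5_4_eq mzv2_6_3_eq mzv2_7_2_eq mzv2_8_1_eq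

lemma eq_diff_zero: "(a :: real) = b \<Longrightarrow> a - b = 0" and eq_diff_zero_sym: "a = b \<Longrightarrow> b - a = 0"
  by simp_all

text \<open>An explicit linear certificate: the rational multipliers solve the system requiring
  every triple value except zeta(4,2,2) to cancel. With the double values inserted the equation is a
  polynomial identity, and each bracket is zero by one of the relations.\<close>

lemma mzv3_4_2_2_eq: "mzv3 4 2 2 = - 9 / 5 * mzv2 5 3 + 3 * mzv1 3 * mzv1 3 * mzv1 2 - 11 * mzv1 3 * mzv1 5 + 1193 / 180 * mzv1 8"
proof -
  have "mzv3 4 2 2 - (- 9 / 5 * mzv2 5 3 + 3 * mzv1 3 * mzv1 3 * mzv1 2 - 11 * mzv1 3 * mzv1 5 + 1193 / 180 * mzv1 8) =
      1 * ((mzv2 3 5 + mzv2 4 4) - (mzv3 3 1 4 + mzv3 3 4 1 + mzv3 2 2 4 + mzv3 3 2 3 + mzv3 3 3 2)) +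
      2 * ((mzv2 4 4 + mzv2 5 3) - (mzv3 4 1 3 + mzv3 4 3 1 + mzv3 2 3 3 + mzv3 3 2 3 + mzv3 4 2 2)) +
      2 * ((mzv2 5 3 + mzv2 6 2) - (mzv3 5 1 2 + mzv3 5 2 1 + mzv3 2 4 2 + mzv3 3 3 2 + mzv3 4 2 2)) +
      1 / 2 * ((2 * mzv3 2 2 4 + mzv3 2 4 2 + mzv2 2 6 + mzv2 4 4) - (mzv1 2 * mzv2 2 4)) +
      2 * ((mzv3 2 3 3 + mzv3 3 2 3 + mzv3 3 3 2 + mzv2 3 5 + mzv2 5 3) - (mzv1 2 * mzv2 3 3)) +
      3 / 2 * ((mzv3 2 4 2 + 2 * mzv3 4 2 2 + mzv2 4 4 + mzv2 6 2) - (mzv1 2 * mzv2 4 2)) +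
      (-1) * ((mzv3 3 4 1 + 5 * mzv3 4 3 1 + 14 * mzv3 5 2 1 + 30 * mzv3 6 1 1 + 4 * mzv3 5 1 2 + mzv3 4 2 2 + mzv3 4 1 3) - (mzv1 3 * mzv2 4 1)) +
      1 * ((7 * mzv3 4 3 1 + 16 * mzv3 5 2 1 + 30 * mzv3 6 1 1 + 6 * mzv3 5 1 2 + 3 * mzv3 4 2 2 + 3 * mzv3 4 1 3 + 2 * mzv3 3 4 1 + mzv3 3 3 2 + mzv3 3 2 3 + mzv3 3 1 4) - (mzv1 4 * mzv2 3 1))"
    by ((simp only: mzv2_eqs, simp add: mzv1_even_pi power_numeral_reduce algebra_simps; fail) | (simp add: mzv2_eqs [unfolded One_nat_def] mzv1_even_pi power_numeral_reduce algebra_simps))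
  also have "\<dots> = 0"
    by (simp only: eq_diff_zero [OF hoffman_mzv_1_3_4] eq_diff_zero [OF hoffman_mzv_1_4_3] eq_diff_zero [OF hoffman_mzv_1_5_2] eq_diff_zero_sym [OF stuffle_mzv_2_2_4] eq_diff_zero_sym [OF stuffle_mzv_2_3_3] eq_diff_zero_sym [OF stuffle_mzv_2_4_2] eq_diff_zero_sym [OF shuffle_mzv_3_4_1] eq_diff_zero_sym [OF shuffle_mzv_4_3_1] diff_self mult_zero_right add_0)
  finally show ?thesis by simp
qed

text \<open>The same kind of certificate with twelve relations. The double values of weight 9 are
  all reduced to zeta products, so no additional generator appears here.\<close>

lemma mzv3_5_2_2_eq: "mzv3 5 2 2 = 2 / 3 * mzv1 3 * mzv1 3 * mzv1 3 - 8 / 3 * mzv1 3 * mzv1 6 + 7 / 4 * mzv1 5 * mzv1 4 - 21 * mzv1 7 * mzv1 2 + 2513 / 72 * mzv1 9"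
proof -
  have "mzv3 5 2 2 - (2 / 3 * mzv1 3 * mzv1 3 * mzv1 3 - 8 / 3 * mzv1 3 * mzv1 6 + 7 / 4 * mzv1 5 * mzv1 4 - 21 * mzv1 7 * mzv1 2 + 2513 / 72 * mzv1 9) =
      (-39 / 8) * ((mzv2 4 5 + mzv2 5 4) - (mzv3 4 1 4 + mzv3 4 4 1 + mzv3 2 3 4 + mzv3 3 2 4 + mzv3 4 2 3 + mzv3 4 3 2)) +
      (-41 / 6) * ((mzv2 5 4 + mzv2 6 3) - (mzv3 5 1 3 + mzv3 5 3 1 + mzv3 2 4 3 + mzv3 3 3 3 + mzv3 4 2 3 + mzv3 5 2 2)) +
      (-55 / 16) * ((mzv3 2 3 4 + mzv3 3 2 4 + mzv3 3 4 2 + mzv2 3 6 + mzv2 5 4) - (mzv1 2 * mzv2 3 4)) +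
      (-23 / 16) * ((mzv3 2 3 4 + 3 * mzv3 3 2 4 + 6 * mzv3 4 1 4 + 3 * mzv3 4 2 3 + 3 * mzv3 4 3 2 + 6 * mzv3 4 4 1 + 2 * mzv3 3 3 3 + 4 * mzv3 3 4 2 + 8 * mzv3 3 5 1) - (mzv1 2 * mzv2 3 4)) +
      (-109 / 24) * ((mzv3 2 4 3 + mzv3 4 2 3 + mzv3 4 3 2 + mzv2 4 5 + mzv2 6 3) - (mzv1 2 * mzv2 4 3)) +
      (-55 / 24) * ((mzv3 2 4 3 + 2 * mzv3 3 3 3 + 4 * mzv3 4 2 3 + 8 * mzv3 5 1 3 + 4 * mzv3 5 2 2 + 8 * mzv3 5 3 1 + 3 * mzv3 4 3 2 + 6 * mzv3 4 4 1) - (mzv1 2 * mzv2 4 3)) +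
      (-25 / 72) * ((3 * mzv3 3 3 3 + mzv2 3 6 + mzv2 6 3) - (mzv1 3 * mzv2 3 3)) +
      5 / 9 * ((3 * mzv3 3 3 3 + 6 * mzv3 4 2 3 + 12 * mzv3 5 1 3 + 6 * mzv3 5 2 2 + 12 * mzv3 5 3 1 + 9 * mzv3 4 3 2 + 18 * mzv3 4 4 1 + 6 * mzv3 3 4 2 + 12 * mzv3 3 5 1) - (mzv1 3 * mzv2 3 3)) +
      143 / 48 * ((mzv3 3 4 2 + mzv3 4 3 2 + mzv3 4 2 3 + mzv2 4 5 + mzv2 7 2) - (mzv1 3 * mzv2 4 2)) +
      29 / 6 * ((mzv3 3 5 1 + mzv3 5 3 1 + mzv3 5 1 3 + mzv2 5 4 + mzv2 8 1) - (mzv1 3 * mzv2 5 1)) +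
      23 / 8 * ((mzv3 4 3 2 + mzv3 3 4 2 + mzv3 3 2 4 + mzv2 3 6 + mzv2 7 2) - (mzv1 4 * mzv2 3 2)) +
      15 / 4 * ((2 * mzv3 4 4 1 + mzv3 4 1 4 + mzv2 4 5 + mzv2 8 1) - (mzv1 4 * mzv2 4 1))"
    by ((simp only: mzv2_eqs, simp add: mzv1_even_pi power_numeral_reduce algebra_simps; fail) | (simp add: mzv2_eqs [unfolded One_nat_def] mzv1_even_pi power_numeral_reduce algebra_simps))
  also have "\<dots> = 0"
    by (simp only: eq_diff_zero [OF hoffman_mzv_1_4_4] eq_diff_zero [OF hoffman_mzv_1_5_3] eq_diff_zero_sym [OF stuffle_mzv_2_3_4] eq_diff_zero_sym [OF shuffle_mzv_2_3_4] eq_diff_zero_sym [OF stuffle_mzv_2_4_3] eq_diff_zero_sym [OF shuffle_mzv_2_4_3] eq_diff_zero_sym [OF stuffle_mzv_3_3_3] eq_diff_zero_sym [OF shuffle_mzv_3_3_3] eq_diff_zero_sym [OF stuffle_mzv_3_4_2] eq_diff_zero_sym [OF stuffle_mzv_3_5_1] eq_diff_zero_sym [OF stuffle_mzv_4_3_2] eq_diff_zero_sym [OF stuffle_mzv_4_4_1] diff_self mult_zero_right add_0)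
  finally show ?thesis by simp
qed

section \<open>Taylor coefficients of the closed form and the seven sums\<close>

lemma zeta_eq_zeta_n:
  "zeta 2 = zeta_n 2" "zeta 3 = zeta_n 3" "zeta 4 = zeta_n 4" "zeta 5 = zeta_n 5" "zeta 6 = zeta_n 6" "zeta 7 = zeta_n 7" "zeta 8 = zeta_n 8" "zeta 9 = zeta_n 9"
  unfolding zeta_eq_mzv1 by (simp_all add: zeta_n_eq_mzv1)

lemma of_real_mzv1:
  "complex_of_real (mzv1 3) = zeta_n 3" "complex_of_real (mzv1 5) = zeta_n 5" "complex_of_real (mzv1 7) = zeta_n 7" "complex_of_real (mzv1 9) = zeta_n 9"
  by (simp_all add: zeta_n_eq_mzv1)

text \<open>zeta(5,3) enters only in order 5, through zeta(6,2) and zeta(4,2,2): its coefficient is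
  (-4)(-2/5) + 16(-9/5) = -136/5.\<close>

lemma product_coeff_4_1_values:
  "product_coeff 4 1 0 = zeta_n 3"
  "product_coeff 4 1 (Suc 0) = 1 / 90 * of_real pi ^ 4"
  "product_coeff 4 1 2 = - 2 * of_real pi ^ 2 * zeta_n 3 + 23 * zeta_n 5"
  "product_coeff 4 1 3 = 19 / 2835 * of_real pi ^ 6 - 4 * zeta_n 3 ^ 2"
  "product_coeff 4 1 4 = 14 / 45 * of_real pi ^ 4 * zeta_n 3 - 70 / 3 * of_real pi ^ 2 * zeta_n 5 + 202 * zeta_n 7"
  "product_coeff 4 1 5 = 2629 / 212625 * of_real pi ^ 8 + 8 * of_real pi ^ 2 * zeta_n 3 ^ 2 - 184 * zeta_n 3 * zeta_n 5 - 136 / 5 * of_real (mzv2 5 3)"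
  "product_coeff 4 1 6 = - 52 / 567 * of_real pi ^ 6 * zeta_n 3 + 62 / 15 * of_real pi ^ 4 * zeta_n 5 - 560 / 3 * of_real pi ^ 2 * zeta_n 7 + 32 / 3 * zeta_n 3 ^ 3 + 13729 / 9 * zeta_n 9"
proof -
  have 0: "complex_of_real (zeta_twos 0 s) = zeta_n s" if "2 \<le> s" for s
    using that by (simp add: zeta_n_eq_mzv1 mzv1_eq_zeta_twos)
  have 1: "zeta_twos 1 s = mzv2 s 2" if "2 \<le> s" for s
    using that by (simp add: mzv2_eq_zeta_twos)
  have 2: "zeta_twos 2 4 = mzv3 4 2 2" "zeta_twos 2 5 = mzv3 5 2 2"
    by (simp_all add: mzv3_eq_zeta_twos)
  note zeta_twos_values = mzv2_3_2_eq mzv2_4_2_eq mzv2_5_2_eq mzv2_6_2_eq mzv2_7_2_eq mzv3_4_2_2_eq mzv3_5_2_2_eq mzv1_even_pi of_real_mzv1 zeta_twos_3_values zeta_n_even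
  show "product_coeff 4 1 0 = zeta_n 3"
    unfolding product_coeff_4_1 by (simp add: 0 2 1 [unfolded One_nat_def] zeta_twos_values power_numeral_reduce algebra_simps)
  show "product_coeff 4 1 (Suc 0) = 1 / 90 * of_real pi ^ 4"
    unfolding product_coeff_4_1 [unfolded One_nat_def] by (simp add: 0 2 1 [unfolded One_nat_def] zeta_twos_values power_numeral_reduce algebra_simps)
  show "product_coeff 4 1 2 = - 2 * of_real pi ^ 2 * zeta_n 3 + 23 * zeta_n 5"
    unfolding product_coeff_4_1 by (simp add: 0 2 1 [unfolded One_nat_def] zeta_twos_values power_numeral_reduce algebra_simps)
  show "product_coeff 4 1 3 = 19 / 2835 * of_real pi ^ 6 - 4 * zeta_n 3 ^ 2"
    unfolding product_coeff_4_1 by (simp add: 0 2 1 [unfolded One_nat_def] zeta_twos_values power_numeral_reduce algebra_simps)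
  show "product_coeff 4 1 4 = 14 / 45 * of_real pi ^ 4 * zeta_n 3 - 70 / 3 * of_real pi ^ 2 * zeta_n 5 + 202 * zeta_n 7"
    unfolding product_coeff_4_1 by (simp add: 0 2 1 [unfolded One_nat_def] zeta_twos_values power_numeral_reduce algebra_simps)
  show "product_coeff 4 1 5 = 2629 / 212625 * of_real pi ^ 8 + 8 * of_real pi ^ 2 * zeta_n 3 ^ 2 - 184 * zeta_n 3 * zeta_n 5 - 136 / 5 * of_real (mzv2 5 3)"
    unfolding product_coeff_4_1 by (simp add: 0 2 1 [unfolded One_nat_def] zeta_twos_values power_numeral_reduce algebra_simps)
  show "product_coeff 4 1 6 = - 52 / 567 * of_real pi ^ 6 * zeta_n 3 + 62 / 15 * of_real pi ^ 4 * zeta_n 5 - 560 / 3 * of_real pi ^ 2 * zeta_n 7 + 32 / 3 * zeta_n 3 ^ 3 + 13729 / 9 * zeta_n 9"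
    unfolding product_coeff_4_1 by (simp add: 0 2 1 [unfolded One_nat_def] zeta_twos_values power_numeral_reduce algebra_simps)
qed

text \<open>The closed form says that 4 N_m/m! is minus the coefficient of order m + 2 in E H.
  Naming the intermediate series \<open>T\<close>, \<open>B\<close>, \<open>C\<close>,
  \<open>H\<close> keeps each stage to a single product or linear combination with explicit
  coefficients.\<close>

lemma f4_series_series_coeffs:
  fixes N :: "nat \<Rightarrow> complex"
  defines "N m \<equiv> (\<Sum>k. nth_deriv m f4 (real (Suc k)))"
  shows "N 1 = - 1 / 12 * of_real pi ^ 3 * \<i> + 7 / 2 * zeta_n 3"
    "N 2 = - 1 / 6 * of_real pi ^ 4 + 7 * of_real pi * zeta_n 3 * \<i>"
    "N 3 = - 2 / 3 * of_real pi ^ 5 * \<i> - 21 * of_real pi ^ 2 * zeta_n 3 + 279 * zeta_n 5"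
    "N 4 = - 10 / 21 * of_real pi ^ 6 - 56 * of_real pi ^ 3 * zeta_n 3 * \<i> + 1116 * of_real pi * zeta_n 5 * \<i> + 336 * zeta_n 3 ^ 2"
    "N 5 = - 148 / 21 * of_real pi ^ 7 * \<i> + 84 * of_real pi ^ 4 * zeta_n 3 - 5580 * of_real pi ^ 2 * zeta_n 5 + 1680 * of_real pi * zeta_n 3 ^ 2 * \<i> + 45720 * zeta_n 7"
    "N 6 = 244 / 525 * of_real pi ^ 8 - 22320 * of_real pi ^ 3 * zeta_n 5 * \<i> - 10080 * of_real pi ^ 2 * zeta_n 3 ^ 2 + 274320 * of_real pi * zeta_n 7 * \<i> + 120960 * zeta_n 3 * zeta_n 5 - 29376 * of_real (mzv2 5 3)"
    "N 7 = - 8156 / 75 * of_real pi ^ 9 * \<i> - 896 / 3 * of_real pi ^ 6 * zeta_n 3 + 46872 * of_real pi ^ 4 * zeta_n 5 - 47040 * of_real pi ^ 3 * zeta_n 3 ^ 2 * \<i> - 1920240 * of_real pi ^ 2 * zeta_n 7 + 846720 * of_real pi * zeta_n 3 * zeta_n 5 * \<i> - 205632 * of_real pi * of_real (mzv2 5 3) * \<i> + 188160 * zeta_n 3 ^ 3 + 14287560 * zeta_n 9"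
proof -
  obtain s where s: "(\<lambda>z. Gamma (1 + z) * Gamma (1 - z)) has_fps_expansion s" and "fps_nth s 0 = 1"
    and "fps_deriv s = s * Abs_fps (\<lambda>n. if odd n then 2 * zeta_n (n + 1) else 0)"
    by (rule Gamma_reflected_expansion)
  obtain g where g: "(\<lambda>z. Gamma (1 + z) ^ 3 / Gamma (1 + 3 * z)) has_fps_expansion g" and g0: "fps_nth g 0 = 1"
    and g': "fps_deriv g = g * Abs_fps (\<lambda>n. if n = 0 then 0 else (-1) ^ (n + 1) * (3 - 3 ^ (n + 1)) * zeta_n (n + 1))"
    by (rule Gamma_cube_quotient_expansion)
  define s2 where "s2 = Abs_fps (\<lambda>n. 2 ^ n * fps_nth s n)"
  define T where "T = 1 + fps_const 4 * fps_X ^ 3 * Abs_fps (product_coeff 4 1)"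
  define B where "B = s2 * T"
  define C where "C = fps_const (1 / 2) - fps_const (3 / 2) * B"
  define H where "H = s * s2 + g * C"
  define E where "E = fps_exp (of_real pi * \<i>)"
  note sc = reflected_coeffs [OF s]
  note gc = g0 Gamma_cube_quotient_coeffs [OF g0 g']
  have s2c: "fps_nth s2 0 = 1"
    "fps_nth s2 (Suc 0) = 0"
    "fps_nth s2 2 = 2 / 3 * of_real pi ^ 2"
    "fps_nth s2 3 = 0"
    "fps_nth s2 4 = 14 / 45 * of_real pi ^ 4"
    "fps_nth s2 5 = 0"
    "fps_nth s2 6 = 124 / 945 * of_real pi ^ 6"
    "fps_nth s2 7 = 0"
    "fps_nth s2 8 = 254 / 4725 * of_real pi ^ 8"
    "fps_nth s2 9 = 0"
    unfolding s2_def by (simp_all add: sc)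
  have Tc: "fps_nth T 0 = 1"
    "fps_nth T (Suc 0) = 0"
    "fps_nth T 2 = 0"
    "fps_nth T 3 = 4 * zeta_n 3"
    "fps_nth T 4 = 2 / 45 * of_real pi ^ 4"
    "fps_nth T 5 = - 8 * of_real pi ^ 2 * zeta_n 3 + 92 * zeta_n 5"
    "fps_nth T 6 = 76 / 2835 * of_real pi ^ 6 - 16 * zeta_n 3 ^ 2"
    "fps_nth T 7 = 56 / 45 * of_real pi ^ 4 * zeta_n 3 - 280 / 3 * of_real pi ^ 2 * zeta_n 5 + 808 * zeta_n 7"
    "fps_nth T 8 = 10516 / 212625 * of_real pi ^ 8 + 32 * of_real pi ^ 2 * zeta_n 3 ^ 2 - 736 * zeta_n 3 * zeta_n 5 - 544 / 5 * of_real (mzv2 5 3)"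
    "fps_nth T 9 = - 208 / 567 * of_real pi ^ 6 * zeta_n 3 + 248 / 15 * of_real pi ^ 4 * zeta_n 5 - 2240 / 3 * of_real pi ^ 2 * zeta_n 7 + 128 / 3 * zeta_n 3 ^ 3 + 54916 / 9 * zeta_n 9"
    unfolding T_def by (simp_all add: mult.assoc fps_X_power_mult_nth product_coeff_4_1_values algebra_simps flip: numeral_2_eq_2)
  have Bc: "fps_nth B 0 = 1"
    "fps_nth B (Suc 0) = 0"
    "fps_nth B 2 = 2 / 3 * of_real pi ^ 2"
    "fps_nth B 3 = 4 * zeta_n 3"
    "fps_nth B 4 = 16 / 45 * of_real pi ^ 4"
    "fps_nth B 5 = - 16 / 3 * of_real pi ^ 2 * zeta_n 3 + 92 * zeta_n 5"
    "fps_nth B 6 = 76 / 405 * of_real pi ^ 6 - 16 * zeta_n 3 ^ 2"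
    "fps_nth B 7 = - 128 / 45 * of_real pi ^ 4 * zeta_n 3 - 32 * of_real pi ^ 2 * zeta_n 5 + 808 * zeta_n 7"
    "fps_nth B 8 = 1366 / 10125 * of_real pi ^ 8 + 64 / 3 * of_real pi ^ 2 * zeta_n 3 ^ 2 - 736 * zeta_n 3 * zeta_n 5 - 544 / 5 * of_real (mzv2 5 3)"
    "fps_nth B 9 = - 608 / 405 * of_real pi ^ 6 * zeta_n 3 - 256 / 15 * of_real pi ^ 4 * zeta_n 5 - 208 * of_real pi ^ 2 * zeta_n 7 + 128 / 3 * zeta_n 3 ^ 3 + 54916 / 9 * zeta_n 9"
    unfolding B_def fps_mult_nth_numeral s2c Tc by (simp_all add: power_numeral_reduce algebra_simps)
  have Cc: "fps_nth C 0 = - 1"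
    "fps_nth C (Suc 0) = 0"
    "fps_nth C 2 = - 1 * of_real pi ^ 2"
    "fps_nth C 3 = - 6 * zeta_n 3"
    "fps_nth C 4 = - 8 / 15 * of_real pi ^ 4"
    "fps_nth C 5 = 8 * of_real pi ^ 2 * zeta_n 3 - 138 * zeta_n 5"
    "fps_nth C 6 = - 38 / 135 * of_real pi ^ 6 + 24 * zeta_n 3 ^ 2"
    "fps_nth C 7 = 64 / 15 * of_real pi ^ 4 * zeta_n 3 + 48 * of_real pi ^ 2 * zeta_n 5 - 1212 * zeta_n 7"
    "fps_nth C 8 = - 683 / 3375 * of_real pi ^ 8 - 32 * of_real pi ^ 2 * zeta_n 3 ^ 2 + 1104 * zeta_n 3 * zeta_n 5 + 816 / 5 * of_real (mzv2 5 3)"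
    "fps_nth C 9 = 304 / 135 * of_real pi ^ 6 * zeta_n 3 + 128 / 5 * of_real pi ^ 4 * zeta_n 5 + 312 * of_real pi ^ 2 * zeta_n 7 - 64 * zeta_n 3 ^ 3 - 27458 / 3 * zeta_n 9"
    unfolding C_def fps_sub_nth fps_mult_left_const_nth Bc by (simp_all add: algebra_simps)
  have Gc: "fps_nth (g * C) 0 = - 1"
    "fps_nth (g * C) (Suc 0) = 0"
    "fps_nth (g * C) 2 = - 1 / 2 * of_real pi ^ 2"
    "fps_nth (g * C) 3 = - 14 * zeta_n 3"
    "fps_nth (g * C) 4 = 7 / 120 * of_real pi ^ 4"
    "fps_nth (g * C) 5 = 7 * of_real pi ^ 2 * zeta_n 3 - 186 * zeta_n 5"
    "fps_nth (g * C) 6 = 355 / 3024 * of_real pi ^ 6 - 56 * zeta_n 3 ^ 2"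
    "fps_nth (g * C) 7 = 77 / 60 * of_real pi ^ 4 * zeta_n 3 + 93 * of_real pi ^ 2 * zeta_n 5 - 1524 * zeta_n 7"
    "fps_nth (g * C) 8 = 155837 / 3024000 * of_real pi ^ 8 + 28 * of_real pi ^ 2 * zeta_n 3 ^ 2 - 672 * zeta_n 3 * zeta_n 5 + 816 / 5 * of_real (mzv2 5 3)"
    "fps_nth (g * C) 9 = 613 / 1080 * of_real pi ^ 6 * zeta_n 3 + 341 / 20 * of_real pi ^ 4 * zeta_n 5 + 762 * of_real pi ^ 2 * zeta_n 7 - 448 / 3 * zeta_n 3 ^ 3 - 34018 / 3 * zeta_n 9"
    unfolding fps_mult_nth_numeral gc Cc by (simp_all add: power_numeral_reduce algebra_simps)
  have Ac: "fps_nth (s * s2) 0 = 1"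
    "fps_nth (s * s2) (Suc 0) = 0"
    "fps_nth (s * s2) 2 = 5 / 6 * of_real pi ^ 2"
    "fps_nth (s * s2) 3 = 0"
    "fps_nth (s * s2) 4 = 53 / 120 * of_real pi ^ 4"
    "fps_nth (s * s2) 5 = 0"
    "fps_nth (s * s2) 6 = 599 / 3024 * of_real pi ^ 6"
    "fps_nth (s * s2) 7 = 0"
    "fps_nth (s * s2) 8 = 7193 / 86400 * of_real pi ^ 8"
    "fps_nth (s * s2) 9 = 0"
    unfolding fps_mult_nth_numeral sc s2c by (simp_all add: power_numeral_reduce algebra_simps)
  \<comment> \<open>Orders 0 and 1 vanish, as they must, since E H is divisible by X^2 and E has
    constant term 1.\<close>
  have Hc: "fps_nth H 0 = 0"
    "fps_nth H (Suc 0) = 0"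
    "fps_nth H 2 = 1 / 3 * of_real pi ^ 2"
    "fps_nth H 3 = - 14 * zeta_n 3"
    "fps_nth H 4 = 1 / 2 * of_real pi ^ 4"
    "fps_nth H 5 = 7 * of_real pi ^ 2 * zeta_n 3 - 186 * zeta_n 5"
    "fps_nth H 6 = 53 / 168 * of_real pi ^ 6 - 56 * zeta_n 3 ^ 2"
    "fps_nth H 7 = 77 / 60 * of_real pi ^ 4 * zeta_n 3 + 93 * of_real pi ^ 2 * zeta_n 5 - 1524 * zeta_n 7"
    "fps_nth H 8 = 1887 / 14000 * of_real pi ^ 8 + 28 * of_real pi ^ 2 * zeta_n 3 ^ 2 - 672 * zeta_n 3 * zeta_n 5 + 816 / 5 * of_real (mzv2 5 3)"
    "fps_nth H 9 = 613 / 1080 * of_real pi ^ 6 * zeta_n 3 + 341 / 20 * of_real pi ^ 4 * zeta_n 5 + 762 * of_real pi ^ 2 * zeta_n 7 - 448 / 3 * zeta_n 3 ^ 3 - 34018 / 3 * zeta_n 9"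
    unfolding H_def fps_add_nth Gc Ac by (simp_all add: algebra_simps)
  have Ec: "fps_nth E 0 = 1"
    "fps_nth E (Suc 0) = of_real pi * \<i>"
    "fps_nth E 2 = - 1 / 2 * of_real pi ^ 2"
    "fps_nth E 3 = - 1 / 6 * of_real pi ^ 3 * \<i>"
    "fps_nth E 4 = 1 / 24 * of_real pi ^ 4"
    "fps_nth E 5 = 1 / 120 * of_real pi ^ 5 * \<i>"
    "fps_nth E 6 = - 1 / 720 * of_real pi ^ 6"
    "fps_nth E 7 = - 1 / 5040 * of_real pi ^ 7 * \<i>"
    "fps_nth E 8 = 1 / 40320 * of_real pi ^ 8"
    "fps_nth E 9 = 1 / 362880 * of_real pi ^ 9 * \<i>"
    unfolding E_def by (simp_all add: fact_numeral power_numeral_reduce algebra_simps)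
  have "fps_const 4 * fps_X ^ 2 * Abs_fps (\<lambda>m. N m / fact m) = - E * H"
    using f4_series_series [OF s g] unfolding s2_def [symmetric] N_def E_def H_def C_def B_def T_def by (simp only: mult.assoc)
  hence F: "4 * (N m / fact m) = - fps_nth (E * H) (m + 2)" for m
  proof -
    assume "fps_const 4 * fps_X ^ 2 * Abs_fps (\<lambda>m. N m / fact m) = - E * H"
    hence "fps_nth (fps_const 4 * (fps_X ^ 2 * Abs_fps (\<lambda>m. N m / fact m))) (m + 2) = fps_nth (- (E * H)) (m + 2)"
      by (simp only: mult.assoc mult_minus_left)
    thus ?thesis by (simp add: fps_X_power_mult_nth)
  qed
  have scale: "a = f / 4 * b" if "4 * (a / f) = b" "f \<noteq> 0" for a b f :: complex
    unfolding that(1) [symmetric] using that(2) by simp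
  have P1: "fps_nth (E * H) 3 = 1 / 3 * of_real pi ^ 3 * \<i> - 14 * zeta_n 3"
    unfolding fps_mult_nth_numeral Ec Hc by (simp add: power_numeral_reduce algebra_simps)
  have "4 * (N 1 / fact 1) = - fps_nth (E * H) 3" using F [of 1] by (simp add: numeral_3_eq_3)
  hence "N 1 = fact 1 / 4 * (- fps_nth (E * H) 3)" by (rule scale) simp
  thus "N 1 = - 1 / 12 * of_real pi ^ 3 * \<i> + 7 / 2 * zeta_n 3"
    unfolding P1 by (simp add: fact_numeral power_numeral_reduce algebra_simps)
  have P2: "fps_nth (E * H) 4 = 1 / 3 * of_real pi ^ 4 - 14 * of_real pi * zeta_n 3 * \<i>"
    unfolding fps_mult_nth_numeral Ec Hc by (simp add: power_numeral_reduce algebra_simps)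
  have "4 * (N 2 / fact 2) = - fps_nth (E * H) 4" using F [of 2] by simp
  hence "N 2 = fact 2 / 4 * (- fps_nth (E * H) 4)" by (rule scale) simp
  thus "N 2 = - 1 / 6 * of_real pi ^ 4 + 7 * of_real pi * zeta_n 3 * \<i>"
    unfolding P2 by (simp add: fact_numeral power_numeral_reduce algebra_simps)
  have P3: "fps_nth (E * H) 5 = 4 / 9 * of_real pi ^ 5 * \<i> + 14 * of_real pi ^ 2 * zeta_n 3 - 186 * zeta_n 5"
    unfolding fps_mult_nth_numeral Ec Hc by (simp add: power_numeral_reduce algebra_simps)
  have "4 * (N 3 / fact 3) = - fps_nth (E * H) 5" using F [of 3] by simp
  hence "N 3 = fact 3 / 4 * (- fps_nth (E * H) 5)" by (rule scale) simp
  thus "N 3 = - 2 / 3 * of_real pi ^ 5 * \<i> - 21 * of_real pi ^ 2 * zeta_n 3 + 279 * zeta_n 5"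
    unfolding P3 by (simp add: fact_numeral power_numeral_reduce algebra_simps)
  have P4: "fps_nth (E * H) 6 = 5 / 63 * of_real pi ^ 6 + 28 / 3 * of_real pi ^ 3 * zeta_n 3 * \<i> - 186 * of_real pi * zeta_n 5 * \<i> - 56 * zeta_n 3 ^ 2"
    unfolding fps_mult_nth_numeral Ec Hc by (simp add: power_numeral_reduce algebra_simps)
  have "4 * (N 4 / fact 4) = - fps_nth (E * H) 6" using F [of 4] by simp
  hence "N 4 = fact 4 / 4 * (- fps_nth (E * H) 6)" by (rule scale) simp
  thus "N 4 = - 10 / 21 * of_real pi ^ 6 - 56 * of_real pi ^ 3 * zeta_n 3 * \<i> + 1116 * of_real pi * zeta_n 5 * \<i> + 336 * zeta_n 3 ^ 2"
    unfolding P4 by (simp add: fact_numeral power_numeral_reduce algebra_simps)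
  have P5: "fps_nth (E * H) 7 = 74 / 315 * of_real pi ^ 7 * \<i> - 14 / 5 * of_real pi ^ 4 * zeta_n 3 + 186 * of_real pi ^ 2 * zeta_n 5 - 56 * of_real pi * zeta_n 3 ^ 2 * \<i> - 1524 * zeta_n 7"
    unfolding fps_mult_nth_numeral Ec Hc by (simp add: power_numeral_reduce algebra_simps)
  have "4 * (N 5 / fact 5) = - fps_nth (E * H) 7" using F [of 5] by simp
  hence "N 5 = fact 5 / 4 * (- fps_nth (E * H) 7)" by (rule scale) simp
  thus "N 5 = - 148 / 21 * of_real pi ^ 7 * \<i> + 84 * of_real pi ^ 4 * zeta_n 3 - 5580 * of_real pi ^ 2 * zeta_n 5 + 1680 * of_real pi * zeta_n 3 ^ 2 * \<i> + 45720 * zeta_n 7"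
    unfolding P5 by (simp add: fact_numeral power_numeral_reduce algebra_simps)
  \<comment> \<open>The factor -720/4 turns 816/5 into -29376 = -72 * 408, the coefficient of
    zeta(5,3) in the sixth formula.\<close>
  have P6: "fps_nth (E * H) 8 = - 61 / 23625 * of_real pi ^ 8 + 124 * of_real pi ^ 3 * zeta_n 5 * \<i> + 56 * of_real pi ^ 2 * zeta_n 3 ^ 2 - 1524 * of_real pi * zeta_n 7 * \<i> - 672 * zeta_n 3 * zeta_n 5 + 816 / 5 * of_real (mzv2 5 3)"
    unfolding fps_mult_nth_numeral Ec Hc by (simp add: power_numeral_reduce algebra_simps)
  have "4 * (N 6 / fact 6) = - fps_nth (E * H) 8" using F [of 6] by simp
  hence "N 6 = fact 6 / 4 * (- fps_nth (E * H) 8)" by (rule scale) simp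
  thus "N 6 = 244 / 525 * of_real pi ^ 8 - 22320 * of_real pi ^ 3 * zeta_n 5 * \<i> - 10080 * of_real pi ^ 2 * zeta_n 3 ^ 2 + 274320 * of_real pi * zeta_n 7 * \<i> + 120960 * zeta_n 3 * zeta_n 5 - 29376 * of_real (mzv2 5 3)"
    unfolding P6 by (simp add: fact_numeral power_numeral_reduce algebra_simps)
  have P7: "fps_nth (E * H) 9 = 2039 / 23625 * of_real pi ^ 9 * \<i> + 32 / 135 * of_real pi ^ 6 * zeta_n 3 - 186 / 5 * of_real pi ^ 4 * zeta_n 5 + 112 / 3 * of_real pi ^ 3 * zeta_n 3 ^ 2 * \<i> + 1524 * of_real pi ^ 2 * zeta_n 7 - 672 * of_real pi * zeta_n 3 * zeta_n 5 * \<i> + 816 / 5 * of_real pi * of_real (mzv2 5 3) * \<i> - 448 / 3 * zeta_n 3 ^ 3 - 34018 / 3 * zeta_n 9"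
    unfolding fps_mult_nth_numeral Ec Hc by (simp add: power_numeral_reduce algebra_simps)
  have "4 * (N 7 / fact 7) = - fps_nth (E * H) 9" using F [of 7] by simp
  hence "N 7 = fact 7 / 4 * (- fps_nth (E * H) 9)" by (rule scale) simp
  thus "N 7 = - 8156 / 75 * of_real pi ^ 9 * \<i> - 896 / 3 * of_real pi ^ 6 * zeta_n 3 + 46872 * of_real pi ^ 4 * zeta_n 5 - 47040 * of_real pi ^ 3 * zeta_n 3 ^ 2 * \<i> - 1920240 * of_real pi ^ 2 * zeta_n 7 + 846720 * of_real pi * zeta_n 3 * zeta_n 5 * \<i> - 205632 * of_real pi * of_real (mzv2 5 3) * \<i> + 188160 * zeta_n 3 ^ 3 + 14287560 * zeta_n 9"
    unfolding P7 by (simp add: fact_numeral power_numeral_reduce algebra_simps)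
qed

text \<open>Both sides are compared after writing even zeta values as rational multiples of powers
  of pi. In the sixth sum this gives -10080 pi^2/72 = -140 pi^2 = -840 zeta(2) as the factor of
  zeta(3)^2, so the coefficient proved is 840, where the English statement prints 84.\<close>

theorem theorem1p6:
  shows "(\<forall>m\<in>{1..7}. summable (\<lambda>k. nth_deriv m f4 (real (Suc k)))) \<and>
    (\<Sum>k. nth_deriv 1 f4 (real (Suc k))) =
      7 / 2 * zeta 3 - of_real pi ^ 3 / 12 * \<i> \<and>
    (\<Sum>k. nth_deriv 2 f4 (real (Suc k))) =
      7 * of_real pi * zeta 3 * \<i> - 15 * zeta 4 \<and>
    (\<Sum>k. nth_deriv 3 f4 (real (Suc k))) =
      279 * zeta 5 - 21 * of_real pi ^ 2 * zeta 3 - 2 / 3 * of_real pi ^ 5 * \<i> \<and>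
    (\<Sum>k. nth_deriv 4 f4 (real (Suc k))) =
      6 * (56 * zeta 3 ^ 2 - 75 * zeta 6)
      + 4 * of_real pi * \<i> * (279 * zeta 5 - 14 * of_real pi ^ 2 * zeta 3) \<and>
    (\<Sum>k. nth_deriv 5 f4 (real (Suc k))) =
      360 * (127 * zeta 7 + 21 * zeta 3 * zeta 4 - 93 * zeta 2 * zeta 5)
      + 60 * of_real pi * \<i> * (28 * zeta 3 ^ 2 - 111 * zeta 6) \<and>
    1 / 72 * (\<Sum>k. nth_deriv 6 f4 (real (Suc k))) =
      61 * zeta 8 - 840 * zeta 2 * zeta 3 ^ 2 + 1680 * zeta 3 * zeta 5 - 408 * double_zeta 5 3
      + 30 * of_real pi * \<i> * (127 * zeta 7 - 62 * zeta 2 * zeta 5) \<and>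
    1 / 168 * (\<Sum>k. nth_deriv 7 f4 (real (Suc k))) =
      5 * (17009 * zeta 9 + 224 * zeta 3 ^ 3 - 13716 * zeta 2 * zeta 7
           - 336 * zeta 3 * zeta 6 + 5022 * zeta 4 * zeta 5)
      + 3 * of_real pi * \<i> * (1680 * zeta 3 * zeta 5 - 408 * double_zeta 5 3
           - 560 * zeta 2 * zeta 3 ^ 2 - 2039 * zeta 8)"
proof (intro conjI ballI)
  show "summable (\<lambda>k. nth_deriv m f4 (real (Suc k)))" for m by (rule f4_series_expansion(2))
qed (unfold f4_series_series_coeffs zeta_eq_zeta_n zeta_n_even, simp_all add: double_zeta_eq_mzv2 power_numeral_reduce algebra_simps)

end
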